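(* Let $p$ be a prime number, let $C$ be a group of prime order $p$, and let $A$ be the ring of integers of an unramified finite extension of $\mathbf{Q}_p$. Let $M$ be a finite $A[C]$-module. Then $$\#M \,\le\, \#\,A[C]/\mathrm{Fit}_{A[C]}(M).$$ If the ideal $\mathrm{Fit}_{A[C]}(M)$ is a principal ideal of $A[C]$, then equality holds.
   Context: $A[C]$ denotes the group ring. "Finite module" means a module whose underlying set is finite, and $\#$ denotes cardinality. For a commutative ring $R$ with identity and a finitely generated $R$-module $M$, choose a surjective $R$-morphism $f:R^t\to M$; the $R$-Fitting ideal $\mathrm{Fit}_R(M)$ is the ideal of $R$ generated by all $\det(v_1,\dots,v_t)$ with $v_1,\dots,v_t\in\mathrm{Ker}\, f$. It does not depend on the choice of $f$. *)

theory Defs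
  imports
    Complex_Main
    "HOL-Computational_Algebra.Primes"
    "HOL-Combinatorics.Permutations"
    "HOL-Algebra.Finite_Extensions"
    "HOL-Algebra.QuotRing"
begin

section \<open>The field of p-adic numbers\<close>

text \<open>The field \<open>Q\<^sub>p\<close> is the completion of the rationals for the p-adic absolute value: Cauchy
  sequences modulo null sequences.\<close>

definition padic_val :: "nat \<Rightarrow> rat \<Rightarrow> int" where
  "padic_val p x =
     int (multiplicity (int p) (fst (quotient_of x))) - int (multiplicity (int p) (snd (quotient_of x)))"

definition padic_abs :: "nat \<Rightarrow> rat \<Rightarrow> real" where
  "padic_abs p x = (if x = 0 then 0 else real p powi (- padic_val p x))"

definition padic_Cauchy :: "nat \<Rightarrow> (nat \<Rightarrow> rat) \<Rightarrow> bool" where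
  "padic_Cauchy p s \<longleftrightarrow> (\<forall>e>0. \<exists>N. \<forall>m\<ge>N. \<forall>n\<ge>N. padic_abs p (s m - s n) < e)"

definition padic_Cauchy_ring :: "nat \<Rightarrow> (nat \<Rightarrow> rat) ring" where
  "padic_Cauchy_ring p =
     \<lparr>carrier = {s. padic_Cauchy p s},
      mult = (\<lambda>s t n. s n * t n), one = (\<lambda>n. 1),
      zero = (\<lambda>n. 0), add = (\<lambda>s t n. s n + t n)\<rparr>"

definition padic_null :: "nat \<Rightarrow> (nat \<Rightarrow> rat) set" where
  "padic_null p = {s. (\<lambda>n. padic_abs p (s n)) \<longlonglongrightarrow> 0}"

definition Qp :: "nat \<Rightarrow> (nat \<Rightarrow> rat) set ring" where
  "Qp p = padic_Cauchy_ring p Quot padic_null p"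

text \<open>The absolute value of a class is the limit of the absolute values along any of its
  representatives.\<close>

definition Qp_abs :: "nat \<Rightarrow> (nat \<Rightarrow> rat) set \<Rightarrow> real" where
  "Qp_abs p a = lim (\<lambda>n. padic_abs p ((SOME s. s \<in> a) n))"

definition Zp :: "nat \<Rightarrow> (nat \<Rightarrow> rat) set set" where
  "Zp p = {a \<in> carrier (Qp p). Qp_abs p a \<le> 1}"


section \<open>Finite extensions of the p-adic numbers and their rings of integers\<close>

text \<open>An extension is a field \<open>K\<close> together with a ring homomorphism \<open>\<iota>\<close> from \<open>Q\<^sub>p\<close> to \<open>K\<close>.\<close>

definition finite_padic_extension ::
    "nat \<Rightarrow> ('k, 'n) ring_scheme \<Rightarrow> ((nat \<Rightarrow> rat) set \<Rightarrow> 'k) \<Rightarrow> bool" where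
  "finite_padic_extension p K \<iota> \<longleftrightarrow>
     field K \<and> \<iota> \<in> ring_hom (Qp p) K \<and> ring.finite_dimension K (\<iota> ` carrier (Qp p)) (carrier K)"

text \<open>Polynomials are lists of coefficients with the leading coefficient first.\<close>

definition integral_over :: "('k, 'n) ring_scheme \<Rightarrow> 'k set \<Rightarrow> 'k \<Rightarrow> bool" where
  "integral_over K S x \<longleftrightarrow>
     (\<exists>q. q \<noteq> [] \<and> set q \<subseteq> S \<and> lead_coeff q = \<one>\<^bsub>K\<^esub> \<and> ring.eval K q x = \<zero>\<^bsub>K\<^esub>)"

definition ring_of_integers ::
    "nat \<Rightarrow> ('k, 'n) ring_scheme \<Rightarrow> ((nat \<Rightarrow> rat) set \<Rightarrow> 'k) \<Rightarrow> ('k, 'n) ring_scheme" where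
  "ring_of_integers p K \<iota> = K\<lparr>carrier := {x \<in> carrier K. integral_over K (\<iota> ` Zp p) x}\<rparr>"

text \<open>Ramification index 1: the ideal generated by \<open>p\<close> is the maximal ideal of the ring of
  integers. The residue fields are finite, so the residue extension is automatically separable.\<close>

definition unramified ::
    "nat \<Rightarrow> ('k, 'n) ring_scheme \<Rightarrow> ((nat \<Rightarrow> rat) set \<Rightarrow> 'k) \<Rightarrow> bool" where
  "unramified p K \<iota> \<longleftrightarrow>
     (let A = ring_of_integers p K \<iota> in maximalideal (PIdl\<^bsub>A\<^esub> ([p] \<cdot>\<^bsub>A\<^esub> \<one>\<^bsub>A\<^esub>)) A)"


section \<open>Group rings\<close>

text \<open>Elements are the finitely supported functions from the group to the ring, with convolution
  \<open>(f h)(g) = \<Sum> f(x) h(x\<^sup>-\<^sup>1 g)\<close>, the sum being over the support of \<open>f\<close>.\<close>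

definition group_ring :: "('a, 'm) ring_scheme \<Rightarrow> ('g, 'n) monoid_scheme \<Rightarrow> ('g \<Rightarrow> 'a) ring" where
  "group_ring A G =
     \<lparr>carrier = {f \<in> carrier G \<rightarrow>\<^sub>E carrier A. finite {x \<in> carrier G. f x \<noteq> \<zero>\<^bsub>A\<^esub>}},
      mult = (\<lambda>f h. \<lambda>g\<in>carrier G.
        \<Oplus>\<^bsub>A\<^esub>x\<in>{x \<in> carrier G. f x \<noteq> \<zero>\<^bsub>A\<^esub>}. f x \<otimes>\<^bsub>A\<^esub> h (inv\<^bsub>G\<^esub> x \<otimes>\<^bsub>G\<^esub> g)),
      one = (\<lambda>g\<in>carrier G. if g = \<one>\<^bsub>G\<^esub> then \<one>\<^bsub>A\<^esub> else \<zero>\<^bsub>A\<^esub>),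
      zero = (\<lambda>g\<in>carrier G. \<zero>\<^bsub>A\<^esub>),
      add = (\<lambda>f h. \<lambda>g\<in>carrier G. f g \<oplus>\<^bsub>A\<^esub> h g)\<rparr>"


section \<open>Fitting ideals\<close>

text \<open>The multiplicative fields of the record have no meaning for a module.\<close>

definition free_module :: "('a, 'm) ring_scheme \<Rightarrow> nat \<Rightarrow> ('a, nat \<Rightarrow> 'a) module" where
  "free_module R t =
     \<lparr>carrier = {..<t} \<rightarrow>\<^sub>E carrier R,
      mult = undefined, one = undefined,
      zero = (\<lambda>i\<in>{..<t}. \<zero>\<^bsub>R\<^esub>),
      add = (\<lambda>v w. \<lambda>i\<in>{..<t}. v i \<oplus>\<^bsub>R\<^esub> w i),
      smult = (\<lambda>a v. \<lambda>i\<in>{..<t}. a \<otimes>\<^bsub>R\<^esub> v i)\<rparr>"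

definition mod_hom ::
    "('a, 'm) ring_scheme \<Rightarrow> ('a, 'b, 'n) module_scheme \<Rightarrow> ('a, 'c, 'o) module_scheme \<Rightarrow> ('b \<Rightarrow> 'c) set" where
  "mod_hom R M N =
     {f \<in> carrier M \<rightarrow> carrier N.
        (\<forall>x\<in>carrier M. \<forall>y\<in>carrier M. f (x \<oplus>\<^bsub>M\<^esub> y) = f x \<oplus>\<^bsub>N\<^esub> f y) \<and>
        (\<forall>a\<in>carrier R. \<forall>x\<in>carrier M. f (a \<odot>\<^bsub>M\<^esub> x) = a \<odot>\<^bsub>N\<^esub> f x)}"

definition det :: "('a, 'm) ring_scheme \<Rightarrow> nat \<Rightarrow> (nat \<Rightarrow> nat \<Rightarrow> 'a) \<Rightarrow> 'a" where
  "det R t v =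
     (\<Oplus>\<^bsub>R\<^esub>\<sigma>\<in>{\<sigma>. \<sigma> permutes {..<t}}. [sign \<sigma>] \<cdot>\<^bsub>R\<^esub> (\<Otimes>\<^bsub>R\<^esub>i\<in>{..<t}. v i (\<sigma> i)))"

definition presentation ::
    "('a, 'm) ring_scheme \<Rightarrow> ('a, 'b, 'n) module_scheme \<Rightarrow> nat \<Rightarrow> ((nat \<Rightarrow> 'a) \<Rightarrow> 'b) \<Rightarrow> bool" where
  "presentation R M t f \<longleftrightarrow>
     f \<in> mod_hom R (free_module R t) M \<and> f ` carrier (free_module R t) = carrier M"

definition presentation_ideal ::
    "('a, 'm) ring_scheme \<Rightarrow> ('a, 'b, 'n) module_scheme \<Rightarrow> nat \<Rightarrow> ((nat \<Rightarrow> 'a) \<Rightarrow> 'b) \<Rightarrow> 'a set" where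
  "presentation_ideal R M t f =
     Idl\<^bsub>R\<^esub> {det R t v | v. \<forall>i<t. v i \<in> carrier (free_module R t) \<and> f (v i) = \<zero>\<^bsub>M\<^esub>}"

text \<open>Defined for a finitely generated module \<open>M\<close>; the ideal does not depend on the chosen
  presentation.\<close>

definition fitting_ideal :: "('a, 'm) ring_scheme \<Rightarrow> ('a, 'b, 'n) module_scheme \<Rightarrow> 'a set" where
  "fitting_ideal R M =
     (case (SOME (t, f). presentation R M t f) of (t, f) \<Rightarrow> presentation_ideal R M t f)"

end

theory Submission
  imports
    "Jordan_Normal_Form.Determinant"
    "HOL-Library.Function_Algebras"
    "HOL-Algebra.Multiplicative_Group"
    Defs
begin

text \<open>
  Let \<open>\<sigma>\<close> generate \<open>C\<close>, and in \<open>R = A[C]\<close> put \<open>x = \<Sum>\<^sub>g g\<close> and \<open>y = \<sigma> - 1\<close>. Then \<open>x y = 0\<close>, each of \<open>x\<close>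
  and \<open>y\<close> generates the annihilator of the other, \<open>R\<close> is local with maximal ideal \<open>(x, y)\<close>, and
  \<open>R/(y) = A\<close> and \<open>R/(x) = A[\<zeta>\<^sub>p]\<close> are discrete valuation rings with uniformizers \<open>x\<close> and \<open>y\<close>.
  Unramifiedness enters here: \<open>x = y\<^sup>p\<^sup>-\<^sup>1 + p h\<close> with a unit \<open>h\<close>, so \<open>x\<close> becomes \<open>p\<close> in \<open>A\<close>, where
  \<open>p\<close> is a uniformizer, and \<open>p\<close> is a power of \<open>y\<close> up to a unit in \<open>A[\<zeta>\<^sub>p]\<close>. A ring with these
  properties is called a node below, and the theorem holds for every node.

  Let \<open>N\<close> be the kernel of a surjection from \<open>F = R\<^sup>t\<close> to \<open>M\<close>, let \<open>I\<close> be the Fitting ideal and \<open>q\<close> the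
  number of elements of the residue field. The defect \<open>h(N) = [N \<inter> xF : xN]\<close> measures how far \<open>N\<close>
  is from being free. The isomorphism theorems give
  \<open>[F : N] h(N) = [F : N + xF] [F : N + yF]\<close> (\<open>herbrand_index\<close>). The factors on the right are
  indices of lattices over the discrete valuation rings \<open>R/(x)\<close> and \<open>R/(y)\<close>, where a triangular
  basis shows that a lattice and its Fitting ideal have the same index (\<open>dvr_mod.fitting_index\<close>).
  Fitting ideals commute with the reductions modulo \<open>x\<close> and \<open>y\<close>, so the right hand side does not
  change when \<open>N \<subseteq> F\<close> is replaced by \<open>I \<subseteq> R\<close>, and therefore \<open>#M h(N) = #(R/I) h(I)\<close>.

  It remains to compare the defects (\<open>node.index_le_fitting_index\<close>). The quotient behind \<open>h(N)\<close> is a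
  vector space over the residue field, hence \<open>h(N) = 1\<close> or \<open>h(N) \<ge> q\<close>; for the ideal \<open>I\<close> this space
  is at most a line, hence \<open>h(I) \<le> q\<close>. If \<open>h(N) = 1\<close>, then the defect formed with \<open>y\<close> in place of \<open>x\<close>
  is trivial too, because the right hand side above is symmetric; by Nakayama's lemma, lifts of a
  basis of \<open>N\<close> modulo \<open>y\<close> then span \<open>N\<close>, and \<open>I\<close> is principal. Conversely, if \<open>I\<close> is principal, then
  it is generated by a single determinant, by Cramer's rule \<open>N\<close> is free on the rows of this
  determinant, and \<open>h(N) = h(I) = 1\<close>. Thus equality holds for principal \<open>I\<close>, and otherwise
  \<open>h(N) \<ge> q \<ge> h(I)\<close> gives the inequality.

  The ring \<open>R\<close> is a record with a carrier. The type \<open>cring_product\<close>, of class \<open>comm_ring_1\<close>, maps onto it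
  with kernel \<open>Z\<close>, and everything about nodes is carried out in that type modulo the ideal \<open>Z\<close>. In this way
  the determinants of matrices over a commutative ring become available for \<open>R\<close>. Statements about
  the quotient by an ideal \<open>P\<close> are expressed by membership of differences in \<open>P\<close>.
\<close>

hide_const (open) Polynomial.order

section \<open>Indices of subgroups\<close>

definition add_subgroup :: "'g::ab_group_add set \<Rightarrow> bool" where
  "add_subgroup H \<longleftrightarrow> 0 \<in> H \<and> (\<forall>a\<in>H. \<forall>b\<in>H. a - b \<in> H)"

definition sumset :: "'g::ab_group_add set \<Rightarrow> 'g set \<Rightarrow> 'g set" where
  "sumset A B = {v. \<exists>a\<in>A. v - a \<in> B}"

definition add_coset :: "'g::ab_group_add set \<Rightarrow> 'g \<Rightarrow> 'g set" where
  "add_coset H x = {z. z - x \<in> H}"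

text \<open>The value is 0 when there are infinitely many cosets. Multiplicativity survives this convention,
  since it comes from a bijection with a product of quotient sets.\<close>

definition subgroup_index :: "'g::ab_group_add set \<Rightarrow> 'g set \<Rightarrow> nat" where
  "subgroup_index G H = card (add_coset H ` G)"

lemma add_subgroupD:
  assumes "add_subgroup H"
  shows "0 \<in> H" "a \<in> H \<Longrightarrow> b \<in> H \<Longrightarrow> a - b \<in> H" "a \<in> H \<Longrightarrow> - a \<in> H" "a \<in> H \<Longrightarrow> b \<in> H \<Longrightarrow> a + b \<in> H"
proof -
  show 0: "0 \<in> H" and d: "a \<in> H \<Longrightarrow> b \<in> H \<Longrightarrow> a - b \<in> H" for a b
    using assms by (auto simp: add_subgroup_def)
  show m: "a \<in> H \<Longrightarrow> - a \<in> H" for a using d[OF 0, of a] by simp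
  show "a \<in> H \<Longrightarrow> b \<in> H \<Longrightarrow> a + b \<in> H" using d[OF _ m, of a b] by simp
qed

lemma coset_eq_iff:
  assumes "add_subgroup H"
  shows "add_coset H x = add_coset H y \<longleftrightarrow> x - y \<in> H"
proof
  assume "add_coset H x = add_coset H y"
  moreover have "x \<in> add_coset H x" using add_subgroupD(1)[OF assms] by (simp add: add_coset_def)
  ultimately show "x - y \<in> H" by (simp add: add_coset_def)
next
  assume xy: "x - y \<in> H"
  have "z - x \<in> H \<longleftrightarrow> z - y \<in> H" for z
    using add_subgroupD(4)[OF assms xy, of "z - x"] add_subgroupD(2)[OF assms _ xy, of "z - y"]
    by (auto simp: algebra_simps)
  then show "add_coset H x = add_coset H y" by (auto simp: add_coset_def)
qed

lemma subgroup_index_eq_card: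
  assumes H: "add_subgroup H" and \<psi>: "\<And>x y. x \<in> G \<Longrightarrow> y \<in> G \<Longrightarrow> \<psi> x = \<psi> y \<longleftrightarrow> x - y \<in> H"
  shows "subgroup_index G H = card (\<psi> ` G)"
proof -
  let ?c = "add_coset H"
  have eq: "?c x = ?c y \<longleftrightarrow> \<psi> x = \<psi> y" if "x \<in> G" "y \<in> G" for x y
    using that by (simp add: coset_eq_iff[OF H] \<psi>)
  have "bij_betw (\<lambda>a. \<psi> (inv_into G ?c a)) (?c ` G) (\<psi> ` G)"
  proof (rule bij_betw_imageI)
    have *: "\<psi> (inv_into G ?c (?c x)) = \<psi> x" if "x \<in> G" for x
    proof -
      have "inv_into G ?c (?c x) \<in> G" using that by (intro inv_into_into) blast
      moreover have "?c (inv_into G ?c (?c x)) = ?c x" using that by (intro f_inv_into_f) blast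
      ultimately show ?thesis using eq that by blast
    qed
    show "inj_on (\<lambda>a. \<psi> (inv_into G ?c a)) (?c ` G)"
      using * eq by (intro inj_onI) (metis (no_types, lifting) imageE)
    show "(\<lambda>a. \<psi> (inv_into G ?c a)) ` ?c ` G = \<psi> ` G"
      using * by (auto simp: image_image)
  qed
  then show ?thesis unfolding subgroup_index_def by (rule bij_betw_same_card)
qed

text \<open>The map \<open>f\<close> induces a bijection from \<open>G/H\<close> to \<open>G'/H'\<close>. With the identity for \<open>f\<close> this is the second
  isomorphism theorem, with a multiplication map it is the first.\<close>

lemma subgroup_index_transfer:
  assumes H: "add_subgroup H" and H': "add_subgroup H'"
    and f: "\<And>u v. u \<in> G \<Longrightarrow> v \<in> G \<Longrightarrow> f u - f v \<in> H' \<longleftrightarrow> u - v \<in> H"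
    and into: "\<And>u. u \<in> G \<Longrightarrow> f u \<in> G'" and onto: "\<And>v. v \<in> G' \<Longrightarrow> \<exists>u\<in>G. v - f u \<in> H'"
  shows "subgroup_index G H = subgroup_index G' H'"
proof -
  let ?c = "add_coset H'"
  have "subgroup_index G H = card ((\<lambda>u. ?c (f u)) ` G)"
    by (rule subgroup_index_eq_card[OF H]) (simp add: coset_eq_iff[OF H'] f)
  also have "(\<lambda>u. ?c (f u)) ` G = ?c ` G'"
  proof
    show "(\<lambda>u. ?c (f u)) ` G \<subseteq> ?c ` G'" using into by blast
    show "?c ` G' \<subseteq> (\<lambda>u. ?c (f u)) ` G"
    proof
      fix a assume "a \<in> ?c ` G'"
      then obtain v where "v \<in> G'" and a: "a = ?c v" by blast
      then obtain u where "u \<in> G" "v - f u \<in> H'" using onto by blast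
      then show "a \<in> (\<lambda>u. ?c (f u)) ` G" using a coset_eq_iff[OF H', of v "f u"] by blast
    qed
  qed
  finally show ?thesis by (simp add: subgroup_index_def)
qed

text \<open>A choice of representatives of the cosets of \<open>K\<close> identifies \<open>G/H\<close> with \<open>G/K \<times> K/H\<close>.\<close>

lemma subgroup_index_tower:
  assumes H: "add_subgroup H" and K: "add_subgroup K" and G: "add_subgroup G"
    and HK: "H \<subseteq> K" and KG: "K \<subseteq> G"
  shows "subgroup_index G H = subgroup_index G K * subgroup_index K H"
proof -
  let ?h = "add_coset H" and ?k = "add_coset K"
  define r where "r a = inv_into G ?k a" for a
  have r: "r (?k x) \<in> G" "?k (r (?k x)) = ?k x" if "x \<in> G" for x
    using that unfolding r_def by (blast intro: inv_into_into, intro f_inv_into_f, blast)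
  have r': "x - r (?k x) \<in> K" if "x \<in> G" for x
    using r(2)[OF that] coset_eq_iff[OF K] by blast
  have "subgroup_index G H = card ((\<lambda>x. (?k x, ?h (x - r (?k x)))) ` G)"
  proof (rule subgroup_index_eq_card[OF H])
    fix x y assume "x \<in> G" "y \<in> G"
    show "(?k x, ?h (x - r (?k x))) = (?k y, ?h (y - r (?k y))) \<longleftrightarrow> x - y \<in> H"
    proof
      assume "(?k x, ?h (x - r (?k x))) = (?k y, ?h (y - r (?k y)))"
      then have "?k x = ?k y" "?h (x - r (?k x)) = ?h (y - r (?k y))" by (rule prod.inject[THEN iffD1, THEN conjunct1], rule prod.inject[THEN iffD1, THEN conjunct2])
      then show "x - y \<in> H" using coset_eq_iff[OF H, of "x - r (?k x)" "y - r (?k y)"] by simp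
    next
      assume xy: "x - y \<in> H"
      then have "?k x = ?k y" using HK coset_eq_iff[OF K] by blast
      moreover from this have "?h (x - r (?k x)) = ?h (y - r (?k y))"
        using coset_eq_iff[OF H, of "x - r (?k x)" "y - r (?k y)"] xy by simp
      ultimately show "(?k x, ?h (x - r (?k x))) = (?k y, ?h (y - r (?k y)))" by simp
    qed
  qed
  also have "(\<lambda>x. (?k x, ?h (x - r (?k x)))) ` G = (?k ` G) \<times> (?h ` K)"
  proof
    show "(\<lambda>x. (?k x, ?h (x - r (?k x)))) ` G \<subseteq> (?k ` G) \<times> (?h ` K)" using r' by blast
    show "(?k ` G) \<times> (?h ` K) \<subseteq> (\<lambda>x. (?k x, ?h (x - r (?k x)))) ` G"
    proof (clarify)
      fix x k assume x: "x \<in> G" and k: "k \<in> K"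
      define y where "y = r (?k x) + k"
      have y: "y \<in> G" unfolding y_def using r(1)[OF x] k KG add_subgroupD(4)[OF G] by blast
      have "y - r (?k x) \<in> K" using k by (simp add: y_def)
      then have "?k y = ?k x" using r(2)[OF x] coset_eq_iff[OF K] by blast
      then have "(?k y, ?h (y - r (?k y))) = (?k x, ?h k)" by (simp add: y_def)
      then show "(?k x, ?h k) \<in> (\<lambda>x. (?k x, ?h (x - r (?k x)))) ` G" using y by (metis (no_types, lifting) image_eqI)
    qed
  qed
  finally show ?thesis by (simp add: subgroup_index_def card_cartesian_product)
qed

lemma add_subgroup_UNIV: "add_subgroup UNIV" by (simp add: add_subgroup_def)

lemma add_subgroup_sumset:
  assumes A: "add_subgroup A" and B: "add_subgroup B"
  shows "add_subgroup (sumset A B)"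
  unfolding add_subgroup_def
proof (intro conjI ballI)
  show "0 \<in> sumset A B" using add_subgroupD(1)[OF A] add_subgroupD(1)[OF B] by (force simp: sumset_def)
  fix u v assume "u \<in> sumset A B" "v \<in> sumset A B"
  then obtain a b where "a \<in> A" "u - a \<in> B" "b \<in> A" "v - b \<in> B" by (auto simp: sumset_def)
  then have "a - b \<in> A" "(u - v) - (a - b) \<in> B"
    using add_subgroupD(2)[OF A] add_subgroupD(2)[OF B, of "u - a" "v - b"] by (auto simp: algebra_simps)
  then show "u - v \<in> sumset A B" by (auto simp: sumset_def)
qed

lemma add_subgroup_Int: "add_subgroup A \<Longrightarrow> add_subgroup B \<Longrightarrow> add_subgroup (A \<inter> B)"
  by (auto simp: add_subgroup_def)

lemma subset_sumset: "0 \<in> B \<Longrightarrow> A \<subseteq> sumset A B" by (force simp: sumset_def)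
lemma subset_sumset2: "0 \<in> A \<Longrightarrow> B \<subseteq> sumset A B" by (force simp: sumset_def)

text \<open>Modulo \<open>Z\<close>, \<open>A\<close> is the image and \<open>B\<close> the kernel of \<open>m\<close>. The index of \<open>N\<close> is the product of those of
  \<open>N + A\<close> and of \<open>N \<inter> A\<close> in \<open>A\<close>, and \<open>m\<close> identifies the quotient by \<open>N + B\<close> with \<open>A/m(N)\<close>. For the two
  factors of a relation \<open>x y = 0\<close>, the roles of \<open>A\<close> and \<open>B\<close> are exchanged when \<open>y\<close> replaces \<open>x\<close>, while
  the right hand side stays the same.\<close>

lemma herbrand_index:
  fixes m :: "'g::ab_group_add \<Rightarrow> 'g"
  assumes m: "\<And>u v. m (u - v) = m u - m v"
    and N: "add_subgroup N" and Z: "add_subgroup Z" and ZN: "Z \<subseteq> N" and mN: "m ` N \<subseteq> N" 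
    and A: "A = sumset (range m) Z" and B: "B = {v. m v \<in> Z}"
  shows "subgroup_index UNIV N * subgroup_index (N \<inter> A) (sumset (m ` N) Z)
       = subgroup_index UNIV (sumset N A) * subgroup_index UNIV (sumset N B)"
proof -
  have m0: "m 0 = 0" using m[of 0 0] by simp
  have sub: "add_subgroup (m ` H)" if "add_subgroup H" for H
    using that m0 unfolding add_subgroup_def by (force simp: m[symmetric])
  have sA: "add_subgroup A" unfolding A by (intro add_subgroup_sumset sub add_subgroup_UNIV Z)
  have sB: "add_subgroup B" unfolding B add_subgroup_def using m m0 add_subgroupD[OF Z] by auto
  have sM: "add_subgroup (sumset (m ` N) Z)" by (intro add_subgroup_sumset sub N Z)
  have sNA: "add_subgroup (sumset N A)" and sNB: "add_subgroup (sumset N B)"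
    by (intro add_subgroup_sumset N sA sB)+
  have sI: "add_subgroup (N \<inter> A)" by (intro add_subgroup_Int N sA)
  have 1: "subgroup_index UNIV N = subgroup_index UNIV (sumset N A) * subgroup_index (sumset N A) N"
    by (intro subgroup_index_tower N sNA add_subgroup_UNIV subset_sumset add_subgroupD(1) sA subset_UNIV)
  have 2: "subgroup_index A (N \<inter> A) = subgroup_index (sumset N A) N"
  proof (rule subgroup_index_transfer[OF sI N, where f="\<lambda>u. u"])
    show "u - v \<in> N \<longleftrightarrow> u - v \<in> N \<inter> A" if "u \<in> A" "v \<in> A" for u v
      using that add_subgroupD(2)[OF sA] by blast
    show "u \<in> sumset N A" if "u \<in> A" for u using that subset_sumset2[OF add_subgroupD(1)[OF N]] by blast
    show "\<exists>u\<in>A. v - u \<in> N" if "v \<in> sumset N A" for v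
      using that by (force simp: sumset_def)
  qed
  have 3: "subgroup_index UNIV (sumset N B) = subgroup_index A (sumset (m ` N) Z)"
  proof (rule subgroup_index_transfer[OF sNB sM, where f=m])
    show "m u - m v \<in> sumset (m ` N) Z \<longleftrightarrow> u - v \<in> sumset N B" for u v
      by (auto simp: sumset_def B m)
    show "m u \<in> A" for u using subset_sumset[OF add_subgroupD(1)[OF Z], of "range m"] by (auto simp: A)
    show "\<exists>u\<in>UNIV. v - m u \<in> sumset (m ` N) Z" if "v \<in> A" for v
    proof -
      obtain w where "v - m w \<in> Z" using \<open>v \<in> A\<close> by (auto simp: A sumset_def)
      then show ?thesis using subset_sumset2[OF add_subgroupD(1)[OF sub[OF N]], of Z] by blast
    qed
  qed
  have "sumset (m ` N) Z \<subseteq> N \<inter> A"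
  proof
    fix v assume "v \<in> sumset (m ` N) Z"
    then obtain n where n: "n \<in> N" "v - m n \<in> Z" by (auto simp: sumset_def)
    then have "(v - m n) + m n \<in> N" using ZN mN add_subgroupD(4)[OF N] by blast
    then show "v \<in> N \<inter> A" using n by (auto simp: A sumset_def)
  qed
  then have 4: "subgroup_index A (sumset (m ` N) Z) = subgroup_index A (N \<inter> A) * subgroup_index (N \<inter> A) (sumset (m ` N) Z)"
    by (intro subgroup_index_tower sM sI sA) auto
  show ?thesis unfolding 1 3 4 2 by simp
qed

section \<open>Ideals, vectors and determinants\<close>

definition ideal_set :: "'r::comm_ring_1 set \<Rightarrow> bool" where
  "ideal_set P \<longleftrightarrow> 0 \<in> P \<and> (\<forall>a\<in>P. \<forall>b\<in>P. a + b \<in> P) \<and> (\<forall>r. \<forall>a\<in>P. r * a \<in> P)"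

text \<open>The preimage of the principal ideal generated by \<open>w\<close> in the quotient by \<open>P\<close>.\<close>

definition principal_mod :: "'r::comm_ring_1 set \<Rightarrow> 'r \<Rightarrow> 'r set" where
  "principal_mod P w = {a. \<exists>r. a - w * r \<in> P}"

definition scale_vec :: "'r::comm_ring_1 \<Rightarrow> (nat \<Rightarrow> 'r) \<Rightarrow> nat \<Rightarrow> 'r" (infixr "*v" 75) where
  "scale_vec r v = (\<lambda>i. r * v i)"

definition submodule_set :: "(nat \<Rightarrow> 'r::comm_ring_1) set \<Rightarrow> bool" where
  "submodule_set N \<longleftrightarrow> 0 \<in> N \<and> (\<forall>a\<in>N. \<forall>b\<in>N. a + b \<in> N) \<and> (\<forall>r. \<forall>a\<in>N. scale_vec r a \<in> N)"

text \<open>A free module of rank \<open>t\<close> is modelled by all functions on the natural numbers, of which only the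
  first \<open>t\<close> values count. Accordingly its submodules are the submodules of the function space that
  contain \<open>vec_in t Z\<close>, where \<open>Z\<close> is the ideal that represents zero. Free modules of different ranks
  thus live in one type, which allows induction on the rank.\<close>

definition vec_in :: "nat \<Rightarrow> 'r set \<Rightarrow> (nat \<Rightarrow> 'r) set" where
  "vec_in t P = {v. \<forall>i<t. v i \<in> P}"

definition det_rows :: "nat \<Rightarrow> (nat \<Rightarrow> nat \<Rightarrow> 'r::comm_ring_1) \<Rightarrow> 'r" where
  "det_rows t v = Determinant.det (mat t t (\<lambda>(i, j). v i j))"

definition ideal_gen :: "'r::comm_ring_1 set \<Rightarrow> 'r set" where
  "ideal_gen S = \<Inter>{J. ideal_set J \<and> S \<subseteq> J}"

lemma ideal_setD:
  assumes "ideal_set P"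
  shows "0 \<in> P" "a \<in> P \<Longrightarrow> b \<in> P \<Longrightarrow> a + b \<in> P" "a \<in> P \<Longrightarrow> r * a \<in> P" "a \<in> P \<Longrightarrow> a * r \<in> P"
    "a \<in> P \<Longrightarrow> - a \<in> P" "a \<in> P \<Longrightarrow> b \<in> P \<Longrightarrow> a - b \<in> P"
proof -
  show "0 \<in> P" and a: "a \<in> P \<Longrightarrow> b \<in> P \<Longrightarrow> a + b \<in> P" and m: "a \<in> P \<Longrightarrow> r * a \<in> P" for a b r
    using assms by (auto simp: ideal_set_def)
  then show "a \<in> P \<Longrightarrow> a * r \<in> P" by (simp add: mult.commute)
  show n: "a \<in> P \<Longrightarrow> - a \<in> P" for a using m[of a "-1"] by simp
  show "a \<in> P \<Longrightarrow> b \<in> P \<Longrightarrow> a - b \<in> P" using a[OF _ n, of a b] by simp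
qed

lemma ideal_set_subgroup: "ideal_set P \<Longrightarrow> add_subgroup P"
  by (auto simp: add_subgroup_def ideal_setD)

lemma ideal_set_sum: "ideal_set P \<Longrightarrow> (\<And>i. i \<in> S \<Longrightarrow> f i \<in> P) \<Longrightarrow> sum f S \<in> P"
  by (induction S rule: infinite_finite_induct) (auto simp: ideal_setD)

lemma ideal_cong_mult:
  assumes "ideal_set P" "a - b \<in> P" "c - d \<in> P" shows "a * c - b * d \<in> P"
proof -
  have "a * c - b * d = a * (c - d) + d * (a - b)" by (simp add: algebra_simps)
  then show ?thesis using assms by (simp add: ideal_setD)
qed

lemma ideal_cong_add:
  assumes "ideal_set P" "a - b \<in> P" "c - d \<in> P" shows "(a + c) - (b + d) \<in> P"
  using ideal_setD(2)[OF assms] by (simp add: algebra_simps)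

lemma ideal_cong_iff: "ideal_set P \<Longrightarrow> a - b \<in> P \<Longrightarrow> a \<in> P \<longleftrightarrow> b \<in> P"
  using ideal_setD(2)[of P "a - b" b] ideal_setD(6)[of P a "a - b"] by auto

lemma ideal_cong_prod:
  assumes "ideal_set P" "\<And>i. i \<in> S \<Longrightarrow> f i - g i \<in> P"
  shows "prod f S - prod g S \<in> P"
  using assms(2) by (induction S rule: infinite_finite_induct) (auto simp: assms(1) ideal_setD ideal_cong_mult)

lemma ideal_cong_power: "ideal_set P \<Longrightarrow> a - b \<in> P \<Longrightarrow> a ^ n - b ^ n \<in> P"
  by (induction n) (auto simp: ideal_setD ideal_cong_mult)

lemma ideal_set_principal: "ideal_set P \<Longrightarrow> ideal_set (principal_mod P w)"
  unfolding ideal_set_def principal_mod_def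
proof (intro conjI ballI allI)
  assume P: "0 \<in> P \<and> (\<forall>a\<in>P. \<forall>b\<in>P. a + b \<in> P) \<and> (\<forall>r. \<forall>a\<in>P. r * a \<in> P)"
  then have I: "ideal_set P" by (simp add: ideal_set_def)
  show "0 \<in> {a. \<exists>r. a - w * r \<in> P}" using P by (auto intro: exI[of _ 0])
  show "a + b \<in> {a. \<exists>r. a - w * r \<in> P}" if ab: "a \<in> {a. \<exists>r. a - w * r \<in> P}" "b \<in> {a. \<exists>r. a - w * r \<in> P}" for a b
  proof -
    obtain r s where "a - w * r \<in> P" "b - w * s \<in> P" using ab by auto
    then have "(a + b) - w * (r + s) \<in> P" using ideal_cong_add[OF I] by (simp add: algebra_simps)
    then show ?thesis by blast
  qed
  show "s * a \<in> {a. \<exists>r. a - w * r \<in> P}" if a: "a \<in> {a. \<exists>r. a - w * r \<in> P}" for s a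
  proof -
    obtain r where "a - w * r \<in> P" using a by auto
    then have "s * a - w * (s * r) \<in> P" using ideal_setD(3)[OF I, of "a - w * r" s] by (simp add: algebra_simps)
    then show ?thesis by blast
  qed
qed

lemma principal_mod_subset: "P \<subseteq> principal_mod P w"
  unfolding principal_mod_def by (auto intro!: exI[of _ 0])

lemma principal_mod_mult: "0 \<in> P \<Longrightarrow> w * r \<in> principal_mod P w"
  unfolding principal_mod_def by (auto intro!: exI[of _ r])

lemma principal_mod_least:
  assumes "ideal_set J" "P \<subseteq> J" "w \<in> J" shows "principal_mod P w \<subseteq> J"
proof
  fix a assume "a \<in> principal_mod P w"
  then obtain r where "a - w * r \<in> P" by (auto simp: principal_mod_def)
  then have "a - w * r \<in> J" using assms by blast
  then show "a \<in> J" using ideal_cong_iff[OF assms(1)] ideal_setD(4)[OF assms(1,3)] by blast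
qed

lemma ideal_gen_ideal: "ideal_set (ideal_gen S)"
  unfolding ideal_set_def ideal_gen_def by auto

lemma ideal_gen_superset: "S \<subseteq> ideal_gen S" by (auto simp: ideal_gen_def)

lemma ideal_gen_least: "ideal_set J \<Longrightarrow> S \<subseteq> J \<Longrightarrow> ideal_gen S \<subseteq> J" by (auto simp: ideal_gen_def)

lemma sumset_ideal:
  assumes A: "ideal_set A" and B: "ideal_set B" shows "ideal_set (sumset A B)"
  unfolding ideal_set_def
proof (intro conjI ballI allI)
  note S = add_subgroup_sumset[OF ideal_set_subgroup[OF A] ideal_set_subgroup[OF B]]
  show "0 \<in> sumset A B" "\<And>a b. a \<in> sumset A B \<Longrightarrow> b \<in> sumset A B \<Longrightarrow> a + b \<in> sumset A B"
    using add_subgroupD[OF S] by auto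
  fix r v assume "v \<in> sumset A B"
  then obtain a where "a \<in> A" "v - a \<in> B" by (auto simp: sumset_def)
  then have "r * a \<in> A" "r * v - r * a \<in> B"
    using ideal_setD(3)[OF A] ideal_setD(3)[OF B, of "v - a" r] by (auto simp: algebra_simps)
  then show "r * v \<in> sumset A B" by (auto simp: sumset_def)
qed

lemma scale_vec_apply [simp]: "(r *v v) i = r * v i" by (simp add: scale_vec_def)

lemma vec_apply [simp]: "(0 :: nat \<Rightarrow> 'r::comm_ring_1) i = 0" "(u + v) i = u i + v i" "(u - v) i = u i - v i" "(- u) i = - u i"
  for u v :: "nat \<Rightarrow> 'r::comm_ring_1"
  by (simp_all)

lemma vec_sum_apply: "(\<Sum>i\<in>S. f i) j = (\<Sum>i\<in>S. f i j)" for f :: "'i \<Rightarrow> nat \<Rightarrow> 'r::comm_ring_1"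
  by (induction S rule: infinite_finite_induct) auto

lemma submodule_setD:
  assumes "submodule_set N"
  shows "0 \<in> N" "a \<in> N \<Longrightarrow> b \<in> N \<Longrightarrow> a + b \<in> N" "a \<in> N \<Longrightarrow> r *v a \<in> N"
    "a \<in> N \<Longrightarrow> - a \<in> N" "a \<in> N \<Longrightarrow> b \<in> N \<Longrightarrow> a - b \<in> N"
proof -
  show "0 \<in> N" and a: "a \<in> N \<Longrightarrow> b \<in> N \<Longrightarrow> a + b \<in> N" and m: "a \<in> N \<Longrightarrow> r *v a \<in> N" for a b r
    using assms by (auto simp: submodule_set_def)
  have "(-1) *v a = - a" for a :: "nat \<Rightarrow> 'a" by (auto simp: fun_eq_iff)
  then show n: "a \<in> N \<Longrightarrow> - a \<in> N" for a using m[of a "-1"] by simp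
  show "a \<in> N \<Longrightarrow> b \<in> N \<Longrightarrow> a - b \<in> N" using a[OF _ n, of a b] by simp
qed

lemma submodule_set_subgroup: "submodule_set N \<Longrightarrow> add_subgroup N"
  by (auto simp: add_subgroup_def submodule_setD)

lemma submodule_set_sum: "submodule_set N \<Longrightarrow> (\<And>i. i \<in> S \<Longrightarrow> f i \<in> N) \<Longrightarrow> sum f S \<in> N"
  by (induction S rule: infinite_finite_induct) (auto simp: submodule_setD)

lemma submodule_cong_iff: "submodule_set N \<Longrightarrow> a - b \<in> N \<Longrightarrow> a \<in> N \<longleftrightarrow> b \<in> N"
  using submodule_setD(2)[of N "a - b" b] submodule_setD(5)[of N a "a - b"] by auto

lemma vec_in_submodule: "ideal_set P \<Longrightarrow> submodule_set (vec_in t P)"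
  by (auto simp: submodule_set_def vec_in_def ideal_setD)

lemma sumset_submodule:
  assumes A: "submodule_set A" and B: "submodule_set B" shows "submodule_set (sumset A B)"
  unfolding submodule_set_def
proof (intro conjI ballI allI)
  note S = add_subgroup_sumset[OF submodule_set_subgroup[OF A] submodule_set_subgroup[OF B]]
  show "0 \<in> sumset A B" "\<And>a b. a \<in> sumset A B \<Longrightarrow> b \<in> sumset A B \<Longrightarrow> a + b \<in> sumset A B"
    using add_subgroupD[OF S] by auto
  fix r v assume "v \<in> sumset A B"
  then obtain a where a: "a \<in> A" "v - a \<in> B" by (auto simp: sumset_def)
  have "r *v v - r *v a = r *v (v - a)" by (auto simp: fun_eq_iff algebra_simps)
  then have "r *v a \<in> A" "r *v v - r *v a \<in> B"
    using submodule_setD(3)[OF A a(1)] submodule_setD(3)[OF B a(2), of r] by simp_all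
  then show "r *v v \<in> sumset A B" by (auto simp: sumset_def)
qed

lemma det_rows_expansion: "det_rows t v = (\<Sum>\<sigma>\<in>{\<sigma>. \<sigma> permutes {..<t}}. of_int (sign \<sigma>) * (\<Prod>i<t. v i (\<sigma> i)))"
proof -
  have "det_rows t v = (\<Sum>\<sigma>\<in>{\<sigma>. \<sigma> permutes {..<t}}. of_int (sign \<sigma>) * (\<Prod>i<t. mat t t (\<lambda>(i, j). v i j) $$ (i, \<sigma> i)))"
    unfolding det_rows_def Determinant.det_def by (simp add: atLeast0LessThan)
  also have "\<dots> = (\<Sum>\<sigma>\<in>{\<sigma>. \<sigma> permutes {..<t}}. of_int (sign \<sigma>) * (\<Prod>i<t. v i (\<sigma> i)))"
  proof (intro sum.cong refl arg_cong2[where f="(*)"] prod.cong)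
    fix \<sigma> i assume s: "\<sigma> \<in> {\<sigma>. \<sigma> permutes {..<t}}" and i: "i \<in> {..<t}"
    then have "\<sigma> i < t" using permutes_in_image[of \<sigma> "{..<t}" i] by simp
    then show "mat t t (\<lambda>(i, j). v i j) $$ (i, \<sigma> i) = v i (\<sigma> i)" using i by simp
  qed
  finally show ?thesis .
qed

lemma det_rows_cong:
  assumes "ideal_set P" "\<And>i j. i < t \<Longrightarrow> j < t \<Longrightarrow> v i j - v' i j \<in> P"
  shows "det_rows t v - det_rows t v' \<in> P"
proof -
  have "of_int (sign \<sigma>) * ((\<Prod>i<t. v i (\<sigma> i)) - (\<Prod>i<t. v' i (\<sigma> i))) \<in> P" if "\<sigma> permutes {..<t}" for \<sigma>
    using permutes_in_image[OF that] assms(2)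
    by (intro ideal_setD(3)[OF assms(1)] ideal_cong_prod[OF assms(1)]) auto
  then have "(\<Sum>\<sigma>\<in>{\<sigma>. \<sigma> permutes {..<t}}. of_int (sign \<sigma>) * ((\<Prod>i<t. v i (\<sigma> i)) - (\<Prod>i<t. v' i (\<sigma> i)))) \<in> P"
    by (intro ideal_set_sum[OF assms(1)]) auto
  then show ?thesis by (simp add: det_rows_expansion right_diff_distrib sum_subtractf)
qed

lemma det_rows_mult:
  "det_rows t (\<lambda>i j. \<Sum>l<t. c i l * b l j) = det_rows t c * det_rows t b"
proof -
  have "mat t t (\<lambda>(i, j). \<Sum>l<t. c i l * b l j) = mat t t (\<lambda>(i, j). c i j) * mat t t (\<lambda>(i, j). b i j)"
    by (intro eq_matI) (auto simp: scalar_prod_def atLeast0LessThan)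
  then show ?thesis unfolding det_rows_def by (simp add: det_mult[of _ t])
qed

lemma det_rows_triangular:
  assumes "\<And>i j. i < j \<Longrightarrow> j < t \<Longrightarrow> b i j = 0"
  shows "det_rows t b = (\<Prod>i<t. b i i)"
proof -
  have "det_rows t b = prod_list (diag_mat (mat t t (\<lambda>(i, j). b i j)))"
    unfolding det_rows_def by (rule det_lower_triangular[of t]) (auto simp: assms)
  also have "\<dots> = (\<Prod>i<t. b i i)"
    by (auto simp: diag_mat_def atLeast0LessThan prod.list_conv_set_nth intro!: prod.cong)
  finally show ?thesis .
qed

text \<open>Laplace expansion along the replaced row turns the determinants on the right into the entries of
  \<open>u\<close> times the adjugate.\<close>

lemma cramer_rows:
  fixes v :: "nat \<Rightarrow> nat \<Rightarrow> 'r::comm_ring_1"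
  assumes "j < t"
  shows "det_rows t v * u j = (\<Sum>i<t. det_rows t (v(i := u)) * v i j)"
proof -
  let ?A = "mat t t (\<lambda>(i, j). v i j)"
  have A: "?A \<in> carrier_mat t t" by simp
  have c: "det_rows t (v(i := u)) = (\<Sum>k<t. u k * cofactor ?A i k)" if "i < t" for i
  proof -
    let ?B = "mat t t (\<lambda>(k, j). (v(i := u)) k j)"
    have "Determinant.det ?B = (\<Sum>k<t. ?B $$ (i, k) * cofactor ?B i k)"
      using laplace_expansion_row[of ?B t i] that by simp
    moreover have "cofactor ?B i k = cofactor ?A i k" if "k < t" for k
      using \<open>i < t\<close> that unfolding cofactor_def mat_delete_def
      by (intro arg_cong2[where f="(*)"] refl arg_cong[where f=Determinant.det] eq_matI) auto
    ultimately show ?thesis using that by (simp add: det_rows_def)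
  qed
  have adj: "(\<Sum>i<t. cofactor ?A i k * v i j) = (if k = j then det_rows t v else 0)" if "k < t" for k
  proof -
    have "(adj_mat ?A * ?A) $$ (k, j) = (Determinant.det ?A \<cdot>\<^sub>m 1\<^sub>m t) $$ (k, j)"
      using adj_mat(3)[OF A] by simp
    then show ?thesis using that assms
      by (auto simp: adj_mat_def scalar_prod_def atLeast0LessThan det_rows_def)
  qed
  have "(\<Sum>i<t. det_rows t (v(i := u)) * v i j) = (\<Sum>i<t. \<Sum>k<t. u k * (cofactor ?A i k * v i j))"
    by (intro sum.cong) (auto simp: c sum_distrib_left ac_simps)
  also have "\<dots> = (\<Sum>k<t. u k * (\<Sum>i<t. cofactor ?A i k * v i j))"
    by (subst sum.swap) (simp add: sum_distrib_left)
  also have "\<dots> = (\<Sum>k<t. if k = j then u k * det_rows t v else 0)"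
    by (intro sum.cong) (auto simp: adj)
  also have "\<dots> = det_rows t v * u j" using assms by (simp add: ac_simps)
  finally show ?thesis by simp
qed

text \<open>A linear relation between the rows is multiplied by the adjugate.\<close>

lemma det_rows_cancel:
  fixes v :: "nat \<Rightarrow> nat \<Rightarrow> 'r::comm_ring_1"
  assumes P: "ideal_set P" and rel: "\<And>j. j < t \<Longrightarrow> (\<Sum>i<t. c i * v i j) \<in> P" and "l < t"
  shows "det_rows t v * c l \<in> P"
proof -
  let ?A = "mat t t (\<lambda>(i, j). v i j)"
  have A: "?A \<in> carrier_mat t t" by simp
  have adj: "(\<Sum>k<t. v i k * cofactor ?A l k) = (if i = l then det_rows t v else 0)" if "i < t" for i
  proof -
    have "(?A * adj_mat ?A) $$ (i, l) = (Determinant.det ?A \<cdot>\<^sub>m 1\<^sub>m t) $$ (i, l)"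
      using adj_mat(2)[OF A] by simp
    then show ?thesis using that assms
      by (auto simp: adj_mat_def scalar_prod_def atLeast0LessThan det_rows_def)
  qed
  have "(\<Sum>k<t. cofactor ?A l k * (\<Sum>i<t. c i * v i k)) = (\<Sum>i<t. c i * (\<Sum>k<t. v i k * cofactor ?A l k))"
    unfolding sum_distrib_left by (subst sum.swap) (simp add: ac_simps)
  also have "\<dots> = (\<Sum>i<t. if i = l then c i * det_rows t v else 0)"
    by (intro sum.cong) (auto simp: adj)
  also have "\<dots> = det_rows t v * c l" using assms by (simp add: ac_simps)
  finally show ?thesis using ideal_set_sum[OF P, of "{..<t}"] ideal_setD(3)[OF P] rel by (metis (no_types, lifting) lessThan_iff)
qed

section \<open>Lattices over discrete valuation rings\<close>

lemma subgroup_index_trivial: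
  assumes "add_subgroup H" "G \<subseteq> H" "add_subgroup G" shows "subgroup_index G H = 1"
proof -
  have "subgroup_index G H = card ((\<lambda>_. ()) ` G)"
    using assms add_subgroupD(2)[OF assms(1)] by (intro subgroup_index_eq_card) auto
  also have "(\<lambda>_. ()) ` G = {()}" using add_subgroupD(1)[OF assms(3)] by auto
  finally show ?thesis by simp
qed

lemma subgroup_index_eq_1:
  assumes H: "add_subgroup H" and G: "add_subgroup G" and 1: "subgroup_index G H = 1"
  shows "G \<subseteq> H"
proof
  fix v assume v: "v \<in> G"
  obtain a where a: "add_coset H ` G = {a}"
    using 1 unfolding subgroup_index_def by (auto simp: card_1_singleton_iff)
  have "add_coset H v = a" "add_coset H 0 = a" using a v add_subgroupD(1)[OF G] by blast+
  then show "v \<in> H" using coset_eq_iff[OF H, of v 0] by simp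
qed

text \<open>A discrete valuation ring with uniformizer \<open>w\<close>, presented as the quotient of the ambient ring by
  the prime ideal \<open>P\<close>.\<close>

locale dvr_mod =
  fixes P :: "'r::comm_ring_1 set" and w :: 'r
  assumes ideal: "ideal_set P"
    and power_notin: "w ^ k \<notin> P"
    and decomp: "r \<notin> P \<Longrightarrow> \<exists>k u v. r - w ^ k * u \<in> P \<and> u * v - 1 \<in> P"
begin

lemma cancel_power:
  assumes "w ^ k * r \<in> P" shows "r \<in> P"
proof (rule ccontr)
  assume "r \<notin> P"
  then obtain j u v where r: "r - w ^ j * u \<in> P" and uv: "u * v - 1 \<in> P" using decomp by blast
  have "w ^ (k + j) * (u * v - 1) + v * w ^ k * (r - w ^ j * u) \<in> P"
    using r uv by (intro ideal_setD(2)[OF ideal] ideal_setD(3)[OF ideal])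
  moreover have "w ^ k * r * v \<in> P" using assms by (rule ideal_setD(4)[OF ideal])
  ultimately have "w ^ k * r * v - (w ^ (k + j) * (u * v - 1) + v * w ^ k * (r - w ^ j * u)) \<in> P"
    by (intro ideal_setD(6)[OF ideal])
  then have "w ^ (k + j) \<in> P" by (simp add: algebra_simps power_add)
  then show False using power_notin by blast
qed

text \<open>The exponent is the least one whose power lies in \<open>J\<close>.\<close>

lemma ideal_is_power:
  assumes J: "ideal_set J" and PJ: "P \<subseteq> J" and e: "w ^ e \<in> J"
  obtains k where "J = principal_mod P (w ^ k)"
proof -
  define k where "k = (LEAST k. w ^ k \<in> J)"
  have k: "w ^ k \<in> J" unfolding k_def using e by (rule LeastI)
  have "J \<subseteq> principal_mod P (w ^ k)"
  proof
    fix r assume r: "r \<in> J"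
    show "r \<in> principal_mod P (w ^ k)"
    proof (cases "r \<in> P")
      case True then show ?thesis using principal_mod_subset by blast
    next
      case False
      then obtain j u v where r': "r - w ^ j * u \<in> P" and uv: "u * v - 1 \<in> P" using decomp by blast
      have "w ^ j * u \<in> J" using r r' PJ ideal_cong_iff[OF J] by blast
      then have "w ^ j * u * v \<in> J" by (rule ideal_setD(4)[OF J])
      moreover have "w ^ j * (u * v - 1) \<in> J" using uv PJ by (intro ideal_setD(3)[OF J]) auto
      ultimately have "w ^ j * u * v - w ^ j * (u * v - 1) \<in> J" by (rule ideal_setD(6)[OF J])
      then have "w ^ j \<in> J" by (simp add: algebra_simps)
      then have "k \<le> j" unfolding k_def by (rule Least_le)
      then have "w ^ j = w ^ k * w ^ (j - k)" by (simp flip: power_add)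
      then have "r - w ^ k * (w ^ (j - k) * u) \<in> P" using r' by (simp add: ac_simps)
      then show ?thesis by (auto simp: principal_mod_def)
    qed
  qed
  then show ?thesis using that principal_mod_least[OF J PJ k] by blast
qed

text \<open>Multiplication by \<open>w ^ k\<close> identifies each successive quotient with the residue field.\<close>

lemma index_power:
  "subgroup_index UNIV (principal_mod P (w ^ k)) = subgroup_index UNIV (principal_mod P w) ^ k"
proof (induction k)
  case 0
  have "x \<in> principal_mod P (w ^ 0)" for x
    using principal_mod_mult[OF ideal_setD(1)[OF ideal], of "w ^ 0" x] by simp
  then have "principal_mod P (w ^ 0) = UNIV" by blast
  then show ?case by (simp add: subgroup_index_trivial add_subgroup_UNIV)
next
  case (Suc k)
  let ?K = "principal_mod P (w ^ k)" and ?H = "principal_mod P (w ^ Suc k)"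
  have iK: "ideal_set ?K" and iH: "ideal_set ?H" and i1: "ideal_set (principal_mod P w)"
    by (intro ideal_set_principal ideal)+
  have HK: "?H \<subseteq> ?K"
    using principal_mod_mult[OF ideal_setD(1)[OF ideal], of "w ^ k" w]
    by (intro principal_mod_least iK principal_mod_subset) (simp add: mult.commute)
  have "subgroup_index UNIV (principal_mod P w) = subgroup_index ?K ?H"
  proof (rule subgroup_index_transfer[OF ideal_set_subgroup[OF i1] ideal_set_subgroup[OF iH], where f="\<lambda>r. w ^ k * r"])
    show "w ^ k * r - w ^ k * s \<in> ?H \<longleftrightarrow> r - s \<in> principal_mod P w" for r s
    proof -
      have "w ^ k * r - w ^ k * s - w ^ Suc k * a = w ^ k * (r - s - w * a)" for a
        by (simp add: algebra_simps)
      moreover have "w ^ k * c \<in> P \<longleftrightarrow> c \<in> P" for c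
        using cancel_power ideal_setD(3)[OF ideal] by blast
      ultimately show ?thesis by (simp add: principal_mod_def)
    qed
    show "w ^ k * r \<in> ?K" for r by (rule principal_mod_mult[OF ideal_setD(1)[OF ideal]])
    show "\<exists>u\<in>UNIV. v - w ^ k * u \<in> ?H" if "v \<in> ?K" for v
      using that principal_mod_subset[of P "w ^ Suc k"] by (auto simp: principal_mod_def[of P "w ^ k"])
  qed
  moreover have "subgroup_index UNIV ?H = subgroup_index UNIV ?K * subgroup_index ?K ?H"
    by (intro subgroup_index_tower ideal_set_subgroup iK iH add_subgroup_UNIV HK) auto
  ultimately show ?case using Suc by simp
qed

text \<open>The Hermite normal form. The last coordinates of the vectors in \<open>L\<close> form an ideal, generated modulo
  \<open>P\<close> by a power of \<open>w\<close>. A vector \<open>b'\<close> of \<open>L\<close> with this last coordinate completes a basis of the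
  vectors of \<open>L\<close> whose last coordinate vanishes, and the index of \<open>L\<close> is the index of the ideal times
  the index of this smaller lattice \<open>L'\<close>.\<close>

lemma triangular_basis:
  assumes "submodule_set L" and "vec_in t P \<subseteq> L" and "\<And>v. w ^ e *v v \<in> L"
  shows "\<exists>b \<kappa>. (\<forall>i<t. b i \<in> L) \<and> (\<forall>i<t. \<forall>j>i. b i j = 0) \<and> (\<forall>i<t. b i i = w ^ \<kappa> i)
     \<and> (\<forall>v\<in>L. \<exists>c. v - (\<Sum>i<t. c i *v b i) \<in> vec_in t P)
     \<and> subgroup_index UNIV L = subgroup_index UNIV (principal_mod P w) ^ (\<Sum>i<t. \<kappa> i :: nat)"
  using assms
proof (induction t arbitrary: L)
  case 0
  have "L = UNIV" using 0 by (auto simp: vec_in_def)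
  then show ?case by (simp add: vec_in_def subgroup_index_trivial add_subgroup_UNIV)
next
  case (Suc t)
  note L = Suc.prems(1) and PL = Suc.prems(2) and eL = Suc.prems(3)
  define J where "J = (\<lambda>v. v t) ` L"
  have J: "ideal_set J" unfolding ideal_set_def
  proof (intro conjI ballI allI)
    show "0 \<in> J" unfolding J_def using submodule_setD(1)[OF L] by (intro image_eqI[where x=0]) auto
    show "a + b \<in> J" if ab: "a \<in> J" "b \<in> J" for a b
    proof -
      obtain u v where "u \<in> L" "v \<in> L" "a = u t" "b = v t" using ab unfolding J_def by blast
      then show ?thesis using submodule_setD(2)[OF L] unfolding J_def by (intro image_eqI[where x="u + v"]) auto
    qed
    show "r * a \<in> J" if a: "a \<in> J" for r a
    proof -
      obtain u where "u \<in> L" "a = u t" using a unfolding J_def by blast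
      then show ?thesis using submodule_setD(3)[OF L] unfolding J_def by (intro image_eqI[where x="r *v u"]) auto
    qed
  qed
  have PJ: "P \<subseteq> J"
  proof
    fix a assume "a \<in> P"
    then have "(\<lambda>j. if j = t then a else 0) \<in> vec_in (Suc t) P"
      using ideal_setD(1)[OF ideal] by (auto simp: vec_in_def)
    then show "a \<in> J" using PL unfolding J_def by (force intro: image_eqI[of _ _ "\<lambda>j. if j = t then a else 0"])
  qed
  have eJ: "w ^ e \<in> J" using eL[of "\<lambda>_. 1"] unfolding J_def by force
  obtain k where k: "J = principal_mod P (w ^ k)" using ideal_is_power[OF J PJ eJ] .
  have "w ^ k \<in> J" using principal_mod_mult[OF ideal_setD(1)[OF ideal], of "w ^ k" 1] by (simp add: k)
  then obtain b0 where b0: "b0 \<in> L" "b0 t = w ^ k" unfolding J_def by force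
  define b' where "b' = (\<lambda>j. if j \<le> t then b0 j else 0)"
  have "b0 - b' \<in> vec_in (Suc t) P" using ideal_setD(1)[OF ideal] by (auto simp: vec_in_def b'_def)
  then have b': "b' \<in> L" using b0 PL submodule_cong_iff[OF L, of b0 b'] by blast
  have b't: "b' t = w ^ k" and b'0: "\<And>j. j > t \<Longrightarrow> b' j = 0" using b0 by (auto simp: b'_def)
  define L' where "L' = {v. v(t := 0) \<in> L}"
  have upd: "(u + v)(t := 0) = u(t := 0) + v(t := 0)" "(r *v v)(t := 0) = r *v (v(t := 0))"
    "(u - v)(t := 0) = u(t := 0) - v(t := 0)" "(0::nat \<Rightarrow> 'r)(t := 0) = 0" for u v :: "nat \<Rightarrow> 'r" and r
    by (auto simp: fun_eq_iff)
  have L': "submodule_set L'" unfolding L'_def submodule_set_def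
    using submodule_setD[OF L] by (auto simp: upd)
  have PL': "vec_in t P \<subseteq> L'" unfolding L'_def
    using PL ideal_setD(1)[OF ideal] by (auto simp: vec_in_def less_Suc_eq)
  have eL': "w ^ e *v v \<in> L'" for v unfolding L'_def mem_Collect_eq upd(2) by (rule eL)
  obtain b \<kappa> where IH: "(\<forall>i<t. b i \<in> L') \<and> (\<forall>i<t. \<forall>j>i. b i j = 0) \<and> (\<forall>i<t. b i i = w ^ \<kappa> i)
     \<and> (\<forall>v\<in>L'. \<exists>c. v - (\<Sum>i<t. c i *v b i) \<in> vec_in t P)
     \<and> subgroup_index UNIV L' = subgroup_index UNIV (principal_mod P w) ^ (\<Sum>i<t. \<kappa> i :: nat)"
    using Suc.IH[OF L' PL' eL'] by (elim exE) (rule that)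
  then have b: "\<And>i. i < t \<Longrightarrow> b i \<in> L'" "\<And>i j. i < t \<Longrightarrow> j > i \<Longrightarrow> b i j = 0"
      "\<And>i. i < t \<Longrightarrow> b i i = w ^ \<kappa> i"
      and sp: "\<And>v. v \<in> L' \<Longrightarrow> \<exists>c. v - (\<Sum>i<t. c i *v b i) \<in> vec_in t P"
      and idx: "subgroup_index UNIV L' = subgroup_index UNIV (principal_mod P w) ^ (\<Sum>i<t. \<kappa> i :: nat)"
    by simp_all
  have bL: "b i \<in> L" if "i < t" for i
  proof -
    have "(b i)(t := 0) = b i" using b(2)[OF that that] by (simp add: fun_upd_idem)
    then show ?thesis using b(1)[OF that] by (simp add: L'_def)
  qed
  define \<beta> where "\<beta> i = (if i < t then b i else b')" for i
  define \<kappa>' where "\<kappa>' i = (if i < t then \<kappa> i else k)" for i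
  show ?case
  proof (intro exI[of _ \<beta>] exI[of _ \<kappa>'] conjI allI impI ballI)
    show "\<beta> i \<in> L" if "i < Suc t" for i using bL b' by (simp add: \<beta>_def)
    show "\<beta> i j = 0" if "i < Suc t" "j > i" for i j
      using that b(2)[of i j] b'0[of j] by (cases "i < t") (auto simp: \<beta>_def less_Suc_eq)
    show "\<beta> i i = w ^ \<kappa>' i" if "i < Suc t" for i
      using that b(3)[of i] b't by (cases "i < t") (auto simp: \<beta>_def \<kappa>'_def less_Suc_eq)
    show "\<exists>c. v - (\<Sum>i<Suc t. c i *v \<beta> i) \<in> vec_in (Suc t) P" if v: "v \<in> L" for v
    proof -
      have "v t \<in> principal_mod P (w ^ k)" using v k by (auto simp: J_def)
      then obtain c where c: "v t - w ^ k * c \<in> P" by (auto simp: principal_mod_def)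
      define u where "u = v - c *v b'"
      have u: "u \<in> L" "u t \<in> P" using submodule_setD(5)[OF L v submodule_setD(3)[OF L b', of c]] b't c
        by (simp_all add: u_def mult.commute)
      have "u - u(t := 0) \<in> vec_in (Suc t) P" using u ideal_setD(1)[OF ideal] by (auto simp: vec_in_def)
      then have "u \<in> L'" using u PL submodule_cong_iff[OF L, of u "u(t := 0)"] by (auto simp: L'_def)
      then obtain c' where c': "u - (\<Sum>i<t. c' i *v b i) \<in> vec_in t P" using sp by blast
      define c'' where "c'' i = (if i < t then c' i else c)" for i
      have eq: "v - (\<Sum>i<Suc t. c'' i *v \<beta> i) = u - (\<Sum>i<t. c' i *v b i)"
        by (simp add: c''_def \<beta>_def u_def)
      have "(u - (\<Sum>i<t. c' i *v b i)) t \<in> P" using u(2) b(2) by (simp add: vec_sum_apply)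
      then have "u - (\<Sum>i<t. c' i *v b i) \<in> vec_in (Suc t) P"
        using c' by (auto simp: vec_in_def less_Suc_eq)
      then show ?thesis by (intro exI[of _ c'']) (simp only: eq)
    qed
    define K where "K = {v :: nat \<Rightarrow> 'r. v t \<in> J}"
    have sK: "add_subgroup K" unfolding K_def add_subgroup_def
      using ideal_setD[OF J] by auto
    note sJ = ideal_set_subgroup[OF J] and sL = submodule_set_subgroup[OF L]
      and sL' = submodule_set_subgroup[OF L']
    have LK: "L \<subseteq> K" by (auto simp: K_def J_def)
    have 1: "subgroup_index UNIV K = subgroup_index UNIV J"
    proof (rule subgroup_index_transfer[OF sK sJ, where f="\<lambda>v. v t"])
      show "\<exists>u\<in>UNIV. v - u t \<in> J" for v
        using ideal_setD(1)[OF J] by (intro bexI[of _ "\<lambda>_. v"]) auto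
    qed (simp_all add: K_def)
    have 2: "subgroup_index UNIV L' = subgroup_index K L"
    proof (rule subgroup_index_transfer[OF sL' sL, where f="\<lambda>v. v(t := 0)"])
      show "u(t := 0) - v(t := 0) \<in> L \<longleftrightarrow> u - v \<in> L'" for u v by (simp add: L'_def upd)
      show "u(t := 0) \<in> K" for u using ideal_setD(1)[OF J] by (simp add: K_def)
      show "\<exists>u\<in>UNIV. v - u(t := 0) \<in> L" if "v \<in> K" for v
      proof -
        obtain l where l: "l \<in> L" "l t = v t" using \<open>v \<in> K\<close> by (auto simp: K_def J_def)
        then have "(v - l)(t := 0) = v - l" by (simp add: fun_upd_idem)
        then have "v - (v - l)(t := 0) \<in> L" using l by simp
        then show ?thesis by blast
      qed
    qed
    have "subgroup_index UNIV L = subgroup_index UNIV K * subgroup_index K L"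
      by (intro subgroup_index_tower sL sK add_subgroup_UNIV LK) auto
    also have "\<dots> = subgroup_index UNIV (principal_mod P w) ^ (\<Sum>i<Suc t. \<kappa>' i)"
      unfolding 1 2[symmetric] idx k index_power by (simp add: \<kappa>'_def power_add)
    finally show "subgroup_index UNIV L = subgroup_index UNIV (principal_mod P w) ^ (\<Sum>i<Suc t. \<kappa>' i)" .
  qed
qed

end

text \<open>The preimage, in the ambient ring, of the Fitting ideal of the quotient of the free module of rank
  \<open>t\<close> by \<open>N\<close>.\<close>

definition fitting :: "'r::comm_ring_1 set \<Rightarrow> nat \<Rightarrow> (nat \<Rightarrow> 'r) set \<Rightarrow> 'r set" where
  "fitting Z t N = ideal_gen (Z \<union> {det_rows t v | v. \<forall>i<t. v i \<in> N})"

lemma fitting_ideal_set: "ideal_set (fitting Z t N)" by (simp add: fitting_def ideal_gen_ideal)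

lemma fitting_superset: "Z \<subseteq> fitting Z t N"
  using ideal_gen_superset unfolding fitting_def by blast

lemma det_in_fitting: "(\<And>i. i < t \<Longrightarrow> v i \<in> N) \<Longrightarrow> det_rows t v \<in> fitting Z t N"
  unfolding fitting_def by (rule subsetD[OF ideal_gen_superset]) auto

lemma fitting_least:
  assumes "ideal_set J" "Z \<subseteq> J" "\<And>v. (\<And>i. i < t \<Longrightarrow> v i \<in> N) \<Longrightarrow> det_rows t v \<in> J"
  shows "fitting Z t N \<subseteq> J"
  unfolding fitting_def using assms by (intro ideal_gen_least) auto

text \<open>Expressing vectors through the rows \<open>n\<close> multiplies their determinant by that of the coefficients.\<close>

lemma fitting_span:
  assumes Z: "ideal_set Z" and n: "\<And>i. i < t \<Longrightarrow> n i \<in> N"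
    and span: "\<And>v. v \<in> N \<Longrightarrow> \<exists>c. v - (\<Sum>i<t. c i *v n i) \<in> vec_in t Z"
  shows "fitting Z t N = principal_mod Z (det_rows t n)"
proof
  have iP: "ideal_set (principal_mod Z (det_rows t n))" by (intro ideal_set_principal Z)
  show "fitting Z t N \<subseteq> principal_mod Z (det_rows t n)"
  proof (rule fitting_least[OF iP principal_mod_subset])
    fix v assume v: "\<And>i. i < t \<Longrightarrow> v i \<in> N"
    have "\<forall>i\<in>{..<t}. \<exists>c. v i - (\<Sum>l<t. c l *v n l) \<in> vec_in t Z" using span v by simp
    from bchoice[OF this] obtain c where c: "\<And>i. i < t \<Longrightarrow> v i - (\<Sum>l<t. c i l *v n l) \<in> vec_in t Z"
      by auto
    have "det_rows t v - det_rows t (\<lambda>i j. \<Sum>l<t. c i l * n l j) \<in> Z"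
      using c by (intro det_rows_cong[OF Z]) (auto simp: vec_in_def vec_sum_apply)
    then have "det_rows t v - det_rows t n * det_rows t c \<in> Z"
      by (simp add: det_rows_mult ac_simps)
    then show "det_rows t v \<in> principal_mod Z (det_rows t n)" by (auto simp: principal_mod_def)
  qed
  show "principal_mod Z (det_rows t n) \<subseteq> fitting Z t N"
    by (intro principal_mod_least fitting_ideal_set fitting_superset det_in_fitting n)
qed

text \<open>The determinant of a triangular basis is a power of \<open>w\<close> whose exponent is the length of the
  quotient by \<open>L\<close>.\<close>

lemma (in dvr_mod) fitting_index:
  assumes "submodule_set L" and "vec_in t P \<subseteq> L" and "\<And>v. w ^ e *v v \<in> L"
  shows "subgroup_index UNIV L = subgroup_index UNIV (fitting P t L)"
proof -
  obtain b \<kappa> where "(\<forall>i<t. b i \<in> L) \<and> (\<forall>i<t. \<forall>j>i. b i j = 0) \<and> (\<forall>i<t. b i i = w ^ \<kappa> i)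
     \<and> (\<forall>v\<in>L. \<exists>c. v - (\<Sum>i<t. c i *v b i) \<in> vec_in t P)
     \<and> subgroup_index UNIV L = subgroup_index UNIV (principal_mod P w) ^ (\<Sum>i<t. \<kappa> i :: nat)"
    using triangular_basis[OF assms] by (elim exE) (rule that)
  then have b: "\<And>i. i < t \<Longrightarrow> b i \<in> L" "\<And>i j. i < t \<Longrightarrow> j > i \<Longrightarrow> b i j = 0"
      "\<And>i. i < t \<Longrightarrow> b i i = w ^ \<kappa> i"
      and sp: "\<And>v. v \<in> L \<Longrightarrow> \<exists>c. v - (\<Sum>i<t. c i *v b i) \<in> vec_in t P"
      and idx: "subgroup_index UNIV L = subgroup_index UNIV (principal_mod P w) ^ (\<Sum>i<t. \<kappa> i :: nat)"
    by simp_all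
  have "det_rows t b = (\<Prod>i<t. w ^ \<kappa> i)"
    by (subst det_rows_triangular) (auto intro!: prod.cong simp: b)
  also have "\<dots> = w ^ (\<Sum>i<t. \<kappa> i)" by (simp add: power_sum)
  finally have "fitting P t L = principal_mod P (w ^ (\<Sum>i<t. \<kappa> i))"
    using fitting_span[OF ideal b(1) sp] by simp
  then show ?thesis by (simp add: idx index_power)
qed

text \<open>Fitting ideals are compatible with the passage to the quotient by \<open>P\<close>.\<close>

lemma fitting_sumset:
  assumes Z: "ideal_set Z" and P: "ideal_set P" and ZP: "Z \<subseteq> P" and N: "submodule_set N"
  shows "fitting P t (sumset N (vec_in t P)) = sumset (fitting Z t N) P"
proof
  have iS: "ideal_set (sumset (fitting Z t N) P)" by (intro sumset_ideal fitting_ideal_set P)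
  have s: "fitting Z t N \<subseteq> sumset (fitting Z t N) P" "P \<subseteq> sumset (fitting Z t N) P"
    by (intro subset_sumset subset_sumset2 ideal_setD(1) P fitting_ideal_set)+
  show "fitting P t (sumset N (vec_in t P)) \<subseteq> sumset (fitting Z t N) P"
  proof (rule fitting_least[OF iS s(2)])
    fix v assume "\<And>i. i < t \<Longrightarrow> v i \<in> sumset N (vec_in t P)"
    then have "\<forall>i\<in>{..<t}. \<exists>n. n \<in> N \<and> v i - n \<in> vec_in t P" by (auto simp: sumset_def)
    from bchoice[OF this] obtain n where n: "\<And>i. i < t \<Longrightarrow> n i \<in> N" "\<And>i. i < t \<Longrightarrow> v i - n i \<in> vec_in t P"
      by auto
    have "det_rows t v - det_rows t n \<in> P"
      using n(2) by (intro det_rows_cong[OF P]) (auto simp: vec_in_def)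
    then show "det_rows t v \<in> sumset (fitting Z t N) P"
      using det_in_fitting[of t n N Z] n(1) by (auto simp: sumset_def)
  qed
  have "N \<subseteq> sumset N (vec_in t P)"
    by (intro subset_sumset submodule_setD(1) vec_in_submodule P)
  then have "fitting Z t N \<subseteq> fitting P t (sumset N (vec_in t P))"
    using ZP fitting_superset[of P t] by (intro fitting_least fitting_ideal_set det_in_fitting) blast+
  moreover have "P \<subseteq> fitting P t (sumset N (vec_in t P))" by (rule fitting_superset)
  ultimately show "sumset (fitting Z t N) P \<subseteq> fitting P t (sumset N (vec_in t P))"
    using ideal_cong_iff[OF fitting_ideal_set[of P t "sumset N (vec_in t P)"]] unfolding sumset_def by blast
qed

section \<open>Nodes\<close>

text \<open>The generators are eliminated one at a time: the last one is congruent to a combination in which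
  it occurs itself with a coefficient divisible by \<open>w\<close>, so that one minus this coefficient is
  invertible and expresses it through the others. The scalars form a subset \<open>R\<close> of the ring, because
  the lemma is applied both to the ring itself and to a subring.\<close>

lemma nakayama_mod:
  fixes s :: "'r::comm_ring_1 \<Rightarrow> 'b::ab_group_add \<Rightarrow> 'b" and g :: "nat \<Rightarrow> 'b"
  assumes s: "Modules.module s"
    and N0: "add_subgroup N0" "\<And>r a. r \<in> R \<Longrightarrow> a \<in> N0 \<Longrightarrow> s r a \<in> N0"
    and R: "w \<in> R" "\<And>a b. a \<in> R \<Longrightarrow> b \<in> R \<Longrightarrow> a + b \<in> R" "\<And>a b. a \<in> R \<Longrightarrow> b \<in> R \<Longrightarrow> a * b \<in> R"
    and unit: "\<And>a. a \<in> R \<Longrightarrow> \<exists>u\<in>R. \<forall>v\<in>N. s (u * (1 - w * a)) v - v \<in> N0"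
    and wN: "\<And>v. v \<in> N \<Longrightarrow> \<exists>v'\<in>N. v - s w v' \<in> N0"
    and g: "\<And>i. i < m \<Longrightarrow> g i \<in> N"
    and gen: "\<And>v. v \<in> N \<Longrightarrow> \<exists>c. (\<forall>i<m. c i \<in> R) \<and> v - (\<Sum>i<m. s (c i) (g i)) \<in> N0"
  shows "N \<subseteq> N0"
  using g gen
proof (induction m)
  case 0
  then show ?case by auto
next
  case (Suc m)
  interpret Modules.module s by (rule s)
  note D = add_subgroupD[OF N0(1)]
  obtain h where h: "h \<in> N" "g m - s w h \<in> N0" using wN Suc.prems(1)[of m] by blast
  obtain c where c: "\<And>i. i < Suc m \<Longrightarrow> c i \<in> R" "h - (\<Sum>i<Suc m. s (c i) (g i)) \<in> N0"
    using Suc.prems(2)[OF h(1)] by blast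
  obtain u where u: "u \<in> R" "\<And>v. v \<in> N \<Longrightarrow> s (u * (1 - w * c m)) v - v \<in> N0"
    using unit[of "c m"] c(1) by blast
  have "s (u * w) (h - (\<Sum>i<Suc m. s (c i) (g i))) + s u (g m - s w h) \<in> N0"
    by (rule D(4)[OF N0(2)[OF R(3)[OF u(1) R(1)] c(2)] N0(2)[OF u(1) h(2)]])
  also have "s (u * w) (h - (\<Sum>i<Suc m. s (c i) (g i))) + s u (g m - s w h)
      = s (u * (1 - w * c m)) (g m) - (\<Sum>i<m. s (u * w * c i) (g i))"
    by (simp add: scale_right_diff_distrib scale_right_distrib scale_left_diff_distrib scale_sum_right algebra_simps)
  finally have "(s (u * (1 - w * c m)) (g m) - (\<Sum>i<m. s (u * w * c i) (g i)))
      - (s (u * (1 - w * c m)) (g m) - g m) \<in> N0"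
    by (rule D(2)[OF _ u(2)[OF Suc.prems(1)[OF lessI]]])
  then have e: "g m - (\<Sum>i<m. s (u * w * c i) (g i)) \<in> N0" by (simp add: algebra_simps)
  show ?case
  proof (rule Suc.IH)
    show "g i \<in> N" if "i < m" for i using Suc.prems(1) that by simp
    fix v assume "v \<in> N"
    then obtain d where d: "\<And>i. i < Suc m \<Longrightarrow> d i \<in> R" "v - (\<Sum>i<Suc m. s (d i) (g i)) \<in> N0"
      using Suc.prems(2) by blast
    have "(v - (\<Sum>i<Suc m. s (d i) (g i))) + s (d m) (g m - (\<Sum>i<m. s (u * w * c i) (g i))) \<in> N0"
      by (rule D(4)[OF d(2) N0(2)[OF d(1)[OF lessI] e]])
    also have "(v - (\<Sum>i<Suc m. s (d i) (g i))) + s (d m) (g m - (\<Sum>i<m. s (u * w * c i) (g i)))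
      = v - (\<Sum>i<m. s (d i + d m * (u * w * c i)) (g i))"
      by (simp add: scale_right_diff_distrib scale_left_distrib scale_sum_right sum.distrib algebra_simps)
    finally show "\<exists>c. (\<forall>i<m. c i \<in> R) \<and> v - (\<Sum>i<m. s (c i) (g i)) \<in> N0"
      using d(1) c(1) u(1) R by (intro exI[of _ "\<lambda>i. d i + d m * (u * w * c i)"]) simp
  qed
qed

lemma module_scale_vec: "Modules.module (scale_vec :: 'r::comm_ring_1 \<Rightarrow> _)"
  by unfold_locales (auto simp: fun_eq_iff algebra_simps)

text \<open>Modulo \<open>Z\<close> this describes a local ring with maximal ideal \<open>(x, y)\<close> in which \<open>x\<close> and \<open>y\<close> generate
  each other's annihilators. Separatedness and non-nilpotency in the quotients by \<open>(y)\<close> and by \<open>(x)\<close>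
  make these discrete valuation rings; the standard example is \<open>k[[x, y]]/(x y)\<close>. All assumptions are
  symmetric in \<open>x\<close> and \<open>y\<close>.\<close>

locale node =
  fixes Z :: "'r::comm_ring_1 set" and x y :: 'r
  assumes Z: "ideal_set Z"
    and xy: "x * y \<in> Z"
    and ann_x: "x * r \<in> Z \<Longrightarrow> r \<in> principal_mod Z y"
    and ann_y: "y * r \<in> Z \<Longrightarrow> r \<in> principal_mod Z x"
    and local: "r \<notin> principal_mod (principal_mod Z y) x \<Longrightarrow> \<exists>u. r * u - 1 \<in> Z"
    and sep_x: "(\<And>n. r \<in> principal_mod (principal_mod Z y) (x ^ n)) \<Longrightarrow> r \<in> principal_mod Z y"
    and sep_y: "(\<And>n. r \<in> principal_mod (principal_mod Z x) (y ^ n)) \<Longrightarrow> r \<in> principal_mod Z x"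
    and pow_x: "x ^ n \<notin> principal_mod Z y"
    and pow_y: "y ^ n \<notin> principal_mod Z x"
begin

abbreviation "px \<equiv> principal_mod Z x"
abbreviation "py \<equiv> principal_mod Z y"
abbreviation "mm \<equiv> principal_mod py x"

lemma px: "ideal_set px" and py: "ideal_set py" and mm: "ideal_set mm"
  by (intro ideal_set_principal Z)+

lemma principal_mod_swap: "principal_mod px y = mm"
proof -
  have "principal_mod (principal_mod Z a) b \<subseteq> principal_mod (principal_mod Z b) a" for a b
  proof
    fix r assume "r \<in> principal_mod (principal_mod Z a) b"
    then obtain s t where "r - b * s - a * t \<in> Z" by (auto simp: principal_mod_def)
    then have "r - a * t - b * s \<in> Z" by (simp add: algebra_simps)
    then show "r \<in> principal_mod (principal_mod Z b) a" by (auto simp: principal_mod_def)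
  qed
  then show ?thesis by blast
qed

lemma swap: "node Z y x"
proof
  show "ideal_set Z" "y * x \<in> Z" using Z xy by (simp_all add: mult.commute)
  show "\<exists>u. r * u - 1 \<in> Z" if "r \<notin> principal_mod px y" for r
    using that local by (simp add: principal_mod_swap)
qed (fact ann_x ann_y sep_x sep_y pow_x pow_y)+

lemma x_times_py: "r \<in> py \<Longrightarrow> x * r \<in> Z"
proof -
  assume "r \<in> py"
  then obtain s where "r - y * s \<in> Z" by (auto simp: principal_mod_def)
  then have "x * (r - y * s) + x * y * s \<in> Z" by (intro ideal_setD(2)[OF Z] ideal_setD(3)[OF Z \<open>r - y * s \<in> Z\<close>] ideal_setD(4)[OF Z xy])
  then show ?thesis by (simp add: algebra_simps)
qed

lemma ann_x_iff: "x * r \<in> Z \<longleftrightarrow> r \<in> py" using ann_x x_times_py by blast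

lemma one_notin_mm: "1 \<notin> mm"
proof
  assume "1 \<in> mm"
  then obtain s where s: "1 - x * s \<in> py" by (auto simp: principal_mod_def)
  have "1 \<in> principal_mod py (x ^ n)" for n
  proof -
    have "1 ^ n - (x * s) ^ n \<in> py" using ideal_cong_power[OF py s] .
    then show ?thesis by (auto simp: principal_mod_def power_mult_distrib)
  qed
  then have "1 \<in> py" by (rule sep_x)
  then show False using pow_x[of 0] by simp
qed

text \<open>For an element outside \<open>(y)\<close> there is a largest \<open>k\<close> such that it is divisible by \<open>x ^ k\<close> modulo \<open>y\<close>.
  The cofactor then lies outside the maximal ideal and is a unit.\<close>

sublocale dvr_mod py x
proof
  show "ideal_set py" by (rule py)
  show "x ^ k \<notin> py" for k by (rule pow_x)
  fix r assume r: "r \<notin> py"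
  then obtain n where n: "r \<notin> principal_mod py (x ^ n)" using sep_x by blast
  define n0 where "n0 = (LEAST n. r \<notin> principal_mod py (x ^ n))"
  have n0: "r \<notin> principal_mod py (x ^ n0)" unfolding n0_def using n by (rule LeastI)
  have "r \<in> principal_mod py (x ^ 0)"
    using principal_mod_mult[OF ideal_setD(1)[OF py], of 1 r] by simp
  then obtain k where k: "n0 = Suc k" using n0 by (cases n0) auto
  have "r \<in> principal_mod py (x ^ k)" 
    using not_less_Least[of k "\<lambda>n. r \<notin> principal_mod py (x ^ n)"] k unfolding n0_def by simp
  then obtain u where u: "r - x ^ k * u \<in> py" by (auto simp: principal_mod_def)
  have "u \<notin> mm"
  proof
    assume "u \<in> mm"
    then obtain s where "u - x * s \<in> py" by (auto simp: principal_mod_def)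
    then have "(r - x ^ k * u) + x ^ k * (u - x * s) \<in> py" 
      using u by (intro ideal_setD(2)[OF py] ideal_setD(3)[OF py])
    then have "r - x ^ n0 * s \<in> py" by (simp add: k algebra_simps)
    then show False using n0 by (auto simp: principal_mod_def)
  qed
  then obtain v where "u * v - 1 \<in> Z" using local by blast
  then have "u * v - 1 \<in> py" using principal_mod_subset by blast
  then show "\<exists>k u v. r - x ^ k * u \<in> py \<and> u * v - 1 \<in> py" using u by blast
qed

lemma px_Int_py: "r \<in> px \<Longrightarrow> r \<in> py \<Longrightarrow> r \<in> Z"
proof -
  assume "r \<in> px" "r \<in> py"
  then obtain a where a: "r - x * a \<in> Z" by (auto simp: principal_mod_def)
  have "x * r - x * (r - x * a) \<in> Z"
    by (rule ideal_setD(6)[OF Z x_times_py[OF \<open>r \<in> py\<close>] ideal_setD(3)[OF Z a]])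
  then have "x * (x * a) \<in> Z" by (simp add: algebra_simps)
  then have "x ^ 1 * a \<in> py" by (simp add: ann_x_iff)
  then have "a \<in> py" by (rule cancel_power)
  then show ?thesis using a ideal_cong_iff[OF Z a] ann_x_iff by blast
qed

text \<open>For a group ring, where \<open>x\<close> is the norm element, this is the order of the Tate cohomology group
  of degree 0.\<close>

definition defect :: "nat \<Rightarrow> (nat \<Rightarrow> 'r) set \<Rightarrow> nat" where
  "defect t N = subgroup_index (N \<inter> vec_in t px) (sumset ((*v) x ` N) (vec_in t Z))"

definition ideal_defect :: "'r set \<Rightarrow> nat" where
  "ideal_defect I = subgroup_index (I \<inter> px) (sumset ((*) x ` I) Z)"

lemma index_defect:
  assumes N: "submodule_set N" and ZN: "vec_in t Z \<subseteq> N"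
  shows "subgroup_index UNIV N * defect t N
    = subgroup_index UNIV (sumset N (vec_in t px)) * subgroup_index UNIV (sumset N (vec_in t py))"
  unfolding defect_def
proof (rule herbrand_index)
  show "x *v (u - v) = x *v u - x *v v" for u v by (auto simp: fun_eq_iff algebra_simps)
  show "add_subgroup N" "add_subgroup (vec_in t Z)" "vec_in t Z \<subseteq> N" "(*v) x ` N \<subseteq> N"
    using N ZN vec_in_submodule[OF Z] submodule_set_subgroup submodule_setD(3)[OF N] by auto
  show "vec_in t py = {v. x *v v \<in> vec_in t Z}" by (auto simp: vec_in_def ann_x_iff)
  show "vec_in t px = sumset (range ((*v) x)) (vec_in t Z)"
  proof
    show "vec_in t px \<subseteq> sumset (range ((*v) x)) (vec_in t Z)"
    proof
      fix v assume "v \<in> vec_in t px"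
      then have "\<forall>i\<in>{..<t}. \<exists>r. v i - x * r \<in> Z" by (auto simp: vec_in_def principal_mod_def)
      from bchoice[OF this] obtain r where "\<And>i. i < t \<Longrightarrow> v i - x * r i \<in> Z" by auto
      then have "v - x *v r \<in> vec_in t Z" by (simp add: vec_in_def)
      then show "v \<in> sumset (range ((*v) x)) (vec_in t Z)" by (auto simp: sumset_def)
    qed
    show "sumset (range ((*v) x)) (vec_in t Z) \<subseteq> vec_in t px"
      by (force simp: sumset_def vec_in_def principal_mod_def)
  qed
qed

lemma index_ideal_defect:
  assumes I: "ideal_set I" and ZI: "Z \<subseteq> I"
  shows "subgroup_index UNIV I * ideal_defect I
    = subgroup_index UNIV (sumset I px) * subgroup_index UNIV (sumset I py)"
  unfolding ideal_defect_def
proof (rule herbrand_index)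
  show "x * (u - v) = x * u - x * v" for u v by (simp add: algebra_simps)
  show "add_subgroup I" "add_subgroup Z" "Z \<subseteq> I" "(*) x ` I \<subseteq> I"
    using I ZI Z ideal_set_subgroup ideal_setD(3)[OF I] by auto
  show "py = {v. x * v \<in> Z}" by (auto simp: ann_x_iff)
  show "px = sumset (range ((*) x)) Z" by (auto simp: sumset_def principal_mod_def)
qed

text \<open>Two of the vectors \<open>x\<^sup>n v\<close> lie in the same coset of \<open>N\<close>, and \<open>1 - x\<^sup>m\<close> is a unit for positive \<open>m\<close>.\<close>

lemma power_multiple_in:
  assumes N: "submodule_set N" and ZN: "vec_in t Z \<subseteq> N" and fin: "subgroup_index UNIV N \<noteq> 0"
  shows "\<exists>e. x ^ e *v v \<in> N"
proof -
  have "finite (add_coset N ` UNIV)" using fin unfolding subgroup_index_def by (meson card.infinite)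
  then have "finite (range (\<lambda>n. add_coset N (x ^ n *v v)))" by (rule finite_subset[rotated]) auto
  then have "\<not> inj (\<lambda>n. add_coset N (x ^ n *v v))" using finite_imageD infinite_UNIV_nat by blast
  then obtain i j where ij: "i < j" "add_coset N (x ^ i *v v) = add_coset N (x ^ j *v v)"
    unfolding inj_on_def by (metis linorder_neqE_nat)
  then have d: "x ^ i *v v - x ^ j *v v \<in> N" using coset_eq_iff[OF submodule_set_subgroup[OF N]] by blast
  have "1 - x ^ (j - i) \<notin> mm"
  proof
    assume "1 - x ^ (j - i) \<in> mm"
    moreover have "x ^ (j - i) = x * x ^ (j - i - 1)" using ij(1) by (metis power_Suc Suc_pred' zero_less_diff diff_Suc_1 diff_diff_left plus_1_eq_Suc add.commute)
    then have "x ^ (j - i) \<in> mm" using principal_mod_mult[OF ideal_setD(1)[OF py], of x] by simp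
    ultimately have "(1 - x ^ (j - i)) + x ^ (j - i) \<in> mm" by (rule ideal_setD(2)[OF mm])
    then show False using one_notin_mm by simp
  qed
  then obtain u where u: "(1 - x ^ (j - i)) * u - 1 \<in> Z" using local by blast
  have j: "x ^ j = x ^ i * x ^ (j - i)" using ij(1) by (simp flip: power_add)
  have "u *v (x ^ i *v v - x ^ j *v v) \<in> N" using d by (rule submodule_setD(3)[OF N])
  moreover have "u *v (x ^ i *v v - x ^ j *v v) - x ^ i *v v \<in> vec_in t Z"
  proof -
    have "(u *v (x ^ i *v v - x ^ j *v v) - x ^ i *v v) l = x ^ i * v l * ((1 - x ^ (j - i)) * u - 1)" for l
      by (simp add: j algebra_simps)
    then show ?thesis using ideal_setD(3)[OF Z u] by (simp add: vec_in_def)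
  qed
  ultimately have "x ^ i *v v \<in> N"
    using ZN submodule_cong_iff[OF N, of "u *v (x ^ i *v v - x ^ j *v v)" "x ^ i *v v"] by blast
  then show ?thesis by blast
qed

lemma power_annihilates:
  assumes N: "submodule_set N" and ZN: "vec_in t Z \<subseteq> N" and fin: "subgroup_index UNIV N \<noteq> 0"
  obtains e where "\<And>v. x ^ e *v v \<in> N"
proof -
  define \<delta> where "\<delta> i = (\<lambda>j. if j = i then 1 else 0 :: 'r)" for i :: nat
  have "\<forall>i\<in>{..<t}. \<exists>e. x ^ e *v \<delta> i \<in> N" using power_multiple_in[OF N ZN fin] by blast
  from bchoice[OF this] obtain e where e: "\<And>i. i < t \<Longrightarrow> x ^ e i *v \<delta> i \<in> N" by auto
  have "x ^ (\<Sum>i<t. e i) *v v \<in> N" for v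
  proof -
    have "x ^ (\<Sum>i<t. e i) *v \<delta> i \<in> N" if "i < t" for i
    proof -
      have "e i \<le> (\<Sum>i<t. e i)" using that by (intro member_le_sum) auto
      then have "x ^ (\<Sum>i<t. e i) = x ^ ((\<Sum>i<t. e i) - e i) * x ^ e i" by (simp flip: power_add)
      then have "x ^ (\<Sum>i<t. e i) *v \<delta> i = x ^ ((\<Sum>i<t. e i) - e i) *v (x ^ e i *v \<delta> i)"
        by (simp add: fun_eq_iff mult.assoc)
      then show ?thesis using submodule_setD(3)[OF N e[OF that]] by simp
    qed
    then have s: "(\<Sum>i<t. v i *v (x ^ (\<Sum>i<t. e i) *v \<delta> i)) \<in> N"
      using submodule_setD(3)[OF N] by (intro submodule_set_sum N) simp
    have "x ^ (\<Sum>i<t. e i) *v v - (\<Sum>i<t. v i *v (x ^ (\<Sum>i<t. e i) *v \<delta> i)) \<in> vec_in t Z"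
      using ideal_setD(1)[OF Z] by (auto simp: vec_in_def vec_sum_apply \<delta>_def if_distrib cong: if_cong)
    then show ?thesis using ZN s submodule_cong_iff[OF N] by blast
  qed
  then show ?thesis using that by blast
qed


text \<open>A generator \<open>d\<close> of the Fitting ideal is a nonzerodivisor, because the ideal contains powers of both
  \<open>x\<close> and \<open>y\<close>. As the ring is local, \<open>d\<close> may be replaced by a single determinant, and Cramer's rule
  shows that the module is free on the rows of this determinant. A free module has trivial defect:
  if \<open>n = \<Sum> c\<^sub>i v\<^sub>i\<close> is divisible by \<open>x\<close>, then \<open>y n = 0\<close> forces \<open>y c\<^sub>i = 0\<close>, so every \<open>c\<^sub>i\<close> is divisible by \<open>x\<close>.\<close>

lemma principal_fitting:
  assumes N: "submodule_set N" and ZN: "vec_in t Z \<subseteq> N"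
    and ex: "\<And>v. x ^ e *v v \<in> N" and ey: "\<And>v. y ^ e' *v v \<in> N"
    and d: "fitting Z t N = principal_mod Z d"
  shows "N \<inter> vec_in t px \<subseteq> sumset ((*v) x ` N) (vec_in t Z)"
    and "fitting Z t N \<inter> px \<subseteq> sumset ((*) x ` fitting Z t N) Z"
proof -
  interpret S: node Z y x by (rule swap)
  have dI: "d \<in> fitting Z t N" using principal_mod_mult[OF ideal_setD(1)[OF Z], of d 1] d by simp
  have pw: "w ^ (e * t) \<in> fitting Z t N" if "\<And>v. w ^ e *v v \<in> N" for w e
  proof -
    define v where "v i = w ^ e *v (\<lambda>j. if j = i then 1 else 0)" for i :: nat
    have "det_rows t v = (\<Prod>i<t. v i i)"
      by (rule det_rows_triangular) (simp add: v_def)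
    also have "\<dots> = w ^ (e * t)" by (simp add: v_def power_mult)
    finally show ?thesis using det_in_fitting[of t v N Z] that by (simp add: v_def)
  qed
  have nzd: "r \<in> Z" if r: "d * r \<in> Z" for r
  proof -
    have *: "w ^ n * r \<in> Z" if wn: "w ^ n \<in> fitting Z t N" for w n
    proof -
      obtain s where s: "w ^ n - d * s \<in> Z" using wn d by (auto simp: principal_mod_def)
      have "(w ^ n - d * s) * r + s * (d * r) \<in> Z"
        by (intro ideal_setD(2)[OF Z] ideal_setD(4)[OF Z s] ideal_setD(3)[OF Z r])
      then show ?thesis by (simp add: algebra_simps)
    qed
    have "r \<in> py" using *[OF pw[OF ex]] principal_mod_subset cancel_power by blast
    moreover have "r \<in> px" using *[OF pw[OF ey]] principal_mod_subset S.cancel_power by blast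
    ultimately show ?thesis using px_Int_py by blast
  qed
  show "fitting Z t N \<inter> px \<subseteq> sumset ((*) x ` fitting Z t N) Z"
  proof
    fix a assume a: "a \<in> fitting Z t N \<inter> px"
    then obtain r where r: "a - d * r \<in> Z" by (auto simp: d principal_mod_def)
    have ya: "y * a \<in> Z" using a S.x_times_py by blast
    have "y * a - y * (a - d * r) \<in> Z" by (intro ideal_setD(6)[OF Z ya] ideal_setD(3)[OF Z r])
    then have "d * (y * r) \<in> Z" by (simp add: algebra_simps)
    then have "r \<in> px" using nzd ann_y by blast
    then obtain s where s: "r - x * s \<in> Z" by (auto simp: principal_mod_def)
    have "(a - d * r) + d * (r - x * s) \<in> Z"
      by (intro ideal_setD(2)[OF Z r] ideal_setD(3)[OF Z s])
    then have "a - x * (d * s) \<in> Z" by (simp add: algebra_simps)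
    moreover have "d * s \<in> fitting Z t N" using ideal_setD(4)[OF fitting_ideal_set dI] .
    ultimately show "a \<in> sumset ((*) x ` fitting Z t N) Z" by (auto simp: sumset_def)
  qed
  have "\<not> (\<forall>v s. (\<forall>i<t. v i \<in> N) \<longrightarrow> det_rows t v - d * s \<in> Z \<longrightarrow> s \<in> mm)"
  proof
    assume none: "\<forall>v s. (\<forall>i<t. v i \<in> N) \<longrightarrow> det_rows t v - d * s \<in> Z \<longrightarrow> s \<in> mm"
    \<comment> \<open>If all determinants were multiples of \<open>d\<close> by elements of the maximal ideal, then so would \<open>d\<close> be.\<close>
    define K where "K = {r. \<exists>a\<in>mm. r - d * a \<in> Z}"
    have K: "ideal_set K" unfolding ideal_set_def
    proof (intro conjI ballI allI)
      show "0 \<in> K" using ideal_setD(1)[OF Z] ideal_setD(1)[OF mm] by (auto simp: K_def intro!: bexI[of _ 0])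
      fix a assume "a \<in> K"
      then obtain a' where a: "a' \<in> mm" "a - d * a' \<in> Z" by (auto simp: K_def)
      have "r * a - d * (r * a') \<in> Z" for r using ideal_setD(3)[OF Z a(2), of r] by (simp add: algebra_simps)
      then show "r * a \<in> K" for r using ideal_setD(3)[OF mm a(1)] by (auto simp: K_def)
      fix b assume "b \<in> K"
      then obtain b' where b: "b' \<in> mm" "b - d * b' \<in> Z" by (auto simp: K_def)
      have "(a + b) - d * (a' + b') \<in> Z" using ideal_cong_add[OF Z a(2) b(2)] by (simp add: algebra_simps)
      then show "a + b \<in> K" using ideal_setD(2)[OF mm a(1) b(1)] by (auto simp: K_def)
    qed
    have ZK: "Z \<subseteq> K" using ideal_setD(1)[OF mm] by (auto simp: K_def intro!: bexI[of _ 0])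
    have "fitting Z t N \<subseteq> K"
    proof (rule fitting_least[OF K ZK])
      fix v assume v: "\<And>i. i < t \<Longrightarrow> v i \<in> N"
      have "det_rows t v \<in> principal_mod Z d" using det_in_fitting[of t v N Z] v d by simp
      then obtain s where "det_rows t v - d * s \<in> Z" by (auto simp: principal_mod_def)
      then show "det_rows t v \<in> K" using none v by (auto simp: K_def)
    qed
    then obtain a where a: "a \<in> mm" "d - d * a \<in> Z" using dI by (auto simp: K_def)
    then have "d * (1 - a) \<in> Z" by (simp add: algebra_simps)
    then have "1 - a \<in> Z" by (rule nzd)
    then have "1 - a \<in> mm" using principal_mod_subset by blast
    then have "(1 - a) + a \<in> mm" using a(1) by (rule ideal_setD(2)[OF mm])
    then show False using one_notin_mm by simp
  qed
  then obtain v s where v: "\<And>i. i < t \<Longrightarrow> v i \<in> N" and s: "det_rows t v - d * s \<in> Z" and smm: "s \<notin> mm"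
    by auto
  obtain u where u: "s * u - 1 \<in> Z" using local smm by blast
  \<comment> \<open>The determinant of the rows \<open>v\<close> is \<open>d\<close> times the unit \<open>s\<close>, hence a nonzerodivisor as well.\<close>
  have du: "d - det_rows t v * u \<in> Z"
  proof -
    have "- (u * (det_rows t v - d * s)) - d * (s * u - 1) \<in> Z"
      by (intro ideal_setD(6)[OF Z] ideal_setD(5)[OF Z] ideal_setD(3)[OF Z] s u)
    then show ?thesis by (simp add: algebra_simps)
  qed
  have nzd': "r \<in> Z" if r: "det_rows t v * r \<in> Z" for r
  proof -
    have "(d - det_rows t v * u) * r + u * (det_rows t v * r) \<in> Z"
      by (intro ideal_setD(2)[OF Z] ideal_setD(4)[OF Z du] ideal_setD(3)[OF Z r])
    then have "d * r \<in> Z" by (simp add: algebra_simps)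
    then show ?thesis by (rule nzd)
  qed
  have span: "\<exists>c. n - (\<Sum>i<t. c i *v v i) \<in> vec_in t Z" if n: "n \<in> N" for n
  proof -
    have "\<forall>i\<in>{..<t}. \<exists>c. det_rows t (v(i := n)) - det_rows t v * c \<in> Z"
    proof
      fix i assume "i \<in> {..<t}"
      have "det_rows t (v(i := n)) \<in> principal_mod Z d"
        unfolding d[symmetric] using v n by (intro det_in_fitting) simp
      then obtain c where c: "det_rows t (v(i := n)) - d * c \<in> Z" by (auto simp: principal_mod_def)
      have "(det_rows t (v(i := n)) - d * c) + c * (d - det_rows t v * u) \<in> Z"
        by (intro ideal_setD(2)[OF Z c] ideal_setD(3)[OF Z du])
      then have "det_rows t (v(i := n)) - det_rows t v * (u * c) \<in> Z" by (simp add: algebra_simps)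
      then show "\<exists>c. det_rows t (v(i := n)) - det_rows t v * c \<in> Z" ..
    qed
    from bchoice[OF this] obtain c where c: "\<And>i. i < t \<Longrightarrow> det_rows t (v(i := n)) - det_rows t v * c i \<in> Z" by auto
    have "n j - (\<Sum>i<t. c i * v i j) \<in> Z" if j: "j < t" for j
    proof (rule nzd')
      have "(\<Sum>i<t. (det_rows t (v(i := n)) - det_rows t v * c i) * v i j) \<in> Z"
        by (intro ideal_set_sum[OF Z] ideal_setD(4)[OF Z] c) simp
      also have "(\<Sum>i<t. (det_rows t (v(i := n)) - det_rows t v * c i) * v i j)
          = (\<Sum>i<t. det_rows t (v(i := n)) * v i j) - det_rows t v * (\<Sum>i<t. c i * v i j)"
        by (simp add: left_diff_distrib sum_subtractf sum_distrib_left mult.assoc)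
      also have "\<dots> = det_rows t v * (n j - (\<Sum>i<t. c i * v i j))"
        using cramer_rows[OF j, of v n] by (simp add: right_diff_distrib)
      finally show "det_rows t v * (n j - (\<Sum>i<t. c i * v i j)) \<in> Z" .
    qed
    then have "n - (\<Sum>i<t. c i *v v i) \<in> vec_in t Z" by (simp add: vec_in_def vec_sum_apply)
    then show ?thesis by (rule exI[of _ c])
  qed
  show "N \<inter> vec_in t px \<subseteq> sumset ((*v) x ` N) (vec_in t Z)"
  proof
    fix n assume n: "n \<in> N \<inter> vec_in t px"
    then obtain c where c: "n - (\<Sum>i<t. c i *v v i) \<in> vec_in t Z" using span by blast
    have rel: "(\<Sum>i<t. (y * c i) * v i j) \<in> Z" if j: "j < t" for j
    proof -
      have "n j - (\<Sum>i<t. c i * v i j) \<in> Z" using c j by (simp add: vec_in_def vec_sum_apply)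
      moreover have "n j \<in> px" using n j by (simp add: vec_in_def)
      then have "y * n j \<in> Z" by (rule S.x_times_py)
      ultimately have "y * n j - y * (n j - (\<Sum>i<t. c i * v i j)) \<in> Z"
        using ideal_setD(6)[OF Z] ideal_setD(3)[OF Z] by blast
      then show ?thesis by (simp add: algebra_simps sum_distrib_left)
    qed
    have "\<forall>i\<in>{..<t}. \<exists>s. c i - x * s \<in> Z"
    proof
      fix i assume "i \<in> {..<t}"
      then have "det_rows t v * (y * c i) \<in> Z" using rel by (intro det_rows_cancel[OF Z]) auto
      then have "c i \<in> px" using nzd' ann_y by blast
      then show "\<exists>s. c i - x * s \<in> Z" by (auto simp: principal_mod_def)
    qed
    from bchoice[OF this] obtain s where s: "\<And>i. i < t \<Longrightarrow> c i - x * s i \<in> Z" by auto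
    have "n - x *v (\<Sum>i<t. s i *v v i) \<in> vec_in t Z"
      unfolding vec_in_def
    proof (intro CollectI allI impI)
      fix j assume j: "j < t"
      have "(n j - (\<Sum>i<t. c i * v i j)) + (\<Sum>i<t. (c i - x * s i) * v i j) \<in> Z"
        using c j s by (intro ideal_setD(2)[OF Z] ideal_set_sum[OF Z] ideal_setD(4)[OF Z])
          (auto simp: vec_in_def vec_sum_apply)
      then show "(n - x *v (\<Sum>i<t. s i *v v i)) j \<in> Z"
        by (simp add: vec_sum_apply left_diff_distrib sum_subtractf sum_distrib_left mult.assoc)
    qed
    moreover have "(\<Sum>i<t. s i *v v i) \<in> N"
      using v by (intro submodule_set_sum[OF N] submodule_setD(3)[OF N]) auto
    ultimately show "n \<in> sumset ((*v) x ` N) (vec_in t Z)" by (auto simp: sumset_def)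
  qed
qed


lemma spanning_mod:
  assumes L: "submodule_set L" and "vec_in t py \<subseteq> L" and "\<And>v. x ^ e *v v \<in> L"
  obtains b where "\<And>i. i < t \<Longrightarrow> b i \<in> L" "\<And>v. v \<in> L \<Longrightarrow> \<exists>c. v - (\<Sum>i<t. c i *v b i) \<in> vec_in t py"
proof -
  obtain b \<kappa> where "(\<forall>i<t. b i \<in> L) \<and> (\<forall>i<t. \<forall>j>i. b i j = 0) \<and> (\<forall>i<t. b i i = x ^ \<kappa> i)
     \<and> (\<forall>v\<in>L. \<exists>c. v - (\<Sum>i<t. c i *v b i) \<in> vec_in t py)
     \<and> subgroup_index UNIV L = subgroup_index UNIV mm ^ (\<Sum>i<t. \<kappa> i :: nat)"
    using triangular_basis[OF assms] by (elim exE) (rule that)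
  then show ?thesis by (intro that[of b]) simp_all
qed

lemma scaled_submodule:
  assumes "submodule_set N" shows "submodule_set (sumset ((*v) r ` N) (vec_in t Z))"
proof -
  have "submodule_set ((*v) r ` N)" unfolding submodule_set_def
  proof (intro conjI ballI allI)
    show "0 \<in> (*v) r ` N" using submodule_setD(1)[OF assms] by (intro image_eqI[where x=0]) (auto simp: fun_eq_iff)
    fix a assume "a \<in> (*v) r ` N"
    then obtain a' where a: "a' \<in> N" "a = r *v a'" by blast
    show "s *v a \<in> (*v) r ` N" for s
      using submodule_setD(3)[OF assms a(1), of s] a(2) by (intro image_eqI[where x="s *v a'"]) (auto simp: fun_eq_iff)
    fix b assume "b \<in> (*v) r ` N"
    then obtain b' where b: "b' \<in> N" "b = r *v b'" by blast
    show "a + b \<in> (*v) r ` N"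
      using submodule_setD(2)[OF assms a(1) b(1)] a(2) b(2)
      by (intro image_eqI[where x="a' + b'"]) (auto simp: fun_eq_iff algebra_simps)
  qed
  then show ?thesis by (intro sumset_submodule vec_in_submodule Z)
qed

text \<open>Choose \<open>n\<^sub>1, \<dots>, n\<^sub>t\<close> in \<open>N\<close> that form a basis of \<open>N\<close> modulo \<open>y\<close>. Every element of \<open>N\<close> then differs from
  a combination of them by an element of \<open>N\<close> that is divisible by \<open>y\<close> in the free module, hence in
  \<open>N\<close>, since the defect with respect to \<open>y\<close> equals the defect with respect to \<open>x\<close> and is trivial. So
  \<open>N\<close> is spanned by the \<open>n\<^sub>i\<close> modulo \<open>y N\<close>, and Nakayama's lemma applies.\<close>

lemma trivial_defect_spanning:
  assumes N: "submodule_set N" and ZN: "vec_in t Z \<subseteq> N" and fin: "subgroup_index UNIV N \<noteq> 0"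
    and ex: "\<And>v. x ^ e *v v \<in> N" and ey: "\<And>v. y ^ e' *v v \<in> N"
    and triv: "N \<inter> vec_in t px \<subseteq> sumset ((*v) x ` N) (vec_in t Z)"
  shows "\<exists>d. fitting Z t N = principal_mod Z d"
proof -
  interpret S: node Z y x by (rule swap)
  note sN = submodule_set_subgroup[OF N]
  have D: "add_subgroup (sumset ((*v) r ` N) (vec_in t Z))" for r
    by (intro submodule_set_subgroup scaled_submodule N)
  have V: "submodule_set (vec_in t px)" "submodule_set (vec_in t py)"
    by (intro vec_in_submodule px py)+
  have "defect t N = 1"
    unfolding defect_def by (intro subgroup_index_trivial D triv add_subgroup_Int sN submodule_set_subgroup V)
  \<comment> \<open>The index formula is symmetric in \<open>x\<close> and \<open>y\<close>, and the index of \<open>N\<close> is not 0.\<close>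
  then have "S.defect t N = 1"
    using index_defect[OF N ZN] S.index_defect[OF N ZN] fin by (simp add: mult.commute)
  then have triv': "N \<inter> vec_in t py \<subseteq> sumset ((*v) y ` N) (vec_in t Z)"
    unfolding S.defect_def by (intro subgroup_index_eq_1 D add_subgroup_Int sN submodule_set_subgroup V)
  define L where "L = sumset N (vec_in t py)"
  have L: "submodule_set L" unfolding L_def by (intro sumset_submodule N V)
  have NL: "N \<subseteq> L" "vec_in t py \<subseteq> L" unfolding L_def
    by (intro subset_sumset subset_sumset2 submodule_setD(1) N V)+
  obtain b where b: "\<And>i. i < t \<Longrightarrow> b i \<in> L" "\<And>v. v \<in> L \<Longrightarrow> \<exists>c. v - (\<Sum>i<t. c i *v b i) \<in> vec_in t py"
    using spanning_mod[OF L NL(2)] ex NL(1) by blast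
  have "\<forall>i\<in>{..<t}. \<exists>n. n \<in> N \<and> b i - n \<in> vec_in t py" using b(1) by (auto simp: L_def sumset_def)
  from bchoice[OF this] obtain n where n: "\<And>i. i < t \<Longrightarrow> n i \<in> N" "\<And>i. i < t \<Longrightarrow> b i - n i \<in> vec_in t py" by auto
  have nspan: "\<exists>c. v - (\<Sum>i<t. c i *v n i) \<in> N \<inter> vec_in t py" if v: "v \<in> N" for v
  proof -
    obtain c where c: "v - (\<Sum>i<t. c i *v b i) \<in> vec_in t py" using b(2) v NL by blast
    have "(\<Sum>i<t. c i *v (b i - n i)) \<in> vec_in t py"
      using n(2) by (intro submodule_set_sum[OF V(2)] submodule_setD(3)[OF V(2)]) auto
    with c have "(v - (\<Sum>i<t. c i *v b i)) + (\<Sum>i<t. c i *v (b i - n i)) \<in> vec_in t py"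
      by (rule submodule_setD(2)[OF V(2)])
    also have "(v - (\<Sum>i<t. c i *v b i)) + (\<Sum>i<t. c i *v (b i - n i)) = v - (\<Sum>i<t. c i *v n i)"
      by (simp add: fun_eq_iff vec_sum_apply right_diff_distrib sum_subtractf)
    finally have "v - (\<Sum>i<t. c i *v n i) \<in> vec_in t py" .
    moreover have "v - (\<Sum>i<t. c i *v n i) \<in> N"
      using n(1) by (intro submodule_setD(5)[OF N v] submodule_set_sum[OF N] submodule_setD(3)[OF N]) auto
    ultimately show ?thesis by blast
  qed
  \<comment> \<open>Nakayama's lemma needs generators of \<open>N\<close> modulo the span of the \<open>n i\<close>. They are found as \<open>y\<close> times
      a basis, modulo \<open>x\<close>, of the lattice of all vectors that \<open>y\<close> maps into \<open>N\<close>.\<close>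
  define L' where "L' = {f. y *v f \<in> N}"
  have ydist: "y *v (u + v) = y *v u + y *v v" "y *v (r *v v) = r *v (y *v v)" "y *v 0 = (0 :: nat \<Rightarrow> 'r)" for u v r
    by (auto simp: fun_eq_iff algebra_simps)
  have L': "submodule_set L'" unfolding submodule_set_def L'_def mem_Collect_eq ydist
    using submodule_setD(1-3)[OF N] by (intro conjI ballI allI) (auto simp: ydist)
  have VL': "vec_in t px \<subseteq> L'"
    using ZN S.x_times_py by (auto simp: L'_def vec_in_def)
  have eL': "y ^ e' *v v \<in> L'" for v
    unfolding L'_def mem_Collect_eq ydist by (rule ey)
  obtain b' where b': "\<And>i. i < t \<Longrightarrow> b' i \<in> L'" "\<And>v. v \<in> L' \<Longrightarrow> \<exists>c. v - (\<Sum>i<t. c i *v b' i) \<in> vec_in t px"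
    using S.spanning_mod[OF L' VL' eL'] by blast
  have yspan: "\<exists>c. v - (\<Sum>i<t. c i *v (y *v b' i)) \<in> vec_in t Z" if v: "v \<in> N \<inter> vec_in t py" for v
  proof -
    have "\<forall>i\<in>{..<t}. \<exists>f. v i - y * f \<in> Z" using v by (auto simp: vec_in_def principal_mod_def)
    from bchoice[OF this] obtain f where "\<And>i. i < t \<Longrightarrow> v i - y * f i \<in> Z" by auto
    then have f: "v - y *v f \<in> vec_in t Z" by (simp add: vec_in_def)
    then have "f \<in> L'" using v ZN submodule_cong_iff[OF N, of v "y *v f"] by (auto simp: L'_def)
    then obtain c where c: "f - (\<Sum>i<t. c i *v b' i) \<in> vec_in t px" using b'(2) by blast
    have "y *v (f - (\<Sum>i<t. c i *v b' i)) \<in> vec_in t Z"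
      using c S.x_times_py by (simp add: vec_in_def)
    with f have "(v - y *v f) + y *v (f - (\<Sum>i<t. c i *v b' i)) \<in> vec_in t Z"
      by (rule submodule_setD(2)[OF vec_in_submodule[OF Z]])
    also have "(v - y *v f) + y *v (f - (\<Sum>i<t. c i *v b' i)) = v - (\<Sum>i<t. c i *v (y *v b' i))"
      by (simp add: fun_eq_iff vec_sum_apply algebra_simps sum_distrib_left)
    finally show ?thesis by (rule exI[of _ c])
  qed
  define N0 where "N0 = {v. \<exists>c. v - (\<Sum>i<t. c i *v n i) \<in> vec_in t Z}"
  have N0: "submodule_set N0" unfolding submodule_set_def
  proof (intro conjI ballI allI)
    note VZ = submodule_setD[OF vec_in_submodule[OF Z, of t]]
    show "0 \<in> N0" unfolding N0_def using VZ(1)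
      by (auto intro!: exI[of _ "\<lambda>_. 0"] simp: vec_in_def vec_sum_apply)
    fix u assume "u \<in> N0"
    then obtain c where c: "u - (\<Sum>i<t. c i *v n i) \<in> vec_in t Z" by (auto simp: N0_def)
    have "r *v u - (\<Sum>i<t. (r * c i) *v n i) = r *v (u - (\<Sum>i<t. c i *v n i))" for r
      by (simp add: fun_eq_iff vec_sum_apply algebra_simps sum_distrib_left)
    then have "r *v u - (\<Sum>i<t. (r * c i) *v n i) \<in> vec_in t Z" for r using VZ(3)[OF c] by (simp only:)
    then show "r *v u \<in> N0" for r by (auto simp: N0_def intro: exI[of _ "\<lambda>i. r * c i"])
    fix v assume "v \<in> N0"
    then obtain d where d: "v - (\<Sum>i<t. d i *v n i) \<in> vec_in t Z" by (auto simp: N0_def)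
    have "(u + v) - (\<Sum>i<t. (c i + d i) *v n i) = (u - (\<Sum>i<t. c i *v n i)) + (v - (\<Sum>i<t. d i *v n i))"
      by (simp add: fun_eq_iff vec_sum_apply algebra_simps sum.distrib)
    then have "(u + v) - (\<Sum>i<t. (c i + d i) *v n i) \<in> vec_in t Z" using VZ(2)[OF c d] by (simp only:)
    then show "u + v \<in> N0" by (auto simp: N0_def intro: exI[of _ "\<lambda>i. c i + d i"])
  qed
  have ZN0: "vec_in t Z \<subseteq> N0" by (auto simp: N0_def intro!: exI[of _ "\<lambda>_. 0"] simp: vec_in_def vec_sum_apply)
  have combN0: "(\<Sum>i<t. c i *v n i) \<in> N0" for c
    unfolding N0_def using submodule_setD(1)[OF vec_in_submodule[OF Z, of t]] by (auto intro!: exI[of _ c])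
  define g where "g i = y *v b' i" for i
  have "N \<subseteq> N0"
  proof (rule nakayama_mod[where s=scale_vec and R=UNIV and w=y and m=t and g=g, OF module_scale_vec])
    show "add_subgroup N0" by (rule submodule_set_subgroup[OF N0])
    show "r *v a \<in> N0" if "a \<in> N0" for r a using that by (rule submodule_setD(3)[OF N0])
    show "\<exists>u\<in>UNIV. \<forall>v\<in>N. (u * (1 - y * a)) *v v - v \<in> N0" for a
    proof -
      have "1 - y * a \<notin> mm"
      proof
        assume "1 - y * a \<in> mm"
        moreover have "y * a \<in> mm"
          using principal_mod_mult[OF ideal_setD(1)[OF px], of y a] by (simp add: principal_mod_swap)
        ultimately have "(1 - y * a) + y * a \<in> mm" by (rule ideal_setD(2)[OF mm])
        then show False using one_notin_mm by simp
      qed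
      then obtain u where u: "(1 - y * a) * u - 1 \<in> Z" using local by blast
      have "(u * (1 - y * a)) *v v - v \<in> vec_in t Z" for v
      proof -
        have "((u * (1 - y * a)) *v v - v) i = v i * ((1 - y * a) * u - 1)" for i by (simp add: algebra_simps)
        then show ?thesis using ideal_setD(3)[OF Z u] by (simp add: vec_in_def)
      qed
      then show ?thesis using ZN0 by (intro bexI[of _ u]) auto
    qed
    show "\<exists>v'\<in>N. v - y *v v' \<in> N0" if v: "v \<in> N" for v
    proof -
      obtain c where c: "v - (\<Sum>i<t. c i *v n i) \<in> N \<inter> vec_in t py" using nspan[OF v] by blast
      then have "v - (\<Sum>i<t. c i *v n i) \<in> sumset ((*v) y ` N) (vec_in t Z)" using triv' by blast
      then obtain v' where v': "v' \<in> N" "(v - (\<Sum>i<t. c i *v n i)) - y *v v' \<in> vec_in t Z"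
        by (auto simp: sumset_def)
      then have "((v - (\<Sum>i<t. c i *v n i)) - y *v v') + (\<Sum>i<t. c i *v n i) \<in> N0"
        using ZN0 combN0 by (intro submodule_setD(2)[OF N0]) auto
      then have "v - y *v v' \<in> N0" by (simp add: algebra_simps)
      then show ?thesis using v'(1) by blast
    qed
    show "g i \<in> N" if "i < t" for i using b'(1)[OF that] by (simp add: L'_def g_def)
    show "\<exists>c. (\<forall>i<t. c i \<in> UNIV) \<and> v - (\<Sum>i<t. c i *v g i) \<in> N0" if v: "v \<in> N" for v
    proof -
      obtain c where c: "v - (\<Sum>i<t. c i *v n i) \<in> N \<inter> vec_in t py" using nspan[OF v] by blast
      obtain c' where c': "(v - (\<Sum>i<t. c i *v n i)) - (\<Sum>i<t. c' i *v g i) \<in> vec_in t Z"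
        using yspan[OF c] unfolding g_def by blast
      then have "((v - (\<Sum>i<t. c i *v n i)) - (\<Sum>i<t. c' i *v g i)) + (\<Sum>i<t. c i *v n i) \<in> N0"
        using ZN0 combN0 by (intro submodule_setD(2)[OF N0]) auto
      then have "v - (\<Sum>i<t. c' i *v g i) \<in> N0" by (simp add: algebra_simps)
      then show ?thesis by blast
    qed
  qed auto
  then have "fitting Z t N = principal_mod Z (det_rows t n)"
    using n(1) by (intro fitting_span Z) (auto simp: N0_def)
  then show ?thesis ..
qed

text \<open>Both \<open>x\<close> and \<open>y\<close> annihilate the quotient whose order is the defect, so the multiples of a nonzero
  element of it form a copy of the residue field.\<close>

lemma defect_ge:
  assumes N: "submodule_set N" and fin: "defect t N \<noteq> 0"
    and v: "v \<in> N" "v \<in> vec_in t px" "v \<notin> sumset ((*v) x ` N) (vec_in t Z)"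
  shows "subgroup_index UNIV mm \<le> defect t N" and "subgroup_index UNIV mm \<noteq> 0"
proof -
  interpret S: node Z y x by (rule swap)
  define D where "D = sumset ((*v) x ` N) (vec_in t Z)"
  have D: "submodule_set D" unfolding D_def by (rule scaled_submodule[OF N])
  note sD = submodule_set_subgroup[OF D]
  have xv: "x *v v \<in> D" unfolding D_def using v(1) submodule_setD(1)[OF vec_in_submodule[OF Z, of t]]
    by (intro subsetD[OF subset_sumset]) auto
  have yv: "y *v v \<in> D"
  proof -
    have "y *v v \<in> vec_in t Z" using v(2) S.x_times_py by (simp add: vec_in_def)
    moreover have "0 \<in> (*v) x ` N" using submodule_setD(1)[OF N] by (intro image_eqI[where x=0]) (auto simp: fun_eq_iff)
    ultimately show ?thesis unfolding D_def by (intro subsetD[OF subset_sumset2])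
  qed
  have ZD: "z *v v \<in> D" if z: "z \<in> Z" for z
  proof -
    have "z *v v \<in> vec_in t Z" using ideal_setD(4)[OF Z z] by (simp add: vec_in_def)
    moreover have "0 \<in> (*v) x ` N" using submodule_setD(1)[OF N] by (intro image_eqI[where x=0]) (auto simp: fun_eq_iff)
    ultimately show ?thesis unfolding D_def by (intro subsetD[OF subset_sumset2])
  qed
  have mult: "r *v v \<in> D \<longleftrightarrow> r \<in> mm" for r
  proof
    assume "r \<in> mm"
    then obtain s u where z: "r - x * s - y * u \<in> Z" by (auto simp: principal_mod_def)
    have "(r - x * s - y * u) *v v + (s *v (x *v v) + u *v (y *v v)) \<in> D"
      by (intro submodule_setD(2)[OF D] submodule_setD(3)[OF D] xv yv ZD[OF z])
    also have "(r - x * s - y * u) *v v + (s *v (x *v v) + u *v (y *v v)) = r *v v"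
      by (simp add: fun_eq_iff algebra_simps)
    finally show "r *v v \<in> D" .
  next
    assume rD: "r *v v \<in> D"
    show "r \<in> mm"
    proof (rule ccontr)
      assume "r \<notin> mm"
      then obtain u where u: "r * u - 1 \<in> Z" using local by blast
      have "u *v (r *v v) - (r * u - 1) *v v \<in> D"
        by (intro submodule_setD(5)[OF D] submodule_setD(3)[OF D rD] ZD[OF u])
      also have "u *v (r *v v) - (r * u - 1) *v v = v" by (simp add: fun_eq_iff algebra_simps)
      finally show False using v(3) by (simp add: D_def)
    qed
  qed
  have eq: "subgroup_index UNIV mm = card (range (\<lambda>r. add_coset D (r *v v)))"
  proof (rule subgroup_index_eq_card[OF ideal_set_subgroup[OF mm]])
    fix r s
    have "r *v v - s *v v = (r - s) *v v" by (simp add: fun_eq_iff algebra_simps)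
    then show "add_coset D (r *v v) = add_coset D (s *v v) \<longleftrightarrow> r - s \<in> mm"
      by (simp add: coset_eq_iff[OF sD] mult)
  qed
  have sub: "range (\<lambda>r. add_coset D (r *v v)) \<subseteq> add_coset D ` (N \<inter> vec_in t px)"
    using submodule_setD(3)[OF N v(1)] submodule_setD(3)[OF vec_in_submodule[OF px] v(2)] by blast
  have fin': "finite (add_coset D ` (N \<inter> vec_in t px))"
    using fin unfolding defect_def subgroup_index_def D_def[symmetric] by (meson card.infinite)
  show "subgroup_index UNIV mm \<le> defect t N"
    unfolding eq defect_def subgroup_index_def[of "N \<inter> _"] D_def[symmetric] by (rule card_mono[OF fin' sub])
  show "subgroup_index UNIV mm \<noteq> 0"
    unfolding eq using finite_subset[OF sub fin'] by (simp add: card_eq_0_iff)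
qed

text \<open>The elements of \<open>I\<close> that are divisible by \<open>x\<close> are the multiples of one element \<open>g\<close>, since the ideal \<open>J\<close>
  of their cofactors contains \<open>y\<close> and is generated by a power of \<open>x\<close> modulo \<open>y\<close>. The multiples \<open>x g\<close> and
  \<open>y g\<close> lie in \<open>x I\<close>, so the quotient is an image of the residue field.\<close>

lemma ideal_defect_le:
  assumes I: "ideal_set I" and ZI: "Z \<subseteq> I" and xe: "x ^ e \<in> I" and fin: "subgroup_index UNIV mm \<noteq> 0"
  shows "ideal_defect I \<le> subgroup_index UNIV mm"
proof -
  define D where "D = sumset ((*) x ` I) Z"
  have "ideal_set ((*) x ` I)" unfolding ideal_set_def
  proof (intro conjI ballI allI)
    show "0 \<in> (*) x ` I" using ideal_setD(1)[OF I] by (intro image_eqI[where x=0]) auto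
    fix a assume "a \<in> (*) x ` I"
    then obtain a' where a: "a' \<in> I" "a = x * a'" by blast
    show "s * a \<in> (*) x ` I" for s
      using ideal_setD(3)[OF I a(1), of s] a(2) by (intro image_eqI[where x="s * a'"]) auto
    fix b assume "b \<in> (*) x ` I"
    then obtain b' where b: "b' \<in> I" "b = x * b'" by blast
    show "a + b \<in> (*) x ` I"
      using ideal_setD(2)[OF I a(1) b(1)] a(2) b(2) by (intro image_eqI[where x="a' + b'"]) (auto simp: algebra_simps)
  qed
  then have D: "ideal_set D" unfolding D_def by (intro sumset_ideal Z)
  note sD = ideal_set_subgroup[OF D]
  have xI: "x * a \<in> D" if "a \<in> I" for a
    unfolding D_def using that ideal_setD(1)[OF Z] by (intro subsetD[OF subset_sumset]) auto
  have ZD: "Z \<subseteq> D" unfolding D_def using ideal_setD(1)[OF I] by (intro subset_sumset2) (auto intro!: image_eqI[where x=0])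
  define J where "J = {r. x * r \<in> I}"
  have J: "ideal_set J" unfolding ideal_set_def J_def
    using ideal_setD(1)[OF I] ideal_setD(2)[OF I] ideal_setD(3)[OF I]
    by (auto simp: distrib_left mult.left_commute[of x])
  have pJ: "py \<subseteq> J" using ZI x_times_py by (auto simp: J_def)
  have "x ^ e \<in> J" unfolding J_def using ideal_setD(3)[OF I xe] by simp
  then obtain k where k: "J = principal_mod py (x ^ k)" using ideal_is_power[OF J pJ] by blast
  define g where "g = x * x ^ k"
  have gI: "x ^ k \<in> J" using principal_mod_mult[OF ideal_setD(1)[OF py], of "x ^ k" 1] by (simp add: k)
  then have gI: "g \<in> I" by (simp add: J_def g_def)
  have surj: "\<exists>r. a - g * r \<in> D" if a: "a \<in> I \<inter> px" for a
  proof -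
    obtain s where s: "a - x * s \<in> Z" using a by (auto simp: principal_mod_def)
    then have "x * s \<in> I" using a ZI ideal_cong_iff[OF I, of a "x * s"] by blast
    then have "s \<in> principal_mod py (x ^ k)" using k by (auto simp: J_def)
    then obtain r where r: "s - x ^ k * r \<in> py" by (auto simp: principal_mod_def)
    have "(a - x * s) + x * (s - x ^ k * r) \<in> Z" by (intro ideal_setD(2)[OF Z s] x_times_py r)
    then have "a - g * r \<in> D" using ZD by (auto simp: g_def algebra_simps)
    then show ?thesis ..
  qed
  define K where "K = {r. g * r \<in> D}"
  have K: "ideal_set K" unfolding ideal_set_def K_def
    using ideal_setD(1)[OF D] ideal_setD(2)[OF D] ideal_setD(3)[OF D]
    by (auto simp: distrib_left mult.left_commute[of g])
  have "principal_mod py x \<subseteq> K"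
  proof (rule principal_mod_least[OF K])
    show "py \<subseteq> K"
    proof
      fix r assume "r \<in> py"
      then have "x ^ k * (x * r) \<in> Z" by (intro ideal_setD(3)[OF Z] x_times_py)
      then show "r \<in> K" using ZD by (auto simp: K_def g_def algebra_simps)
    qed
    show "x \<in> K" using xI[OF gI] by (simp add: K_def mult.commute)
  qed
  then have "subgroup_index UNIV mm = subgroup_index UNIV K * subgroup_index K mm"
    by (intro subgroup_index_tower ideal_set_subgroup mm K add_subgroup_UNIV) auto
  moreover have "subgroup_index UNIV K = ideal_defect I"
    unfolding ideal_defect_def D_def[symmetric]
  proof (rule subgroup_index_transfer[OF ideal_set_subgroup[OF K] sD, where f="(*) g"])
    show "g * u - g * v \<in> D \<longleftrightarrow> u - v \<in> K" for u v by (simp add: K_def right_diff_distrib)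
    show "g * u \<in> I \<inter> px" for u
    proof -
      have "x * (x ^ k * u) \<in> px" by (rule principal_mod_mult[OF ideal_setD(1)[OF Z]])
      then show ?thesis using ideal_setD(4)[OF I gI] by (simp add: g_def mult.assoc)
    qed
    show "\<exists>u\<in>UNIV. v - g * u \<in> D" if "v \<in> I \<inter> px" for v using surj[OF that] by blast
  qed
  ultimately show ?thesis using fin by (cases "subgroup_index K mm") auto
qed

text \<open>The formula \<open>eq\<close> in the proof compares both indices through the defects. In the first case of the
  inequality the Fitting ideal is principal, in the second both defects are compared with the order
  of the residue field.\<close>

theorem index_le_fitting_index:
  assumes N: "submodule_set N" and ZN: "vec_in t Z \<subseteq> N" and fin: "subgroup_index UNIV N \<noteq> 0"
  shows "subgroup_index UNIV N \<le> subgroup_index UNIV (fitting Z t N)"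
    and "fitting Z t N = principal_mod Z d \<Longrightarrow> subgroup_index UNIV N = subgroup_index UNIV (fitting Z t N)"
proof -
  interpret S: node Z y x by (rule swap)
  define I where "I = fitting Z t N"
  have I: "ideal_set I" and ZI: "Z \<subseteq> I" unfolding I_def by (rule fitting_ideal_set fitting_superset)+
  obtain e where e: "\<And>v. x ^ e *v v \<in> N" using power_annihilates[OF N ZN fin] by blast
  obtain e' where e': "\<And>v. y ^ e' *v v \<in> N" using S.power_annihilates[OF N ZN fin] by blast
  have V: "submodule_set (vec_in t px)" "submodule_set (vec_in t py)"
    by (intro vec_in_submodule px py)+
  have Nsub: "N \<subseteq> sumset N (vec_in t py)" "N \<subseteq> sumset N (vec_in t px)"
    by (intro subset_sumset submodule_setD(1) V)+
  have iy: "subgroup_index UNIV (sumset N (vec_in t py)) = subgroup_index UNIV (sumset I py)"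
    unfolding I_def fitting_sumset[OF Z py principal_mod_subset N, symmetric]
    using e Nsub(1) by (intro fitting_index[of _ _ e] sumset_submodule N V subset_sumset2 submodule_setD(1)) auto
  have ix: "subgroup_index UNIV (sumset N (vec_in t px)) = subgroup_index UNIV (sumset I px)"
    unfolding I_def fitting_sumset[OF Z px principal_mod_subset N, symmetric]
    using e' Nsub(2) by (intro S.fitting_index[of _ _ e'] sumset_submodule N V subset_sumset2 submodule_setD(1)) auto
  have eq: "subgroup_index UNIV N * defect t N = subgroup_index UNIV I * ideal_defect I"
    by (simp add: index_defect[OF N ZN] index_ideal_defect[OF I ZI] iy ix)
  have fx: "subgroup_index UNIV (sumset N (vec_in t w)) \<noteq> 0" if "ideal_set w" for w
  proof -
    have "subgroup_index UNIV N = subgroup_index UNIV (sumset N (vec_in t w)) * subgroup_index (sumset N (vec_in t w)) N"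
      using that by (intro subgroup_index_tower submodule_set_subgroup sumset_submodule N vec_in_submodule
          add_subgroup_UNIV subset_sumset submodule_setD(1)) auto
    then show ?thesis using fin by auto
  qed
  have dN: "defect t N \<noteq> 0" using index_defect[OF N ZN] fx[OF px] fx[OF py] fin by (metis mult_eq_0_iff)
  have dI: "ideal_defect I \<noteq> 0" using eq dN fin by (metis mult_eq_0_iff)
  have sDN: "add_subgroup (sumset ((*v) x ` N) (vec_in t Z))"
    by (intro submodule_set_subgroup scaled_submodule N)
  have principal: "subgroup_index UNIV N = subgroup_index UNIV I" if d: "I = principal_mod Z d" for d
  proof -
    note P = principal_fitting[OF N ZN e e' d[unfolded I_def]]
    have dN1: "defect t N = 1" unfolding defect_def
      by (intro subgroup_index_trivial sDN P(1) add_subgroup_Int submodule_set_subgroup N V)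
    have sDI: "add_subgroup (sumset ((*) x ` I) Z)"
      proof (rule add_subgroup_sumset[OF _ ideal_set_subgroup[OF Z]], unfold add_subgroup_def, intro conjI ballI)
        show "0 \<in> (*) x ` I" using ideal_setD(1)[OF I] by (intro image_eqI[where x=0]) auto
        fix a b assume "a \<in> (*) x ` I" "b \<in> (*) x ` I"
        then obtain a' b' where "a' \<in> I" "b' \<in> I" "a = x * a'" "b = x * b'" by blast
        then show "a - b \<in> (*) x ` I"
          using ideal_setD(6)[OF I] by (intro image_eqI[where x="a' - b'"]) (auto simp: algebra_simps)
      qed
    have "ideal_defect I = 1" unfolding ideal_defect_def
      using P(2) by (intro subgroup_index_trivial[OF sDI] add_subgroup_Int ideal_set_subgroup I px) (simp add: I_def)
    then show ?thesis using eq dN1 by simp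
  qed
  show "subgroup_index UNIV N = subgroup_index UNIV (fitting Z t N)" if "fitting Z t N = principal_mod Z d"
    using principal[of d] that by (simp add: I_def)
  show "subgroup_index UNIV N \<le> subgroup_index UNIV (fitting Z t N)"
  proof (cases "N \<inter> vec_in t px \<subseteq> sumset ((*v) x ` N) (vec_in t Z)")
    case True
    then show ?thesis using trivial_defect_spanning[OF N ZN fin e e'] principal by (auto simp: I_def)
  next
    case False
    then obtain v where v: "v \<in> N" "v \<in> vec_in t px" "v \<notin> sumset ((*v) x ` N) (vec_in t Z)" by blast
    note q = defect_ge[OF N dN v]
    have xe: "x ^ (e * t) \<in> I"
    proof -
      define b where "b i = x ^ e *v (\<lambda>j. if j = i then 1 else 0)" for i :: nat
      have "det_rows t b = (\<Prod>i<t. b i i)" by (rule det_rows_triangular) (simp add: b_def)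
      also have "\<dots> = x ^ (e * t)" by (simp add: b_def power_mult)
      finally show ?thesis using det_in_fitting[of t b N Z] e by (simp add: b_def I_def)
    qed
    have "ideal_defect I \<le> defect t N" using ideal_defect_le[OF I ZI xe q(2)] q(1) by simp
    then have "subgroup_index UNIV N * ideal_defect I \<le> subgroup_index UNIV I * ideal_defect I"
      unfolding eq[symmetric] by simp
    then show ?thesis using dI by (simp add: I_def)
  qed
qed

end

section \<open>Group rings of cyclic groups of prime order\<close>

text \<open>By Pascal's rule, consecutive binomial coefficients \<open>p - 1\<close> over \<open>m\<close> add up to a binomial coefficient of
  \<open>p\<close>, which \<open>p\<close> divides.\<close>

lemma prime_dvd_alternating_binomial:
  assumes "Factorial_Ring.prime p" "m < p"
  shows "int p dvd 1 - (-1) ^ m * int ((p - 1) choose m)"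
  using assms(2)
proof (induction m)
  case 0
  then show ?case by simp
next
  case (Suc m)
  have p: "p = Suc (p - 1)" using assms(1) prime_gt_0_nat[of p] by simp
  have "p choose Suc m = ((p - 1) choose m) + ((p - 1) choose Suc m)"
    by (subst p) (rule binomial_Suc_Suc)
  then have *: "int ((p - 1) choose Suc m) = int (p choose Suc m) - int ((p - 1) choose m)" by simp
  have "p dvd (p choose Suc m)" using Suc.prems assms(1) prime_gt_0_nat[OF assms(1)] by (intro dvd_choose_prime) auto
  then have "int p dvd int (p choose Suc m)" by simp
  then have "int p dvd (1 - (-1) ^ m * int ((p - 1) choose m)) + (-1) ^ m * int (p choose Suc m)"
    using Suc by (intro dvd_add) auto
  also have "\<dots> = 1 - (-1) ^ Suc m * int ((p - 1) choose Suc m)" unfolding * by (simp add: algebra_simps)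
  finally show ?case .
qed

text \<open>Modulo \<open>p\<close> the \<open>p\<close>-th cyclotomic polynomial is a power of \<open>s - 1\<close>.\<close>

lemma norm_element_expansion:
  fixes s :: "'r::comm_ring_1"
  assumes "Factorial_Ring.prime p"
  shows "\<exists>h. (\<Sum>k<p. s ^ k) = (s - 1) ^ (p - 1) + of_nat p * h"
proof -
  define n where "n = p - 1"
  have p: "p = Suc n" using assms prime_gt_0_nat[of p] by (simp add: n_def)
  have "\<forall>m\<in>{..n}. \<exists>c. 1 - (-1) ^ m * int (n choose m) = int p * c"
    using prime_dvd_alternating_binomial[OF assms] unfolding n_def[symmetric] dvd_def by (simp add: p less_Suc_eq_le)
  from bchoice[OF this] obtain c where c: "\<And>m. m \<le> n \<Longrightarrow> 1 - (-1) ^ m * int (n choose m) = int p * c m" by auto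
  have c': "1 - (-1) ^ m * of_nat (n choose m) = of_nat p * (of_int (c m) :: 'r)" if "m \<le> n" for m
    using arg_cong[OF c[OF that], of "of_int :: int \<Rightarrow> 'r"] by simp
  have "(\<Sum>k<p. s ^ k) = (\<Sum>m\<le>n. s ^ (n - m))"
    using sum.nat_diff_reindex[of "\<lambda>k. s ^ k" "Suc n"] by (simp add: p lessThan_Suc_atMost)
  moreover have "(s - 1) ^ n = (\<Sum>m\<le>n. of_nat (n choose m) * (-1) ^ m * s ^ (n - m))"
    using binomial_ring[of "-1" s n] by simp
  ultimately have "(\<Sum>k<p. s ^ k) - (s - 1) ^ n = (\<Sum>m\<le>n. (1 - (-1) ^ m * of_nat (n choose m)) * s ^ (n - m))"
    by (simp add: sum_subtractf algebra_simps)
  also have "\<dots> = of_nat p * (\<Sum>m\<le>n. of_int (c m) * s ^ (n - m))"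
    unfolding sum_distrib_left by (intro sum.cong) (auto simp: c' mult.assoc)
  finally have "(\<Sum>k<p. s ^ k) = (s - 1) ^ (p - 1) + of_nat p * (\<Sum>m\<le>n. of_int (c m) * s ^ (n - m))"
    by (simp add: n_def algebra_simps)
  then show ?thesis ..
qed

text \<open>The group ring of a cyclic group of order \<open>p\<close> over a discrete valuation ring with uniformizer \<open>p\<close>,
  seen from the ambient ring: \<open>Z\<close> represents zero, \<open>A\<close> represents the coefficients and \<open>s\<close> a
  generator of the group.\<close>

locale cyclic_group_ring =
  fixes Z A :: "'r::comm_ring_1 set" and s :: 'r and p :: nat
  assumes Z: "ideal_set Z" and p: "Factorial_Ring.prime p"
    and one_A: "1 \<in> A"
    and add_A: "a \<in> A \<Longrightarrow> b \<in> A \<Longrightarrow> a + b \<in> A"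
    and minus_A: "a \<in> A \<Longrightarrow> - a \<in> A"
    and mult_A: "a \<in> A \<Longrightarrow> b \<in> A \<Longrightarrow> a * b \<in> A"
    and dvr_A: "a \<in> A \<Longrightarrow> a \<notin> Z \<Longrightarrow> \<exists>k. \<exists>u\<in>A. \<exists>v\<in>A. a - of_nat p ^ k * u \<in> Z \<and> u * v - 1 \<in> Z"
    and p_nonunit: "a \<in> A \<Longrightarrow> of_nat p * a - 1 \<notin> Z"
    and p_power: "of_nat p ^ k \<notin> Z"
    and s_order: "s ^ p - 1 \<in> Z"
    and expand: "\<exists>c. (\<forall>k<p. c k \<in> A) \<and> r - (\<Sum>k<p. c k * s ^ k) \<in> Z"
    and unique: "(\<And>k. k < p \<Longrightarrow> c k \<in> A) \<Longrightarrow> (\<Sum>k<p. c k * s ^ k) \<in> Z \<Longrightarrow> k < p \<Longrightarrow> c k \<in> Z"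
begin

definition "x = (\<Sum>k<p. s ^ k)"
definition "y = s - 1"

abbreviation "px \<equiv> principal_mod Z x"
abbreviation "py \<equiv> principal_mod Z y"
abbreviation "\<pi> \<equiv> of_nat p :: 'r"

lemma px: "ideal_set px" and py: "ideal_set py" and mm: "ideal_set (principal_mod py x)"
  by (intro ideal_set_principal Z)+

lemma Z_py: "a \<in> Z \<Longrightarrow> a \<in> py" and Z_px: "a \<in> Z \<Longrightarrow> a \<in> px"
  using principal_mod_subset by blast+

lemma y_py: "y * r \<in> py" and x_px: "x * r \<in> px"
  by (intro principal_mod_mult ideal_setD(1)[OF Z])+

lemma p_gt1: "1 < p" using p by (rule prime_gt_1_nat)

lemma zero_A: "0 \<in> A" using add_A[OF one_A minus_A[OF one_A]] by simp
lemma diff_A: "a \<in> A \<Longrightarrow> b \<in> A \<Longrightarrow> a - b \<in> A" using add_A[OF _ minus_A, of a b] by simp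
lemma of_nat_A: "of_nat n \<in> A" by (induction n) (auto intro: zero_A one_A add_A)
lemma power_A: "a \<in> A \<Longrightarrow> a ^ n \<in> A" by (induction n) (auto intro: one_A mult_A)
lemma sum_A: "(\<And>i. i \<in> S \<Longrightarrow> f i \<in> A) \<Longrightarrow> sum f S \<in> A"
  by (induction S rule: infinite_finite_induct) (auto intro: zero_A add_A)

lemma sum_const: "(\<Sum>k<p. a * s ^ k) = x * a"
  by (simp add: x_def sum_distrib_left mult.commute[of _ a])

lemma yx: "y * x \<in> Z"
  using s_order power_diff_1_eq[of s p] by (simp add: x_def y_def)

lemma power_s_py: "s ^ k - 1 \<in> py"
  using y_py[of "\<Sum>i<k. s ^ i"] power_diff_1_eq[of s k] by (simp add: y_def)

lemma x_cong_p: "x - \<pi> \<in> py"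
proof -
  have "x - \<pi> = (\<Sum>k<p. s ^ k - 1)" by (simp add: x_def sum_subtractf)
  also have "\<dots> \<in> py" by (intro ideal_set_sum py power_s_py)
  finally show ?thesis .
qed

text \<open>The quotient by \<open>(y)\<close> is the coefficient ring; \<open>\<alpha>\<close> is the augmentation of \<open>r\<close>.\<close>

lemma augment: "\<exists>\<alpha>\<in>A. r - \<alpha> \<in> py"
proof -
  obtain a where a: "\<And>k. k < p \<Longrightarrow> a k \<in> A" "r - (\<Sum>k<p. a k * s ^ k) \<in> Z" using expand by blast
  have "(r - (\<Sum>k<p. a k * s ^ k)) + (\<Sum>k<p. a k * (s ^ k - 1)) \<in> py"
    by (intro ideal_setD(2)[OF py] Z_py a ideal_set_sum[OF py] ideal_setD(3)[OF py] power_s_py)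
  then have "r - (\<Sum>k<p. a k) \<in> py" by (simp add: right_diff_distrib sum_subtractf)
  moreover have "(\<Sum>k<p. a k) \<in> A" using a by (intro sum_A) auto
  ultimately show ?thesis by blast
qed

lemma x_times_py: "r \<in> py \<Longrightarrow> x * r \<in> Z"
proof -
  assume "r \<in> py"
  then obtain t where t: "r - y * t \<in> Z" by (auto simp: principal_mod_def)
  have "x * (r - y * t) + y * x * t \<in> Z"
    by (intro ideal_setD(2)[OF Z] ideal_setD(3)[OF Z t] ideal_setD(4)[OF Z yx])
  then show ?thesis by (simp add: algebra_simps)
qed

lemma coeff_px:
  assumes r: "r \<in> px" shows "\<exists>\<gamma>\<in>A. r - (\<Sum>k<p. \<gamma> * s ^ k) \<in> Z"
proof -
  obtain g where g: "r - x * g \<in> Z" using r by (auto simp: principal_mod_def)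
  obtain \<gamma> where \<gamma>: "\<gamma> \<in> A" "g - \<gamma> \<in> py" using augment by blast
  have "(r - x * g) + x * (g - \<gamma>) \<in> Z" by (intro ideal_setD(2)[OF Z g] x_times_py \<gamma>)
  then have "r - (\<Sum>k<p. \<gamma> * s ^ k) \<in> Z" unfolding sum_const by (simp add: algebra_simps)
  then show ?thesis using \<gamma>(1) by blast
qed

lemma A_Int_py: assumes a: "a \<in> A" "a \<in> py" shows "a \<in> Z"
proof -
  have "(\<Sum>k<p. a * s ^ k) \<in> Z" using x_times_py[OF a(2)] by (simp add: sum_const)
  then show ?thesis using unique[of "\<lambda>_. a" 0] a(1) p_gt1 by simp
qed

lemma p_cancel: assumes a: "a \<in> A" "\<pi> ^ k * a \<in> Z" shows "a \<in> Z"
proof (rule ccontr)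
  assume "a \<notin> Z"
  then obtain j u v where u: "a - \<pi> ^ j * u \<in> Z" "u * v - 1 \<in> Z" using dvr_A a(1) by blast
  have "v * (\<pi> ^ k * a) - v * \<pi> ^ k * (a - \<pi> ^ j * u) - \<pi> ^ (k + j) * (u * v - 1) \<in> Z"
    by (intro ideal_setD(6)[OF Z] ideal_setD(3)[OF Z] u a)
  then have "\<pi> ^ (k + j) \<in> Z" by (simp add: algebra_simps power_add)
  then show False using p_power by blast
qed

lemma A_separated:
  assumes a: "a \<in> A" and div: "\<And>n. \<exists>b\<in>A. a - \<pi> ^ n * b \<in> Z" shows "a \<in> Z"
proof (rule ccontr)
  assume "a \<notin> Z"
  then obtain k u v where u: "a - \<pi> ^ k * u \<in> Z" "u * v - 1 \<in> Z" "u \<in> A" "v \<in> A" using dvr_A a by blast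
  obtain b where b: "b \<in> A" "a - \<pi> ^ Suc k * b \<in> Z" using div by blast
  have "(a - \<pi> ^ Suc k * b) - (a - \<pi> ^ k * u) \<in> Z" by (intro ideal_setD(6)[OF Z] b u)
  then have "\<pi> ^ k * (u - \<pi> * b) \<in> Z" by (simp add: algebra_simps)
  then have ub: "u - \<pi> * b \<in> Z" by (rule p_cancel[rotated]) (intro diff_A mult_A of_nat_A u b)
  have "(u * v - 1) - v * (u - \<pi> * b) \<in> Z" by (intro ideal_setD(6)[OF Z] ideal_setD(3)[OF Z] ub u)
  then have "\<pi> * (b * v) - 1 \<in> Z" by (simp add: algebra_simps)
  then show False using p_nonunit[OF mult_A[OF b(1) u(4)]] by blast
qed

text \<open>The ideal generated by \<open>1 - p w\<close> and by \<open>p\<close> is the whole ring, which is finitely generated over \<open>A\<close>, so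
  Nakayama's lemma over \<open>A\<close> removes \<open>p\<close>.\<close>

lemma unit_one_minus_p: "\<exists>u. (1 - \<pi> * w) * u - 1 \<in> Z"
proof -
  let ?N0 = "principal_mod Z (1 - \<pi> * w)"
  have N0: "ideal_set ?N0" by (intro ideal_set_principal Z)
  have ZN0: "a \<in> Z \<Longrightarrow> a \<in> ?N0" for a using principal_mod_subset by blast
  have "UNIV \<subseteq> ?N0"
  proof (rule nakayama_mod[where s="(*)" and R=A and w=\<pi> and m=p and g="\<lambda>k. s ^ k"])
    show "Modules.module ((*) :: 'r \<Rightarrow> 'r \<Rightarrow> 'r)" by unfold_locales (auto simp: algebra_simps)
    show "\<exists>u\<in>A. \<forall>v\<in>UNIV. u * (1 - \<pi> * a) * v - v \<in> ?N0" if a: "a \<in> A" for a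
    proof -
      have "1 - \<pi> * a \<notin> Z" using p_nonunit[OF a] ideal_setD(5)[OF Z, of "1 - \<pi> * a"] by auto
      moreover have "1 - \<pi> * a \<in> A" by (intro diff_A one_A mult_A of_nat_A a)
      ultimately obtain k u v where u: "1 - \<pi> * a - \<pi> ^ k * u \<in> Z" "u * v - 1 \<in> Z" "u \<in> A" "v \<in> A"
        using dvr_A by blast
      have "k = 0"
      proof (rule ccontr)
        assume "k \<noteq> 0"
        then obtain j where "k = Suc j" by (cases k) auto
        then have "\<pi> * (a + \<pi> ^ j * u) - 1 \<in> Z" using ideal_setD(5)[OF Z u(1)] by (simp add: algebra_simps)
        then show False using p_nonunit[OF add_A[OF a mult_A[OF power_A[OF of_nat_A] u(3)]]] by blast
      qed
      have "v * (1 - \<pi> * a - \<pi> ^ k * u) + (u * v - 1) \<in> Z"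
        by (intro ideal_setD(2)[OF Z] ideal_setD(3)[OF Z] u)
      then have c: "v * (1 - \<pi> * a) - 1 \<in> Z" using \<open>k = 0\<close> by (simp add: algebra_simps)
      have "v * (1 - \<pi> * a) * t - t \<in> ?N0" for t
        using ZN0[OF ideal_setD(4)[OF Z c, of t]] by (simp add: algebra_simps)
      then show ?thesis using u(4) by blast
    qed
    show "\<exists>v'\<in>UNIV. v - \<pi> * v' \<in> ?N0" for v
    proof -
      have "(1 - \<pi> * w) * v \<in> ?N0" by (rule principal_mod_mult[OF ideal_setD(1)[OF Z]])
      then have "v - \<pi> * (w * v) \<in> ?N0" by (simp add: algebra_simps)
      then show ?thesis by blast
    qed
    show "\<exists>c. (\<forall>i<p. c i \<in> A) \<and> v - (\<Sum>i<p. c i * s ^ i) \<in> ?N0" for v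
      using expand[of v] ZN0 by blast
  qed (use N0 in \<open>auto intro: ideal_set_subgroup ideal_setD of_nat_A add_A mult_A\<close>)
  then have "1 \<in> ?N0" by blast
  then obtain u where "1 - (1 - \<pi> * w) * u \<in> Z" by (auto simp: principal_mod_def)
  then show ?thesis using ideal_setD(5)[OF Z] by force
qed

definition "h = (SOME h. x = y ^ (p - 1) + \<pi> * h)"

lemma x_eq: "x = y ^ (p - 1) + \<pi> * h"
  unfolding h_def by (rule someI_ex) (use norm_element_expansion[OF p, of s] in \<open>simp add: x_def y_def\<close>)

text \<open>As \<open>y ^ p\<close> is divisible by \<open>p\<close>, the partial geometric series with \<open>p\<close> terms is an inverse up to
  a factor of the form \<open>1 - p w\<close>.\<close>

lemma unit_one_plus_y: "\<exists>u. (1 + y * g) * u - 1 \<in> Z"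
proof -
  define z where "z = - (y * g)"
  have yp: "y ^ p = y * x - \<pi> * (y * h)"
  proof -
    have "y ^ p = y * y ^ (p - 1)" using p_gt1 by (simp flip: power_Suc)
    also have "y ^ (p - 1) = x - \<pi> * h" using x_eq by simp
    finally show ?thesis by (simp add: algebra_simps)
  qed
  define w where "w = - ((- g) ^ p * (y * h))"
  have zp: "z ^ p = (- g) ^ p * (y * x) + \<pi> * w"
  proof -
    have "z ^ p = (- g) ^ p * y ^ p" unfolding z_def by (simp flip: power_mult_distrib add: mult.commute)
    then show ?thesis by (simp add: yp w_def algebra_simps)
  qed
  obtain u where u: "(1 - \<pi> * w) * u - 1 \<in> Z" using unit_one_minus_p by blast
  have "(1 + y * g) * (\<Sum>i<p. z ^ i) = 1 - z ^ p"
    using power_diff_1_eq[of z p] by (simp add: z_def algebra_simps)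
  then have "(1 + y * g) * ((\<Sum>i<p. z ^ i) * u) = (1 - z ^ p) * u"
    by (simp only: mult.assoc[symmetric])
  also have "\<dots> = (1 - \<pi> * w) * u - (y * x) * ((- g) ^ p * u)"
    unfolding zp by (simp add: algebra_simps)
  finally have e: "(1 + y * g) * ((\<Sum>i<p. z ^ i) * u) - 1 = ((1 - \<pi> * w) * u - 1) - (y * x) * ((- g) ^ p * u)"
    by simp
  have "((1 - \<pi> * w) * u - 1) - (y * x) * ((- g) ^ p * u) \<in> Z"
    by (intro ideal_setD(6)[OF Z u] ideal_setD(4)[OF Z yx])
  then show ?thesis using e by metis
qed

lemma unit_lift:
  assumes "r - u \<in> py" "u * v - 1 \<in> Z" shows "\<exists>w. r * w - 1 \<in> Z"
proof -
  obtain g where g: "r - u - y * g \<in> Z" using assms(1) by (auto simp: principal_mod_def)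
  obtain w where w: "(1 + y * (g * v)) * w - 1 \<in> Z" using unit_one_plus_y by blast
  have "(r - u - y * g) * (v * w) + (u * v - 1) * w + ((1 + y * (g * v)) * w - 1) \<in> Z"
    by (intro ideal_setD(2)[OF Z] ideal_setD(4)[OF Z] g assms(2) w)
  then have "r * (v * w) - 1 \<in> Z" by (simp add: algebra_simps)
  then show ?thesis ..
qed

text \<open>The augmentations of \<open>x\<close> and \<open>y\<close> are \<open>p\<close> and 0, so the augmentation of \<open>h\<close> is 1.\<close>

lemma h_unit: "\<exists>u. h * u - 1 \<in> Z"
proof -
  obtain \<alpha> where \<alpha>: "\<alpha> \<in> A" "h - \<alpha> \<in> py" using augment by blast
  have y1: "y ^ (p - 1) \<in> py" using p_gt1 y_py[of "y ^ (p - 2)"]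
    by (simp flip: power_Suc) (metis Suc_diff_Suc numeral_2_eq_2)
  have "x - \<pi> - y ^ (p - 1) - \<pi> * (h - \<alpha>) \<in> py"
    by (intro ideal_setD(6)[OF py] ideal_setD(3)[OF py] x_cong_p y1 \<alpha>)
  then have "\<pi> ^ 1 * (\<alpha> - 1) \<in> py" by (subst (asm) x_eq) (simp add: algebra_simps)
  then have "\<pi> ^ 1 * (\<alpha> - 1) \<in> Z" by (intro A_Int_py mult_A power_A of_nat_A diff_A \<alpha> one_A)
  then have "\<alpha> - 1 \<in> Z" by (rule p_cancel[rotated]) (intro diff_A \<alpha> one_A)
  then have "(h - \<alpha>) + (\<alpha> - 1) \<in> py" by (intro ideal_setD(2)[OF py] \<alpha> Z_py)
  then show ?thesis using unit_lift[of h 1 1] ideal_setD(1)[OF Z] by simp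
qed

lemma y_power_px: "y ^ ((p - 1) * n) - (- (\<pi> * h)) ^ n \<in> px"
proof -
  have "y ^ (p - 1) - (- (\<pi> * h)) \<in> px" using x_px[of 1] x_eq by simp
  from ideal_cong_power[OF px this] show ?thesis by (simp add: power_mult)
qed

text \<open>The quotient by \<open>(y)\<close> is \<open>A\<close>, where \<open>x\<close> becomes \<open>p\<close>. In the quotient by \<open>(x)\<close> the power \<open>y\<^sup>p\<^sup>-\<^sup>1\<close> becomes
  \<open>- p h\<close>, so that statements about powers of \<open>y\<close> reduce to statements about powers of \<open>p\<close>, which can
  be checked on coefficients: the multiples of \<open>x\<close> are the elements with constant coefficients.\<close>

lemma is_node: "node Z x y"
proof
  show "ideal_set Z" by (rule Z)
  show "x * y \<in> Z" using yx by (simp add: mult.commute)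
  show "r \<in> py" if "x * r \<in> Z" for r
  proof -
    obtain \<alpha> where \<alpha>: "\<alpha> \<in> A" "r - \<alpha> \<in> py" using augment by blast
    have "x * r - x * (r - \<alpha>) \<in> Z" by (intro ideal_setD(6)[OF Z] that x_times_py \<alpha>)
    then have "(\<Sum>k<p. \<alpha> * s ^ k) \<in> Z" unfolding sum_const by (simp add: algebra_simps)
    then have "\<alpha> \<in> Z" using unique[of "\<lambda>_. \<alpha>" 0] \<alpha>(1) p_gt1 by simp
    then have "(r - \<alpha>) + \<alpha> \<in> py" by (intro ideal_setD(2)[OF py] \<alpha> Z_py)
    then show ?thesis by simp
  qed
  show "r \<in> px" if r: "y * r \<in> Z" for r
  proof -
    obtain a where a: "\<And>k. k < p \<Longrightarrow> a k \<in> A" "r - (\<Sum>k<p. a k * s ^ k) \<in> Z" using expand by blast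
    obtain n where n: "p = Suc n" using p_gt1 by (cases p) auto
    \<comment> \<open>Multiplication by \<open>s\<close> shifts the coefficients cyclically.\<close>
    define b where "b k = (case k of 0 \<Rightarrow> a n | Suc j \<Rightarrow> a j)" for k
    have b: "b k \<in> A" if "k < p" for k using a(1) that by (auto simp: b_def n split: nat.split)
    have 1: "(\<Sum>k<p. b k * s ^ k) = a n + (\<Sum>k<n. a k * s ^ Suc k)"
      unfolding n sum.lessThan_Suc_shift by (simp add: b_def)
    have 2: "s * (\<Sum>k<p. a k * s ^ k) = (\<Sum>k<n. a k * s ^ Suc k) + a n * s ^ p"
      unfolding n sum_distrib_left by (simp add: algebra_simps)
    have "y * r - y * (r - (\<Sum>k<p. a k * s ^ k)) - a n * (s ^ p - 1) \<in> Z"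
      by (intro ideal_setD(6)[OF Z] ideal_setD(3)[OF Z] r a s_order)
    also have "y * r - y * (r - (\<Sum>k<p. a k * s ^ k)) - a n * (s ^ p - 1)
      = (\<Sum>k<p. b k * s ^ k) - (\<Sum>k<p. a k * s ^ k)"
      unfolding 1 using 2 by (simp add: y_def algebra_simps)
    also have "\<dots> = (\<Sum>k<p. (b k - a k) * s ^ k)" by (simp add: left_diff_distrib sum_subtractf)
    finally have ba: "b k - a k \<in> Z" if "k < p" for k
      using unique[of "\<lambda>k. b k - a k"] b a(1) that by (simp add: diff_A)
    have a0: "a k - a 0 \<in> Z" if "k < p" for k using that
    proof (induction k)
      case 0 then show ?case using ideal_setD(1)[OF Z] by simp
    next
      case (Suc k)
      have "(a k - a 0) - (b (Suc k) - a (Suc k)) \<in> Z" 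
        by (rule ideal_setD(6)[OF Z _ ba]) (use Suc in auto)
      then show ?case by (simp add: b_def)
    qed
    have "(r - (\<Sum>k<p. a k * s ^ k)) + (\<Sum>k<p. (a k - a 0) * s ^ k) \<in> Z"
      using a0 by (intro ideal_setD(2)[OF Z] a ideal_set_sum[OF Z] ideal_setD(4)[OF Z]) auto
    then have "r - x * a 0 \<in> Z" by (simp add: left_diff_distrib sum_subtractf sum_const)
    then show ?thesis by (auto simp: principal_mod_def)
  qed
  show "\<exists>u. r * u - 1 \<in> Z" if r: "r \<notin> principal_mod py x" for r
  proof -
    obtain \<alpha> where \<alpha>: "\<alpha> \<in> A" "r - \<alpha> \<in> py" using augment by blast
    have pym: "a \<in> py \<Longrightarrow> a \<in> principal_mod py x" for a using principal_mod_subset by blast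
    have nm: "\<alpha> \<notin> principal_mod py x"
    proof
      assume "\<alpha> \<in> principal_mod py x"
      then have "(r - \<alpha>) + \<alpha> \<in> principal_mod py x" by (rule ideal_setD(2)[OF mm pym[OF \<alpha>(2)]])
      then show False using r by simp
    qed
    then have "\<alpha> \<notin> Z" using pym Z_py by blast
    then obtain k u v where u: "\<alpha> - \<pi> ^ k * u \<in> Z" "u * v - 1 \<in> Z" using dvr_A \<alpha>(1) by blast
    have "k = 0"
    proof (rule ccontr)
      assume "k \<noteq> 0"
      then obtain j where j: "k = Suc j" by (cases k) auto
      have "x \<in> principal_mod py x"
        using principal_mod_mult[OF ideal_setD(1)[OF py], of x 1] by simp
      then have "x - (x - \<pi>) \<in> principal_mod py x"
        by (rule ideal_setD(6)[OF mm _ pym[OF x_cong_p]])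
      then have "\<pi> \<in> principal_mod py x" by simp
      then have "\<pi> * (\<pi> ^ j * u) \<in> principal_mod py x" by (rule ideal_setD(4)[OF mm])
      then have "(\<alpha> - \<pi> ^ k * u) + \<pi> * (\<pi> ^ j * u) \<in> principal_mod py x"
        by (rule ideal_setD(2)[OF mm pym[OF Z_py[OF u(1)]]])
      then show False using nm by (simp add: j algebra_simps)
    qed
    have "(r - \<alpha>) + (\<alpha> - \<pi> ^ k * u) \<in> py" by (intro ideal_setD(2)[OF py] \<alpha> Z_py u)
    then have "r - u \<in> py" by (simp add: \<open>k = 0\<close>)
    then show ?thesis using u(2) by (rule unit_lift)
  qed
  show "r \<in> py" if r: "\<And>n. r \<in> principal_mod py (x ^ n)" for r
  proof -
    obtain \<alpha> where \<alpha>: "\<alpha> \<in> A" "r - \<alpha> \<in> py" using augment by blast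
    have "\<alpha> \<in> Z"
    proof (rule A_separated[OF \<alpha>(1)])
      fix n
      obtain q where q: "r - x ^ n * q \<in> py" using r[of n] by (auto simp: principal_mod_def)
      obtain \<beta> where \<beta>: "\<beta> \<in> A" "q - \<beta> \<in> py" using augment by blast
      have "(r - x ^ n * q) - (r - \<alpha>) + (x ^ n * q - \<pi> ^ n * \<beta>) \<in> py"
        by (intro ideal_setD(2)[OF py] ideal_setD(6)[OF py] q \<alpha> ideal_cong_mult[OF py]
            ideal_cong_power[OF py] x_cong_p \<beta>)
      then have "\<alpha> - \<pi> ^ n * \<beta> \<in> py" by (simp add: algebra_simps)
      then have "\<alpha> - \<pi> ^ n * \<beta> \<in> Z" by (intro A_Int_py diff_A \<alpha> mult_A power_A of_nat_A \<beta>)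
      then show "\<exists>b\<in>A. \<alpha> - \<pi> ^ n * b \<in> Z" using \<beta>(1) by blast
    qed
    then have "(r - \<alpha>) + \<alpha> \<in> py" by (intro ideal_setD(2)[OF py] \<alpha> Z_py)
    then show ?thesis by simp
  qed
  show "r \<in> px" if r: "\<And>n. r \<in> principal_mod px (y ^ n)" for r
  proof -
    obtain a where a: "\<And>k. k < p \<Longrightarrow> a k \<in> A" "r - (\<Sum>k<p. a k * s ^ k) \<in> Z" using expand by blast
    have p0: "0 < p" using p_gt1 by simp
    have a0: "a k - a 0 \<in> Z" if k: "k < p" for k
    proof (rule A_separated)
      show "a k - a 0 \<in> A" using a(1) k p0 by (intro diff_A) auto
      fix n
      obtain q where q: "r - y ^ ((p - 1) * n) * q \<in> px" using r[of "(p - 1) * n"] by (auto simp: principal_mod_def)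
      define q' where "q' = (- h) ^ n * q"
      have "(r - y ^ ((p - 1) * n) * q) + (y ^ ((p - 1) * n) - (- (\<pi> * h)) ^ n) * q \<in> px"
        by (intro ideal_setD(2)[OF px] ideal_setD(4)[OF px] q y_power_px)
      moreover have "(- (\<pi> * h)) ^ n = \<pi> ^ n * (- h) ^ n" by (simp flip: power_mult_distrib)
      ultimately have "r - \<pi> ^ n * q' \<in> px" by (simp add: q'_def algebra_simps)
      then obtain \<gamma> where \<gamma>: "\<gamma> \<in> A" "r - \<pi> ^ n * q' - (\<Sum>k<p. \<gamma> * s ^ k) \<in> Z" using coeff_px by blast
      obtain c where c: "\<And>k. k < p \<Longrightarrow> c k \<in> A" "q' - (\<Sum>k<p. c k * s ^ k) \<in> Z" using expand by blast
      have "(r - \<pi> ^ n * q' - (\<Sum>k<p. \<gamma> * s ^ k)) - (r - (\<Sum>k<p. a k * s ^ k)) + \<pi> ^ n * (q' - (\<Sum>k<p. c k * s ^ k)) \<in> Z"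
        by (intro ideal_setD(2)[OF Z] ideal_setD(6)[OF Z] ideal_setD(3)[OF Z] \<gamma> a c)
      also have "(r - \<pi> ^ n * q' - (\<Sum>k<p. \<gamma> * s ^ k)) - (r - (\<Sum>k<p. a k * s ^ k)) + \<pi> ^ n * (q' - (\<Sum>k<p. c k * s ^ k))
          = (\<Sum>k<p. (a k - \<gamma> - \<pi> ^ n * c k) * s ^ k)"
        by (simp add: left_diff_distrib right_diff_distrib sum_subtractf sum_distrib_left mult.assoc)
      finally have e: "a k - \<gamma> - \<pi> ^ n * c k \<in> Z" if "k < p" for k
        using unique[of "\<lambda>k. a k - \<gamma> - \<pi> ^ n * c k" k] that a(1) \<gamma>(1) c(1)
        by (simp add: diff_A mult_A power_A of_nat_A)
      have "(a k - \<gamma> - \<pi> ^ n * c k) - (a 0 - \<gamma> - \<pi> ^ n * c 0) \<in> Z" by (rule ideal_setD(6)[OF Z e[OF k] e[OF p0]])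
      then have "a k - a 0 - \<pi> ^ n * (c k - c 0) \<in> Z" by (simp add: algebra_simps)
      then show "\<exists>b\<in>A. a k - a 0 - \<pi> ^ n * b \<in> Z" using c(1) k p0 by (intro bexI[of _ "c k - c 0"] diff_A) auto
    qed
    have "(r - (\<Sum>k<p. a k * s ^ k)) + (\<Sum>k<p. (a k - a 0) * s ^ k) \<in> Z"
      using a0 by (intro ideal_setD(2)[OF Z] a ideal_set_sum[OF Z] ideal_setD(4)[OF Z]) auto
    then have "r - x * a 0 \<in> Z" by (simp add: left_diff_distrib sum_subtractf sum_const)
    then show ?thesis by (auto simp: principal_mod_def)
  qed
  show "x ^ n \<notin> py" for n
  proof
    assume "x ^ n \<in> py"
    then have "x ^ n - (x ^ n - \<pi> ^ n) \<in> py" by (intro ideal_setD(6)[OF py] ideal_cong_power[OF py] x_cong_p)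
    then have "\<pi> ^ n \<in> Z" by (intro A_Int_py power_A of_nat_A) simp
    then show False using p_power by blast
  qed
  show "y ^ n \<notin> px" for n
  proof
    assume yn: "y ^ n \<in> px"
    obtain u where u: "h * u - 1 \<in> Z" using h_unit by blast
    have "n \<le> (p - 1) * n" using p_gt1 by (cases "p - 1") auto
    then have "y ^ ((p - 1) * n) = y ^ n * y ^ ((p - 1) * n - n)" by (simp flip: power_add)
    then have "y ^ ((p - 1) * n) \<in> px" using ideal_setD(4)[OF px yn] by simp
    then have "y ^ ((p - 1) * n) - (y ^ ((p - 1) * n) - (- (\<pi> * h)) ^ n) \<in> px"
      by (intro ideal_setD(6)[OF px] y_power_px)
    then have "(- (\<pi> * h)) ^ n \<in> px" by simp
    then have 1: "(- (\<pi> * h)) ^ n * (- u) ^ n \<in> px" by (rule ideal_setD(4)[OF px])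
    have "(h * u) ^ n - 1 ^ n \<in> Z" by (intro ideal_cong_power[OF Z u])
    then have "\<pi> ^ n * ((h * u) ^ n - 1) \<in> px" by (intro ideal_setD(3)[OF px] Z_px) simp
    with 1 have "(- (\<pi> * h)) ^ n * (- u) ^ n - \<pi> ^ n * ((h * u) ^ n - 1) \<in> px"
      by (rule ideal_setD(6)[OF px])
    moreover have "(- (\<pi> * h)) ^ n * (- u) ^ n = \<pi> ^ n * (h * u) ^ n"
      by (simp flip: power_mult_distrib add: mult.assoc)
    ultimately have "\<pi> ^ n \<in> px" by (simp add: algebra_simps)
    then obtain \<gamma> where \<gamma>: "\<gamma> \<in> A" "\<pi> ^ n - (\<Sum>k<p. \<gamma> * s ^ k) \<in> Z" using coeff_px by blast
    define c where "c k = (if k = 0 then \<pi> ^ n - \<gamma> else - \<gamma>)" for k :: nat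
    have cA: "c k \<in> A" for k using \<gamma>(1) by (auto simp: c_def intro: diff_A minus_A power_A of_nat_A)
    have "(\<Sum>k<p. c k * s ^ k) = (\<Sum>k<p. (if k = 0 then \<pi> ^ n else 0) - \<gamma> * s ^ k)"
      by (intro sum.cong) (auto simp: c_def)
    also have "\<dots> = \<pi> ^ n - (\<Sum>k<p. \<gamma> * s ^ k)" using p_gt1 by (simp add: sum_subtractf)
    finally have "(\<Sum>k<p. c k * s ^ k) \<in> Z" using \<gamma>(2) by simp
    then have c: "c k \<in> Z" if "k < p" for k using unique[of c k] cA that by blast
    have "c 0 - c 1 \<in> Z" using p_gt1 by (intro ideal_setD(6)[OF Z c c]) auto
    then show False using p_power[of n] by (simp add: c_def)
  qed
qed

end

section \<open>Lifting a commutative ring to a type\<close>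

text \<open>The product of all commutative rings whose carrier consists of elements of \<open>'a\<close>, and of the ring of
  integers, whose presence ensures that 0 and 1 differ. The values at records that are not
  commutative rings are pinned down so that the ring laws hold as equations. Every commutative ring
  on \<open>'a\<close> is a quotient of this one type by an ideal.\<close>

typedef 'a cring_product =
  "{f :: 'a ring \<Rightarrow> 'a. \<forall>S. if cring S then f S \<in> carrier S else f S = undefined} \<times> (UNIV :: int set)"
  morphisms families Abs_cring_product
proof -
  have "(\<lambda>S :: 'a ring. if cring S then \<zero>\<^bsub>S\<^esub> else undefined, 0 :: int) \<in>
    {f. \<forall>S. if cring S then f S \<in> carrier S else f S = undefined} \<times> UNIV"
    by (simp add: cring.cring_simprules)
  then show ?thesis by (rule exI)
qed

setup_lifting type_definition_cring_product

lift_definition component :: "'a ring \<Rightarrow> 'a cring_product \<Rightarrow> 'a" is "\<lambda>S f. fst f S" .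

instantiation cring_product :: (type) comm_ring_1
begin

lift_definition zero_cring_product :: "'a cring_product" is
  "(\<lambda>S. if cring S then \<zero>\<^bsub>S\<^esub> else undefined, 0)"
  by (auto simp: cring.cring_simprules)

lift_definition one_cring_product :: "'a cring_product" is
  "(\<lambda>S. if cring S then \<one>\<^bsub>S\<^esub> else undefined, 1)"
  by (auto simp: cring.cring_simprules)

lift_definition plus_cring_product :: "'a cring_product \<Rightarrow> 'a cring_product \<Rightarrow> 'a cring_product" is
  "\<lambda>f g. (\<lambda>S. if cring S then fst f S \<oplus>\<^bsub>S\<^esub> fst g S else undefined, snd f + snd g)"
  by (auto simp: cring.cring_simprules)

lift_definition times_cring_product :: "'a cring_product \<Rightarrow> 'a cring_product \<Rightarrow> 'a cring_product" is
  "\<lambda>f g. (\<lambda>S. if cring S then fst f S \<otimes>\<^bsub>S\<^esub> fst g S else undefined, snd f * snd g)"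
  by (auto simp: cring.cring_simprules)

lift_definition uminus_cring_product :: "'a cring_product \<Rightarrow> 'a cring_product" is
  "\<lambda>f. (\<lambda>S. if cring S then \<ominus>\<^bsub>S\<^esub> fst f S else undefined, - snd f)"
  by (auto simp: cring.cring_simprules)

definition minus_cring_product :: "'a cring_product \<Rightarrow> 'a cring_product \<Rightarrow> 'a cring_product" where
  "minus_cring_product a b = a + - b"

instance
proof
  fix a b c :: "'a cring_product"
  show "a + b + c = a + (b + c)" by transfer (auto simp: fun_eq_iff cring.cring_simprules split: if_splits)
  show "a + b = b + a" by transfer (auto simp: fun_eq_iff cring.cring_simprules split: if_splits)
  show "0 + a = a" by transfer (auto simp: fun_eq_iff cring.cring_simprules split: if_splits, (metis+)?)
  show "- a + a = 0" by transfer (auto simp: fun_eq_iff cring.cring_simprules split: if_splits)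
  show "a - b = a + - b" by (simp add: minus_cring_product_def)
  show "a * b * c = a * (b * c)" by transfer (auto simp: fun_eq_iff cring.cring_simprules split: if_splits)
  show "a * b = b * a" by transfer (auto simp: fun_eq_iff cring.cring_simprules split: if_splits)
  show "1 * a = a"
    by transfer (auto simp: fun_eq_iff ring.ring_simprules[OF cring.axioms(1)] split: if_splits, metis+)
  show "(a + b) * c = a * c + b * c"
    by transfer (auto simp: fun_eq_iff cring.cring_simprules distrib_right split: if_splits)
  show "(0 :: 'a cring_product) \<noteq> 1" by transfer simp
qed

end

lemma component_surj:
  assumes "cring S" "a \<in> carrier S" shows "\<exists>t. component S t = a"
  using assms
  by transfer (rule bexI[of _ "(\<lambda>T. if T = S then a else if cring T then \<zero>\<^bsub>T\<^esub> else undefined, 0)" for a S],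
      auto simp: cring.cring_simprules)


locale lifted_cring = cring R for R :: "'a ring" (structure)
begin

abbreviation "\<phi> \<equiv> component R"

lemma cring_R: "cring R" by (rule is_cring)

lemma \<phi>_closed [simp, intro]: "\<phi> a \<in> carrier R"
  using cring_R by transfer (auto split: if_splits)

lemma \<phi>_0 [simp]: "\<phi> 0 = \<zero>" using cring_R by transfer simp
lemma \<phi>_1 [simp]: "\<phi> 1 = \<one>" using cring_R by transfer simp
lemma \<phi>_add [simp]: "\<phi> (a + b) = \<phi> a \<oplus> \<phi> b" using cring_R by transfer simp
lemma \<phi>_mult [simp]: "\<phi> (a * b) = \<phi> a \<otimes> \<phi> b" using cring_R by transfer simp
lemma \<phi>_minus [simp]: "\<phi> (- a) = \<ominus> \<phi> a" using cring_R by transfer simp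
lemma \<phi>_diff [simp]: "\<phi> (a - b) = \<phi> a \<ominus> \<phi> b" 
  unfolding minus_cring_product_def minus_eq \<phi>_add \<phi>_minus ..

lemma \<phi>_surj: "a \<in> carrier R \<Longrightarrow> \<exists>t. \<phi> t = a" by (rule component_surj[OF cring_R])

lemma \<phi>_sum: "\<phi> (\<Sum>i\<in>S. f i) = (\<Oplus>i\<in>S. \<phi> (f i))"
  by (induction S rule: infinite_finite_induct) (auto simp: finsum_infinite)

lemma \<phi>_prod: "\<phi> (\<Prod>i\<in>S. f i) = (\<Otimes>i\<in>S. \<phi> (f i))"
  by (induction S rule: infinite_finite_induct) (auto simp: finprod_infinite)

lemma \<phi>_sign: "\<phi> (of_int (sign \<sigma>) * a) = [sign \<sigma>] \<cdot> \<phi> a"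
proof (cases "sign \<sigma> = 1")
  case True
  then show ?thesis by (simp add: add_pow_int_ge)
next
  case False
  then have "sign \<sigma> = -1" by (auto simp: sign_def)
  then show ?thesis by (simp add: add_pow_int_lt l_minus)
qed

lemma \<phi>_det: "\<phi> (det_rows t v) = Defs.det R t (\<lambda>i j. \<phi> (v i j))"
  unfolding det_rows_expansion Defs.det_def \<phi>_sum \<phi>_sign \<phi>_prod ..

definition "ker = {a. \<phi> a = \<zero>}"

lemma diff_ker_iff: "a - b \<in> ker \<longleftrightarrow> \<phi> a = \<phi> b"
  by (simp add: ker_def r_right_minus_eq)

lemma ker_ideal: "ideal_set ker" by (auto simp: ideal_set_def ker_def)

lemma preimage_ideal:
  assumes "ideal I R" shows "ideal_set {a. \<phi> a \<in> I}"
proof -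
  interpret I: ideal I R by fact
  show ?thesis by (auto simp: ideal_set_def I.I_l_closed)
qed

lemma index_preimage:
  assumes "ideal I R"
  shows "subgroup_index UNIV {a. \<phi> a \<in> I} = card (carrier (R Quot I))"
proof -
  have "subgroup_index UNIV {a. \<phi> a \<in> I} = card (range (\<lambda>a. I +> \<phi> a))"
  proof (rule subgroup_index_eq_card)
    show "add_subgroup {a. \<phi> a \<in> I}" by (intro ideal_set_subgroup preimage_ideal assms)
    show "I +> \<phi> u = I +> \<phi> v \<longleftrightarrow> u - v \<in> {a. \<phi> a \<in> I}" for u v
      using quotient_eq_iff_same_a_r_cos[OF assms \<phi>_closed \<phi>_closed] by simp
  qed
  also have "range (\<lambda>a. I +> \<phi> a) = carrier (R Quot I)"
    unfolding FactRing_def A_RCOSETS_def' using \<phi>_surj by auto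
  finally show ?thesis .
qed

text \<open>\<open>J\<close> is the ideal generated by the kernel and the preimage of \<open>S\<close>.\<close>

lemma preimage_genideal:
  assumes S: "S \<subseteq> carrier R" and J: "ideal_set J" and kJ: "ker \<subseteq> J"
    and SJ: "\<And>a. \<phi> a \<in> S \<Longrightarrow> a \<in> J" and least: "\<And>J'. ideal_set J' \<Longrightarrow> ker \<subseteq> J' \<Longrightarrow> {a. \<phi> a \<in> S} \<subseteq> J' \<Longrightarrow> J \<subseteq> J'"
  shows "{a. \<phi> a \<in> Idl S} = J"
proof
  note iS = genideal_ideal[OF S]
  interpret iS: ideal "Idl S" R by (rule iS)
  show "J \<subseteq> {a. \<phi> a \<in> Idl S}"
    using genideal_self[OF S] by (intro least preimage_ideal iS) (auto simp: ker_def)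
  have "ideal (\<phi> ` J) R"
  proof (rule idealI[OF ring_axioms])
    show "subgroup (\<phi> ` J) (add_monoid R)"
    proof (rule add.subgroupI)
      show "\<phi> ` J \<subseteq> carrier R" by auto
      show "\<phi> ` J \<noteq> {}" using ideal_setD(1)[OF J] by auto
      fix a assume "a \<in> \<phi> ` J"
      then obtain a' where a: "a' \<in> J" "a = \<phi> a'" by blast
      then have "\<phi> (- a') \<in> \<phi> ` J" using ideal_setD(5)[OF J] by blast
      then show "\<ominus> a \<in> \<phi> ` J" using a by simp
      fix b assume "b \<in> \<phi> ` J"
      then obtain b' where b: "b' \<in> J" "b = \<phi> b'" by blast
      then have "\<phi> (a' + b') \<in> \<phi> ` J" using a ideal_setD(2)[OF J] by blast
      then show "a \<oplus> b \<in> \<phi> ` J" using a b by simp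
    qed
    fix a r assume "a \<in> \<phi> ` J" and r: "r \<in> carrier R"
    then obtain a' r' where a: "a' \<in> J" "a = \<phi> a'" "r = \<phi> r'" using \<phi>_surj by blast
    then have "\<phi> (r' * a') \<in> \<phi> ` J" using ideal_setD(3)[OF J] by blast
    then show "r \<otimes> a \<in> \<phi> ` J" using a by simp
    then show "a \<otimes> r \<in> \<phi> ` J" using a by (simp add: m_comm)
  qed
  moreover have "S \<subseteq> \<phi> ` J"
  proof
    fix a assume "a \<in> S"
    then obtain a' where "\<phi> a' = a" using \<phi>_surj S by blast
    then show "a \<in> \<phi> ` J" using SJ \<open>a \<in> S\<close> by blast
  qed
  ultimately have "Idl S \<subseteq> \<phi> ` J" by (rule genideal_minimal)
  then show "{a. \<phi> a \<in> Idl S} \<subseteq> J"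
  proof (intro subsetI)
    fix a assume "Idl S \<subseteq> \<phi> ` J" "a \<in> {a. \<phi> a \<in> Idl S}"
    then obtain b where b: "b \<in> J" "\<phi> a = \<phi> b" by blast
    then have "a - b \<in> J" using kJ diff_ker_iff by blast
    then show "a \<in> J" using b ideal_cong_iff[OF J] by blast
  qed
qed

end

section \<open>Finite modules and their presentations\<close>

lemma (in module) finite_module_presentation:
  assumes "finite (carrier M)" shows "\<exists>t f. presentation R M t f"
proof -
  define t where "t = card (carrier M)"
  obtain m where m: "bij_betw m {..<t} (carrier M)"
    using ex_bij_betw_nat_finite[OF assms] by (auto simp: t_def atLeast0LessThan)
  have mc: "m i \<in> carrier M" if "i < t" for i using m that by (auto simp: bij_betw_def)
  define f where "f v = (\<Oplus>\<^bsub>M\<^esub>i\<in>{..<t}. v i \<odot>\<^bsub>M\<^esub> m i)" for v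
  have "presentation R M t f" unfolding presentation_def mod_hom_def
  proof (intro conjI CollectI ballI)
    have vc: "v i \<in> carrier R" if "v \<in> carrier (free_module R t)" "i < t" for v i
      using that by (auto simp: free_module_def)
    show "f \<in> carrier (free_module R t) \<rightarrow> carrier M"
      using vc mc by (auto simp: f_def intro!: M.finsum_closed)
    show "f (u \<oplus>\<^bsub>free_module R t\<^esub> v) = f u \<oplus>\<^bsub>M\<^esub> f v"
      if u: "u \<in> carrier (free_module R t)" and v: "v \<in> carrier (free_module R t)" for u v
    proof -
      have "f (u \<oplus>\<^bsub>free_module R t\<^esub> v) = (\<Oplus>\<^bsub>M\<^esub>i\<in>{..<t}. u i \<odot>\<^bsub>M\<^esub> m i \<oplus>\<^bsub>M\<^esub> v i \<odot>\<^bsub>M\<^esub> m i)"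
        unfolding f_def using vc[OF u] vc[OF v] mc
        by (intro M.finsum_cong') (auto simp: free_module_def smult_l_distr)
      also have "\<dots> = f u \<oplus>\<^bsub>M\<^esub> f v"
        unfolding f_def using vc[OF u] vc[OF v] mc by (intro M.finsum_addf) auto
      finally show ?thesis .
    qed
    show "f (a \<odot>\<^bsub>free_module R t\<^esub> v) = a \<odot>\<^bsub>M\<^esub> f v"
      if a: "a \<in> carrier R" and v: "v \<in> carrier (free_module R t)" for a v
    proof -
      have "f (a \<odot>\<^bsub>free_module R t\<^esub> v) = (\<Oplus>\<^bsub>M\<^esub>i\<in>{..<t}. a \<odot>\<^bsub>M\<^esub> (v i \<odot>\<^bsub>M\<^esub> m i))"
        unfolding f_def using vc[OF v] mc a
        by (intro M.finsum_cong') (auto simp: free_module_def smult_assoc1)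
      also have "\<dots> = a \<odot>\<^bsub>M\<^esub> f v"
        unfolding f_def using vc[OF v] mc a by (intro finsum_smult_ldistr[symmetric]) auto
      finally show ?thesis .
    qed
    show "f ` carrier (free_module R t) = carrier M"
    proof
      show "f ` carrier (free_module R t) \<subseteq> carrier M"
        using vc mc by (auto simp: f_def intro!: M.finsum_closed)
      show "carrier M \<subseteq> f ` carrier (free_module R t)"
      proof
        fix b assume "b \<in> carrier M"
        then obtain j where j: "j < t" "b = m j" using m by (auto simp: bij_betw_def)
        define v where "v = (\<lambda>i\<in>{..<t}. if i = j then \<one> else \<zero>)"
        have "f v = (\<Oplus>\<^bsub>M\<^esub>i\<in>{..<t}. if j = i then m i else \<zero>\<^bsub>M\<^esub>)"
          unfolding f_def v_def using mc by (intro M.finsum_cong') auto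
        also have "\<dots> = m j" using j mc by (intro M.finsum_singleton) auto
        finally have "f v = b" using j by simp
        moreover have "v \<in> carrier (free_module R t)" by (auto simp: v_def free_module_def)
        ultimately show "b \<in> f ` carrier (free_module R t)" by blast
      qed
    qed
  qed
  then show ?thesis by blast
qed

lemma (in cring) det_cong:
  assumes "\<And>i j. i < t \<Longrightarrow> j < t \<Longrightarrow> v i j = w i j" "\<And>i j. i < t \<Longrightarrow> j < t \<Longrightarrow> w i j \<in> carrier R"
  shows "Defs.det R t v = Defs.det R t w"
proof -
  have "(\<Otimes>i\<in>{..<t}. v i (\<sigma> i)) = (\<Otimes>i\<in>{..<t}. w i (\<sigma> i))" "(\<Otimes>i\<in>{..<t}. w i (\<sigma> i)) \<in> carrier R"
    if "\<sigma> permutes {..<t}" for \<sigma>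
    using assms permutes_in_image[OF that] by (auto intro!: finprod_cong' finprod_closed)
  then show ?thesis unfolding Defs.det_def
    by (intro finsum_cong') auto
qed

text \<open>A presentation \<open>f\<close> of a module over \<open>R\<close> is lifted to the ambient ring: \<open>relations\<close> is the kernel of the
  composite from the function space to the module.\<close>

locale lifted_module = lifted_cring R + module R M for R :: "'a ring" (structure) and M (structure) +
  fixes t :: nat and f :: "(nat \<Rightarrow> 'a) \<Rightarrow> _"
  assumes pres: "presentation R M t f"
begin

definition "lift v = (\<lambda>i\<in>{..<t}. \<phi> (v i))"
definition "relations = {v. f (lift v) = \<zero>\<^bsub>M\<^esub>}"

lemma lift_closed: "lift v \<in> carrier (free_module R t)"
  by (auto simp: lift_def free_module_def)

lemma lift_surj: "w \<in> carrier (free_module R t) \<Longrightarrow> \<exists>v. lift v = w"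
proof -
  assume w: "w \<in> carrier (free_module R t)"
  then have "\<forall>i\<in>{..<t}. \<exists>a. \<phi> a = w i" using \<phi>_surj by (auto simp: free_module_def)
  from bchoice[OF this] obtain v where v: "\<And>i. i < t \<Longrightarrow> \<phi> (v i) = w i" by auto
  have "lift v = w" using w v by (auto simp: lift_def free_module_def fun_eq_iff PiE_def extensional_def)
  then show ?thesis by blast
qed

lemma f_closed: "f (lift v) \<in> carrier M"
  using pres lift_closed unfolding presentation_def by blast

lemma f_add: "f (lift (u + v)) = f (lift u) \<oplus>\<^bsub>M\<^esub> f (lift v)"
proof -
  have "lift (u + v) = lift u \<oplus>\<^bsub>free_module R t\<^esub> lift v"
    by (auto simp: lift_def free_module_def fun_eq_iff)
  then show ?thesis using pres lift_closed unfolding presentation_def mod_hom_def by auto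
qed

lemma f_scale: "f (lift (a *v v)) = \<phi> a \<odot>\<^bsub>M\<^esub> f (lift v)"
proof -
  have "lift (a *v v) = \<phi> a \<odot>\<^bsub>free_module R t\<^esub> lift v"
    by (auto simp: lift_def free_module_def fun_eq_iff)
  then show ?thesis using pres lift_closed unfolding presentation_def mod_hom_def by auto
qed

lemma f_zero: "f (lift 0) = \<zero>\<^bsub>M\<^esub>"
  using f_scale[of 0 0] f_closed by (simp add: scale_vec_def zero_fun_def)

lemma relations_submodule: "submodule_set relations"
  unfolding submodule_set_def relations_def
  by (auto simp: f_add f_scale f_zero)

lemma f_diff_iff: "f (lift u) = f (lift v) \<longleftrightarrow> u - v \<in> relations"
proof -
  have "f (lift u) = f (lift ((u - v) + v))" by simp
  also have "\<dots> = f (lift (u - v)) \<oplus>\<^bsub>M\<^esub> f (lift v)" by (rule f_add)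
  finally show ?thesis unfolding relations_def using f_closed
    by (metis (mono_tags) M.add.l_cancel_one mem_Collect_eq M.a_comm M.zero_closed M.l_zero M.add.m_closed M.add.right_cancel)
qed

lemma vec_ker_relations: "vec_in t ker \<subseteq> relations"
proof
  fix v assume "v \<in> vec_in t ker"
  then have "lift v = lift 0" by (auto simp: lift_def vec_in_def ker_def fun_eq_iff)
  then show "v \<in> relations" using f_zero by (simp add: relations_def)
qed

lemma index_relations: "subgroup_index UNIV relations = card (carrier M)"
proof -
  have "subgroup_index UNIV relations = card (range (\<lambda>v. f (lift v)))"
    by (rule subgroup_index_eq_card) (simp_all add: submodule_set_subgroup relations_submodule f_diff_iff)
  also have "range (\<lambda>v. f (lift v)) = carrier M"
  proof
    show "carrier M \<subseteq> range (\<lambda>v. f (lift v))"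
    proof
      fix b assume "b \<in> carrier M"
      then obtain w where "w \<in> carrier (free_module R t)" "b = f w" using pres unfolding presentation_def by blast
      then show "b \<in> range (\<lambda>v. f (lift v))" using lift_surj by blast
    qed
  qed (use f_closed in blast)
  finally show ?thesis .
qed

lemma presentation_dets:
  "{Defs.det R t v | v. \<forall>i<t. v i \<in> carrier (free_module R t) \<and> f (v i) = \<zero>\<^bsub>M\<^esub>}
    = {\<phi> (det_rows t v) | v. \<forall>i<t. v i \<in> relations}" (is "?S = _")
proof -
  have det_lift: "Defs.det R t (\<lambda>i. lift (v i)) = \<phi> (det_rows t v)" for v
    unfolding \<phi>_det by (rule det_cong) (auto simp: lift_def)
  show "?S = {\<phi> (det_rows t v) | v. \<forall>i<t. v i \<in> relations}"
  proof
    show "?S \<subseteq> {\<phi> (det_rows t v) | v. \<forall>i<t. v i \<in> relations}"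
    proof
      fix d assume "d \<in> ?S"
      then obtain v where v: "d = Defs.det R t v" "\<And>i. i < t \<Longrightarrow> v i \<in> carrier (free_module R t) \<and> f (v i) = \<zero>\<^bsub>M\<^esub>"
        by blast
      have "\<forall>i\<in>{..<t}. \<exists>w. lift w = v i" using v(2) lift_surj by blast
      from bchoice[OF this] obtain w where w: "\<And>i. i < t \<Longrightarrow> lift (w i) = v i" by auto
      have "d = Defs.det R t (\<lambda>i. lift (w i))"
        unfolding v(1) by (rule det_cong) (auto simp: w lift_def simp flip: w)
      moreover have "\<forall>i<t. w i \<in> relations" using v(2) w by (simp add: relations_def)
      ultimately show "d \<in> {\<phi> (det_rows t v) | v. \<forall>i<t. v i \<in> relations}" unfolding det_lift by blast
    qed
    show "{\<phi> (det_rows t v) | v. \<forall>i<t. v i \<in> relations} \<subseteq> ?S"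
    proof
      fix d assume "d \<in> {\<phi> (det_rows t v) | v. \<forall>i<t. v i \<in> relations}"
      then obtain v where v: "d = \<phi> (det_rows t v)" "\<forall>i<t. v i \<in> relations" by blast
      then have "d = Defs.det R t (\<lambda>i. lift (v i))" by (simp add: det_lift)
      moreover have "\<forall>i<t. lift (v i) \<in> carrier (free_module R t) \<and> f (lift (v i)) = \<zero>\<^bsub>M\<^esub>"
        using v(2) lift_closed by (simp add: relations_def)
      ultimately show "d \<in> ?S" by (intro CollectI exI[of _ "\<lambda>i. lift (v i)"]) simp
    qed
  qed
qed

lemma preimage_presentation_ideal: "{a. \<phi> a \<in> presentation_ideal R M t f} = fitting ker t relations"
  unfolding presentation_ideal_def
proof (rule preimage_genideal)
  let ?S = "{Defs.det R t v | v. \<forall>i<t. v i \<in> carrier (free_module R t) \<and> f (v i) = \<zero>\<^bsub>M\<^esub>}"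
  note S = presentation_dets
  show "?S \<subseteq> carrier R" unfolding S by auto
  show "ideal_set (fitting ker t relations)" "ker \<subseteq> fitting ker t relations"
    by (rule fitting_ideal_set fitting_superset)+
  show "a \<in> fitting ker t relations" if a: "\<phi> a \<in> ?S" for a
  proof -
    obtain v where v: "\<phi> a = \<phi> (det_rows t v)" "\<forall>i<t. v i \<in> relations" using a unfolding S by blast
    have "a - det_rows t v \<in> fitting ker t relations"
      using v(1) fitting_superset[of ker t relations] diff_ker_iff by blast
    moreover have "det_rows t v \<in> fitting ker t relations" using v(2) by (intro det_in_fitting) simp
    ultimately show ?thesis using ideal_cong_iff[OF fitting_ideal_set, of a "det_rows t v"] by blast
  qed
  show "fitting ker t relations \<subseteq> J" if J: "ideal_set J" "ker \<subseteq> J" "{a. \<phi> a \<in> ?S} \<subseteq> J" for J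
    using J(3) unfolding S by (intro fitting_least J) blast
qed

lemma presentation_ideal_is_ideal: "ideal (presentation_ideal R M t f) R"
  unfolding presentation_ideal_def presentation_dets by (rule genideal_ideal) auto

text \<open>The orders of the module and of the quotient by its Fitting ideal are the indices of \<open>relations\<close> and
  of its Fitting ideal in the ambient ring.\<close>

theorem node_fitting:
  assumes node: "node ker x y" and fin: "finite (carrier M)"
  defines "I \<equiv> presentation_ideal R M t f"
  shows "card (carrier M) \<le> card (carrier (R Quot I)) \<and>
    (principalideal I R \<longrightarrow> card (carrier M) = card (carrier (R Quot I)))"
proof -
  interpret node ker x y by fact
  have "carrier M \<noteq> {}" by blast
  then have n0: "subgroup_index UNIV relations \<noteq> 0" using fin by (simp add: index_relations)
  note main = index_le_fitting_index[OF relations_submodule vec_ker_relations n0]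
  have eq: "card (carrier (R Quot I)) = subgroup_index UNIV (fitting ker t relations)"
    using index_preimage[OF presentation_ideal_is_ideal] by (simp add: preimage_presentation_ideal I_def)
  have "card (carrier M) = card (carrier (R Quot I))" if pI: "principalideal I R"
  proof -
    obtain d where d: "d \<in> carrier R" "I = Idl {d}" using principalideal.generate[OF pI] by blast
    obtain d' where d': "\<phi> d' = d" using \<phi>_surj d by blast
    have "fitting ker t relations = principal_mod ker d'"
    proof -
      have "fitting ker t relations = {a. \<phi> a \<in> PIdl d}"
        using preimage_presentation_ideal d by (simp add: I_def cgenideal_eq_genideal)
      also have "\<dots> = principal_mod ker d'"
      proof (intro Set.set_eqI iffI)
        fix a assume "a \<in> {a. \<phi> a \<in> PIdl d}"
        then obtain r where "r \<in> carrier R" "\<phi> a = r \<otimes> d" by (auto simp: cgenideal_def)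
        moreover from this obtain r' where "\<phi> r' = r" using \<phi>_surj by blast
        ultimately have "\<phi> a = \<phi> (d' * r')" using d' d(1) m_comm[of r d] by simp
        then show "a \<in> principal_mod ker d'" using diff_ker_iff by (auto simp: principal_mod_def)
      next
        fix a assume "a \<in> principal_mod ker d'"
        then obtain r where "\<phi> a = \<phi> (d' * r)" using diff_ker_iff by (auto simp: principal_mod_def)
        then show "a \<in> {a. \<phi> a \<in> PIdl d}" using d' d(1) by (auto simp: cgenideal_def intro!: exI[of _ "\<phi> r"] m_comm)
      qed
      finally show ?thesis .
    qed
    from main(2)[OF this] show ?thesis by (simp add: eq index_relations)
  qed
  then show ?thesis using main(1) by (simp add: eq index_relations)
qed

end

text \<open>The choice in the definition of the Fitting ideal selects a presentation as soon as there is one.\<close>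

lemma fitting_ideal_eq_presentation_ideal:
  assumes "\<exists>t f. presentation R M t f"
  obtains t f where "presentation R M t f" "fitting_ideal R M = presentation_ideal R M t f"
proof -
  obtain t f where tf: "(SOME (t, f). presentation R M t f) = (t, f)" by fastforce
  have "case (SOME (t, f). presentation R M t f) of (t, f) \<Rightarrow> presentation R M t f"
    using assms by (intro someI_ex[of "\<lambda>(t, f). presentation R M t f"]) auto
  then show ?thesis using that tf by (simp add: fitting_ideal_def)
qed

theorem fitting_index_of_node:
  fixes R :: "'a ring"
  assumes "module R M" and fin: "finite (carrier M)" and node: "node (lifted_cring.ker R) x y"
  shows "card (carrier M) \<le> card (carrier (R Quot fitting_ideal R M)) \<and>
    (principalideal (fitting_ideal R M) R \<longrightarrow> card (carrier M) = card (carrier (R Quot fitting_ideal R M)))"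
proof -
  interpret module R M by fact
  interpret lifted_cring R by unfold_locales
  obtain t f where tf: "presentation R M t f" "fitting_ideal R M = presentation_ideal R M t f"
    using fitting_ideal_eq_presentation_ideal finite_module_presentation[OF fin] by blast
  interpret lifted_module R M t f by unfold_locales (rule tf)
  show ?thesis using node_fitting[OF node fin] by (simp add: tf(2))
qed

section \<open>Structure of the group ring\<close>

lemma (in group) prime_order_generator:
  assumes p: "Factorial_Ring.prime (order G)"
  obtains \<sigma> where "\<sigma> \<in> carrier G" "\<sigma> [^] order G = \<one>"
    "bij_betw (\<lambda>k. \<sigma> [^] k) {..<order G} (carrier G)"
proof -
  have p1: "1 < order G" using p by (rule prime_gt_1_nat)
  then have fin: "finite (carrier G)" by (intro card_ge_0_finite) (simp add: order_def)
  obtain \<sigma> where \<sigma>: "\<sigma> \<in> carrier G" "\<sigma> \<noteq> \<one>"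
  proof -
    have "\<not> carrier G \<subseteq> {\<one>}"
    proof
      assume "carrier G \<subseteq> {\<one>}"
      then have "card (carrier G) \<le> card {\<one>}" by (intro card_mono) auto
      then show False using p1 by (simp add: order_def)
    qed
    then show thesis using that by blast
  qed
  have "ord \<sigma> dvd order G" using \<sigma> by (intro ord_dvd_group_order)
  moreover have "ord \<sigma> \<noteq> 1" using \<sigma> ord_eq_1 by blast
  ultimately have o: "ord \<sigma> = order G" using p by (auto simp: prime_nat_iff)
  have inj: "inj_on (\<lambda>k. \<sigma> [^] k) {..<order G}"
  proof -
    have "{..<order G} = {0..ord \<sigma> - 1}" using p1 o by auto
    then show ?thesis using ord_inj[OF \<sigma>(1)] by simp
  qed
  have "(\<lambda>k. \<sigma> [^] k) ` {..<order G} = carrier G"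
    using inj \<sigma> fin by (intro card_subset_eq) (auto simp: card_image order_def)
  then show thesis using that[of \<sigma>] \<sigma> inj o pow_ord_eq_1[OF \<sigma>(1)] by (simp add: bij_betw_def)
qed

text \<open>The coefficient ring is a discrete valuation ring with uniformizer \<open>p\<close>.\<close>

locale group_ring_prime_order = A: cring A + C: group C + R: cring "group_ring A C"
  for A :: "('a, 'm) ring_scheme" and C :: "('g, 'n) monoid_scheme" +
  fixes p :: nat
  assumes p: "Factorial_Ring.prime p" and order_C: "order C = p"
    and dvr: "a \<in> carrier A \<Longrightarrow> a \<noteq> \<zero>\<^bsub>A\<^esub> \<Longrightarrow> \<exists>k::nat. \<exists>u\<in>carrier A. \<exists>v\<in>carrier A.
       a = ([p] \<cdot>\<^bsub>A\<^esub> \<one>\<^bsub>A\<^esub>) [^]\<^bsub>A\<^esub> k \<otimes>\<^bsub>A\<^esub> u \<and> u \<otimes>\<^bsub>A\<^esub> v = \<one>\<^bsub>A\<^esub>"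
    and p_nonunit: "a \<in> carrier A \<Longrightarrow> [p] \<cdot>\<^bsub>A\<^esub> \<one>\<^bsub>A\<^esub> \<otimes>\<^bsub>A\<^esub> a \<noteq> \<one>\<^bsub>A\<^esub>"
    and p_power: "([p] \<cdot>\<^bsub>A\<^esub> \<one>\<^bsub>A\<^esub>) [^]\<^bsub>A\<^esub> (k::nat) \<noteq> \<zero>\<^bsub>A\<^esub>"
begin

abbreviation "R \<equiv> group_ring A C"
abbreviation "\<pi> \<equiv> [p] \<cdot>\<^bsub>A\<^esub> \<one>\<^bsub>A\<^esub>"

sublocale L: lifted_cring R by unfold_locales

definition "emb c = (\<lambda>g\<in>carrier C. if g = \<one>\<^bsub>C\<^esub> then c else \<zero>\<^bsub>A\<^esub>)"
definition "delta h = (\<lambda>g\<in>carrier C. if g = h then \<one>\<^bsub>A\<^esub> else \<zero>\<^bsub>A\<^esub>)"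

lemma one_not_zero: "\<one>\<^bsub>A\<^esub> \<noteq> \<zero>\<^bsub>A\<^esub>" using p_power[of 0] by simp

lemma finite_C: "finite (carrier C)"
  using prime_gt_0_nat[OF p] order_C by (intro card_ge_0_finite) (simp add: order_def)

lemma carrier_R: "carrier R = carrier C \<rightarrow>\<^sub>E carrier A"
  using finite_C by (auto simp: group_ring_def)

lemma emb_closed: "c \<in> carrier A \<Longrightarrow> emb c \<in> carrier R"
  by (auto simp: carrier_R emb_def)

lemma delta_closed: "delta h \<in> carrier R" by (auto simp: carrier_R delta_def)

lemma R_zero: "\<zero>\<^bsub>R\<^esub> = (\<lambda>g\<in>carrier C. \<zero>\<^bsub>A\<^esub>)" by (simp add: group_ring_def)
lemma R_one: "\<one>\<^bsub>R\<^esub> = delta \<one>\<^bsub>C\<^esub>" by (simp add: group_ring_def delta_def)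
lemma R_add: "f \<oplus>\<^bsub>R\<^esub> h = (\<lambda>g\<in>carrier C. f g \<oplus>\<^bsub>A\<^esub> h g)" by (simp add: group_ring_def)

lemma emb_one: "emb \<one>\<^bsub>A\<^esub> = \<one>\<^bsub>R\<^esub>" by (simp add: emb_def R_one delta_def)
lemma emb_zero: "emb \<zero>\<^bsub>A\<^esub> = \<zero>\<^bsub>R\<^esub>" by (simp add: emb_def R_zero cong: restrict_cong)
lemma emb_add: "c \<in> carrier A \<Longrightarrow> d \<in> carrier A \<Longrightarrow> emb (c \<oplus>\<^bsub>A\<^esub> d) = emb c \<oplus>\<^bsub>R\<^esub> emb d"
  by (auto simp: emb_def R_add fun_eq_iff)

lemma emb_inj: assumes "emb c = emb d" shows "c = d"
proof -
  have "c = emb c \<one>\<^bsub>C\<^esub>" by (simp add: emb_def)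
  also have "\<dots> = emb d \<one>\<^bsub>C\<^esub>" by (simp only: assms)
  also have "\<dots> = d" by (simp add: emb_def)
  finally show ?thesis .
qed

lemma emb_mult_eq:
  assumes c: "c \<in> carrier A" and f: "f \<in> carrier R"
  shows "emb c \<otimes>\<^bsub>R\<^esub> f = (\<lambda>g\<in>carrier C. c \<otimes>\<^bsub>A\<^esub> f g)"
proof -
  have fc: "f g \<in> carrier A" if "g \<in> carrier C" for g using f that by (auto simp: carrier_R)
  have "(\<Oplus>\<^bsub>A\<^esub>x\<in>{x \<in> carrier C. emb c x \<noteq> \<zero>\<^bsub>A\<^esub>}. emb c x \<otimes>\<^bsub>A\<^esub> f (inv\<^bsub>C\<^esub> x \<otimes>\<^bsub>C\<^esub> g)) = c \<otimes>\<^bsub>A\<^esub> f g"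
    if g: "g \<in> carrier C" for g
  proof (cases "c = \<zero>\<^bsub>A\<^esub>")
    case True
    have "{x \<in> carrier C. emb c x \<noteq> \<zero>\<^bsub>A\<^esub>} = {}" by (auto simp: emb_def True)
    then show ?thesis using fc[OF g] by (simp only: A.finsum_empty) (simp add: True)
  next
    case False
    have "{x \<in> carrier C. emb c x \<noteq> \<zero>\<^bsub>A\<^esub>} = {\<one>\<^bsub>C\<^esub>}" using False by (auto simp: emb_def)
    then show ?thesis using fc g c by (simp add: emb_def)
  qed
  then show ?thesis by (auto simp: group_ring_def intro: restrict_ext)
qed

lemma delta_mult_eq:
  assumes h: "h \<in> carrier C" and f: "f \<in> carrier R"
  shows "delta h \<otimes>\<^bsub>R\<^esub> f = (\<lambda>g\<in>carrier C. f (inv\<^bsub>C\<^esub> h \<otimes>\<^bsub>C\<^esub> g))"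
proof -
  have fc: "f g \<in> carrier A" if "g \<in> carrier C" for g using f that by (auto simp: carrier_R)
  have s: "{x \<in> carrier C. delta h x \<noteq> \<zero>\<^bsub>A\<^esub>} = {h}" using h one_not_zero by (auto simp: delta_def)
  have "(\<Oplus>\<^bsub>A\<^esub>x\<in>{x \<in> carrier C. delta h x \<noteq> \<zero>\<^bsub>A\<^esub>}. delta h x \<otimes>\<^bsub>A\<^esub> f (inv\<^bsub>C\<^esub> x \<otimes>\<^bsub>C\<^esub> g)) = f (inv\<^bsub>C\<^esub> h \<otimes>\<^bsub>C\<^esub> g)"
    if g: "g \<in> carrier C" for g
    unfolding s using h g fc by (simp add: delta_def)
  then show ?thesis by (auto simp: group_ring_def intro: restrict_ext)
qed

lemma emb_mult: "c \<in> carrier A \<Longrightarrow> d \<in> carrier A \<Longrightarrow> emb (c \<otimes>\<^bsub>A\<^esub> d) = emb c \<otimes>\<^bsub>R\<^esub> emb d"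
  by (subst emb_mult_eq) (auto simp: emb_closed, auto simp: emb_def fun_eq_iff)

lemma delta_mult:
  "h \<in> carrier C \<Longrightarrow> h' \<in> carrier C \<Longrightarrow> delta h \<otimes>\<^bsub>R\<^esub> delta h' = delta (h \<otimes>\<^bsub>C\<^esub> h')"
  by (subst delta_mult_eq)
     (auto simp: delta_closed, auto simp: delta_def fun_eq_iff C.m_assoc[symmetric] C.inv_solve_left')

lemma R_finsum_apply:
  assumes "finite S" "\<And>i. i \<in> S \<Longrightarrow> F i \<in> carrier R" "g \<in> carrier C"
  shows "(\<Oplus>\<^bsub>R\<^esub>i\<in>S. F i) g = (\<Oplus>\<^bsub>A\<^esub>i\<in>S. F i g)"
  using assms(1,2)
proof (induction S rule: finite_induct)
  case empty
  then show ?case using assms(3) by (simp add: R_zero)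
next
  case (insert i S)
  have "F j g \<in> carrier A" if "j \<in> insert i S" for j
    using insert.prems[OF that] assms(3) by (auto simp: carrier_R)
  then show ?case using insert assms(3) by (simp add: R_add Pi_def)
qed

definition "scalars = {a. \<exists>c\<in>carrier A. L.\<phi> a = emb c}"

lemma scalarE: assumes "a \<in> scalars" obtains c where "c \<in> carrier A" "L.\<phi> a = emb c"
  using assms by (auto simp: scalars_def)

lemma \<phi>_of_nat: "L.\<phi> (of_nat n) = emb ([n] \<cdot>\<^bsub>A\<^esub> \<one>\<^bsub>A\<^esub>)"
proof (induction n)
  case 0
  then show ?case by (simp add: emb_zero)
next
  case (Suc n)
  have "L.\<phi> (of_nat (Suc n)) = \<one>\<^bsub>R\<^esub> \<oplus>\<^bsub>R\<^esub> emb ([n] \<cdot>\<^bsub>A\<^esub> \<one>\<^bsub>A\<^esub>)" using Suc by simp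
  also have "\<dots> = emb (\<one>\<^bsub>A\<^esub> \<oplus>\<^bsub>A\<^esub> [n] \<cdot>\<^bsub>A\<^esub> \<one>\<^bsub>A\<^esub>)" by (simp add: emb_add emb_one)
  also have "\<one>\<^bsub>A\<^esub> \<oplus>\<^bsub>A\<^esub> [n] \<cdot>\<^bsub>A\<^esub> \<one>\<^bsub>A\<^esub> = [Suc n] \<cdot>\<^bsub>A\<^esub> \<one>\<^bsub>A\<^esub>" by (simp add: A.add.nat_pow_Suc A.a_comm)
  finally show ?case .
qed

lemma \<phi>_p_power: "L.\<phi> (of_nat p ^ k) = emb (\<pi> [^]\<^bsub>A\<^esub> k)"
proof (induction k)
  case 0
  then show ?case by (simp add: emb_one)
next
  case (Suc k)
  have "L.\<phi> (of_nat p ^ Suc k) = emb (\<pi> \<otimes>\<^bsub>A\<^esub> \<pi> [^]\<^bsub>A\<^esub> k)" using Suc by (simp add: \<phi>_of_nat emb_mult)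
  then show ?case by (simp add: A.m_comm)
qed

text \<open>An element of the group ring is the sum of its coefficients times the powers of a generator;
  evaluation at these powers recovers the coefficients.\<close>

theorem lifted_cyclic_group_ring: "\<exists>s. cyclic_group_ring L.ker scalars s p"
proof -
  obtain \<sigma> where \<sigma>: "\<sigma> \<in> carrier C" "\<sigma> [^]\<^bsub>C\<^esub> p = \<one>\<^bsub>C\<^esub>"
    and bij: "bij_betw (\<lambda>k. \<sigma> [^]\<^bsub>C\<^esub> k) {..<p} (carrier C)"
    using C.prime_order_generator p order_C by metis
  obtain s where s: "L.\<phi> s = delta \<sigma>" using L.\<phi>_surj delta_closed by blast
  have s_pow: "L.\<phi> (s ^ k) = delta (\<sigma> [^]\<^bsub>C\<^esub> k)" for k
  proof (induction k)
    case 0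
    then show ?case by (simp add: R_one)
  next
    case (Suc k)
    then show ?case using \<sigma>(1) C.nat_pow_Suc2[OF \<sigma>(1), of k] by (simp add: s delta_mult)
  qed
  have coeff: "L.\<phi> (\<Sum>k<p. a k * s ^ k) (\<sigma> [^]\<^bsub>C\<^esub> j) = c j"
    if j: "j < p" and a: "\<And>k. k < p \<Longrightarrow> c k \<in> carrier A \<and> L.\<phi> (a k) = emb (c k)" for a c j
  proof -
    have g: "\<sigma> [^]\<^bsub>C\<^esub> j \<in> carrier C" using \<sigma> by simp
    have "L.\<phi> (\<Sum>k<p. a k * s ^ k) (\<sigma> [^]\<^bsub>C\<^esub> j) = (\<Oplus>\<^bsub>A\<^esub>k\<in>{..<p}. L.\<phi> (a k * s ^ k) (\<sigma> [^]\<^bsub>C\<^esub> j))"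
      unfolding L.\<phi>_sum using g by (intro R_finsum_apply) auto
    also have "\<dots> = (\<Oplus>\<^bsub>A\<^esub>k\<in>{..<p}. if j = k then c k else \<zero>\<^bsub>A\<^esub>)"
    proof (intro A.finsum_cong' refl)
      fix k assume "k \<in> {..<p}"
      then have k: "k < p" by simp
      have "\<sigma> [^]\<^bsub>C\<^esub> j = \<sigma> [^]\<^bsub>C\<^esub> k \<longleftrightarrow> j = k" using bij j k by (auto simp: bij_betw_def inj_on_def)
      then show "L.\<phi> (a k * s ^ k) (\<sigma> [^]\<^bsub>C\<^esub> j) = (if j = k then c k else \<zero>\<^bsub>A\<^esub>)"
        using a[OF k] g \<sigma>(1) by (simp add: s_pow emb_mult_eq delta_closed) (simp add: delta_def)
    qed (use a in auto)
    also have "\<dots> = c j" using j a by (intro A.finsum_singleton) auto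
    finally show ?thesis .
  qed
  have kerI: "a - b \<in> L.ker \<longleftrightarrow> L.\<phi> a = L.\<phi> b" for a b by (rule L.diff_ker_iff)
  have ker0: "a \<in> L.ker \<longleftrightarrow> L.\<phi> a = \<zero>\<^bsub>R\<^esub>" for a by (simp add: L.ker_def)
  have emb_lift: "\<exists>a\<in>scalars. L.\<phi> a = emb c" if "c \<in> carrier A" for c
    using L.\<phi>_surj[OF emb_closed[OF that]] that by (auto simp: scalars_def)
  have "cyclic_group_ring L.ker scalars s p"
  proof
    show "ideal_set L.ker" by (rule L.ker_ideal)
    show "Factorial_Ring.prime p" by (rule p)
    show "1 \<in> scalars" by (auto simp: scalars_def emb_one intro: bexI[of _ "\<one>\<^bsub>A\<^esub>"])
    fix a assume "a \<in> scalars"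
    then obtain c where c: "c \<in> carrier A" "L.\<phi> a = emb c" by (rule scalarE)
    show "- a \<in> scalars"
    proof -
      have "L.\<phi> (- a) = emb (\<ominus>\<^bsub>A\<^esub> c)"
      proof -
        have "emb (\<ominus>\<^bsub>A\<^esub> c) \<oplus>\<^bsub>R\<^esub> emb c = \<zero>\<^bsub>R\<^esub>"
          using c by (simp flip: emb_add emb_zero add: A.l_neg)
        then show ?thesis using c emb_closed by (simp add: R.minus_equality)
      qed
      then show ?thesis using c by (auto simp: scalars_def)
    qed
    show "of_nat p * a - 1 \<notin> L.ker"
    proof
      assume "of_nat p * a - 1 \<in> L.ker"
      then have "emb (\<pi> \<otimes>\<^bsub>A\<^esub> c) = emb \<one>\<^bsub>A\<^esub>"
        using c by (simp add: kerI \<phi>_of_nat emb_mult emb_one)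
      then show False using p_nonunit[OF c(1)] emb_inj by blast
    qed
    show "\<exists>k. \<exists>u\<in>scalars. \<exists>v\<in>scalars. a - of_nat p ^ k * u \<in> L.ker \<and> u * v - 1 \<in> L.ker" if "a \<notin> L.ker"
    proof -
      have "c \<noteq> \<zero>\<^bsub>A\<^esub>" using that c by (auto simp: ker0 emb_zero)
      then obtain k :: nat and u v where u: "u \<in> carrier A" "v \<in> carrier A" "c = \<pi> [^]\<^bsub>A\<^esub> k \<otimes>\<^bsub>A\<^esub> u" "u \<otimes>\<^bsub>A\<^esub> v = \<one>\<^bsub>A\<^esub>"
        using dvr c(1) by blast
      obtain u' v' where u': "u' \<in> scalars" "L.\<phi> u' = emb u" and v': "v' \<in> scalars" "L.\<phi> v' = emb v"
        using emb_lift u by blast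
      have "a - of_nat p ^ k * u' \<in> L.ker"
        unfolding kerI using c u u' by (simp add: \<phi>_p_power emb_mult)
      moreover have "u' * v' - 1 \<in> L.ker"
        unfolding kerI using u u' v' by (simp add: emb_one flip: emb_mult)
      ultimately show ?thesis using u'(1) v'(1) by blast
    qed
    fix b assume "b \<in> scalars"
    then obtain d where d: "d \<in> carrier A" "L.\<phi> b = emb d" by (rule scalarE)
    show "a + b \<in> scalars" using c d unfolding scalars_def
      by (intro CollectI bexI[of _ "c \<oplus>\<^bsub>A\<^esub> d"]) (simp_all add: emb_add)
    show "a * b \<in> scalars" using c d unfolding scalars_def
      by (intro CollectI bexI[of _ "c \<otimes>\<^bsub>A\<^esub> d"]) (simp_all add: emb_mult)
  next
    show "of_nat p ^ k \<notin> L.ker" for k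
    proof
      assume "of_nat p ^ k \<in> L.ker"
      then have "emb (\<pi> [^]\<^bsub>A\<^esub> k) = emb \<zero>\<^bsub>A\<^esub>" by (simp add: ker0 \<phi>_p_power emb_zero)
      then show False using p_power emb_inj by blast
    qed
    show "s ^ p - 1 \<in> L.ker" unfolding kerI s_pow \<sigma>(2) by (simp add: R_one)
    show "\<exists>a. (\<forall>k<p. a k \<in> scalars) \<and> r - (\<Sum>k<p. a k * s ^ k) \<in> L.ker" for r
    proof -
      define c where "c k = L.\<phi> r (\<sigma> [^]\<^bsub>C\<^esub> k)" for k :: nat
      have c: "c k \<in> carrier A" for k
        using L.\<phi>_closed[of r] \<sigma>(1) unfolding c_def carrier_R by auto
      have "\<forall>k\<in>{..<p}. \<exists>a. a \<in> scalars \<and> L.\<phi> a = emb (c k)" using emb_lift[OF c] by blast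
      from bchoice[OF this] obtain a where a: "\<And>k. k < p \<Longrightarrow> a k \<in> scalars" "\<And>k. k < p \<Longrightarrow> L.\<phi> (a k) = emb (c k)" by auto
      have "L.\<phi> r = L.\<phi> (\<Sum>k<p. a k * s ^ k)"
      proof (rule PiE_ext)
        show "L.\<phi> r \<in> carrier C \<rightarrow>\<^sub>E carrier A" "L.\<phi> (\<Sum>k<p. a k * s ^ k) \<in> carrier C \<rightarrow>\<^sub>E carrier A"
          using L.\<phi>_closed unfolding carrier_R by blast+
        fix g assume "g \<in> carrier C"
        then obtain j where j: "j < p" "g = \<sigma> [^]\<^bsub>C\<^esub> j" using bij by (auto simp: bij_betw_def)
        show "L.\<phi> r g = L.\<phi> (\<Sum>k<p. a k * s ^ k) g"
          unfolding j(2) by (subst coeff[OF j(1), where c=c]) (use c a in \<open>auto simp: c_def\<close>)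
      qed
      then show ?thesis using a(1) kerI by blast
    qed
    show "c k \<in> L.ker" if c: "\<And>k. k < p \<Longrightarrow> c k \<in> scalars" and sum: "(\<Sum>k<p. c k * s ^ k) \<in> L.ker" and k: "k < p" for c k
    proof -
      have "\<forall>k\<in>{..<p}. \<exists>d. d \<in> carrier A \<and> L.\<phi> (c k) = emb d" using c by (auto simp: scalars_def)
      from bchoice[OF this] obtain d where d: "\<And>k. k < p \<Longrightarrow> d k \<in> carrier A \<and> L.\<phi> (c k) = emb (d k)" by auto
      have "d k = \<zero>\<^bsub>A\<^esub>"
        using coeff[where j=k and c=d and a=c, OF k d] sum \<sigma>(1) by (simp add: ker0 R_zero)
      then show ?thesis using d[OF k] by (simp add: ker0 emb_zero)
    qed
  qed
  then show ?thesis ..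
qed

corollary lifted_node: "\<exists>x y. node L.ker x y"
  using lifted_cyclic_group_ring cyclic_group_ring.is_node by blast

end

section \<open>p-adic numbers\<close>

text \<open>The valuation can be read off from any fraction, not only from the reduced one.\<close>

lemma padic_val_divide:
  assumes p: "Factorial_Ring.prime p" and a: "a \<noteq> 0" and b: "b \<noteq> 0"
  shows "padic_val p (of_int a / of_int b) = int (multiplicity (int p) a) - int (multiplicity (int p) b)"
proof -
  obtain c d where cd: "quotient_of (of_int a / of_int b) = (c, d)" by fastforce
  have d: "d > 0" using quotient_of_denom_pos[OF cd] .
  have eq: "of_int a / of_int b = (of_int c / of_int d :: rat)" by (rule quotient_of_div[OF cd])
  then have "of_int (a * d) = (of_int (c * b) :: rat)" using b d by (simp add: field_simps)
  then have ad: "a * d = c * b" by (simp only: of_int_eq_iff)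
  then have c: "c \<noteq> 0" using a d by auto
  have P: "prime_elem (int p)" using p by (simp add: prime_imp_prime_elem)
  have "multiplicity (int p) a + multiplicity (int p) d = multiplicity (int p) c + multiplicity (int p) b"
    using ad a b c d prime_elem_multiplicity_mult_distrib[OF P] by (metis less_irrefl)
  then show ?thesis unfolding padic_val_def cd by simp
qed

lemma rat_as_int_fraction: obtains a b where "x = of_int a / (of_int b :: rat)" "b \<noteq> 0"
proof -
  obtain a b where "quotient_of x = (a, b)" by fastforce
  then show ?thesis using that quotient_of_div quotient_of_denom_pos by (metis less_irrefl)
qed

locale padic =
  fixes p :: nat
  assumes p: "Factorial_Ring.prime p"
begin

abbreviation "v \<equiv> padic_val p"
abbreviation nrm :: "rat \<Rightarrow> real" where "nrm \<equiv> padic_abs p"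

lemma p_gt1: "1 < real p" using prime_gt_1_nat[OF p] by simp

lemma prime_int: "prime_elem (int p)" using p by (simp add: prime_imp_prime_elem)

lemma nrm_0 [simp]: "nrm 0 = 0" by (simp add: padic_abs_def)

lemma nrm_nonneg [simp]: "0 \<le> nrm x" using p_gt1 by (simp add: padic_abs_def)

lemma nrm_eq_0 [simp]: "nrm x = 0 \<longleftrightarrow> x = 0" using p_gt1 by (simp add: padic_abs_def)

lemma val_mult: assumes "x \<noteq> 0" "y \<noteq> 0" shows "v (x * y) = v x + v y"
proof -
  obtain a b where x: "x = of_int a / of_int b" "b \<noteq> 0" by (rule rat_as_int_fraction)
  obtain c d where y: "y = of_int c / of_int d" "d \<noteq> 0" by (rule rat_as_int_fraction)
  have ac: "a \<noteq> 0" "c \<noteq> 0" using assms x y by auto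
  have xy: "x * y = of_int (a * c) / of_int (b * d)" using x y by simp
  have "v (x * y) = int (multiplicity (int p) (a * c)) - int (multiplicity (int p) (b * d))"
    unfolding xy using ac x(2) y(2) by (intro padic_val_divide p) auto
  moreover have "v x = int (multiplicity (int p) a) - int (multiplicity (int p) b)"
    unfolding x(1) using ac x(2) by (intro padic_val_divide p)
  moreover have "v y = int (multiplicity (int p) c) - int (multiplicity (int p) d)"
    unfolding y(1) using ac y(2) by (intro padic_val_divide p)
  ultimately show ?thesis using ac x(2) y(2)
    by (simp add: prime_elem_multiplicity_mult_distrib[OF prime_int])
qed

lemma nrm_mult: "nrm (x * y) = nrm x * nrm y"
proof (cases "x = 0 \<or> y = 0")
  case False
  have "real p powi (- v x + - v y) = real p powi (- v x) * real p powi (- v y)"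
    using p_gt1 by (intro power_int_add) auto
  then show ?thesis using False by (simp add: padic_abs_def val_mult)
qed auto

lemma val_1: "v 1 = 0" using padic_val_divide[OF p, of 1 1] by simp

lemma nrm_1 [simp]: "nrm 1 = 1" by (simp add: padic_abs_def val_1)

lemma nrm_minus [simp]: "nrm (- x) = nrm x"
proof -
  have "nrm (-1) * nrm (-1) = 1" by (simp flip: nrm_mult)
  then have "nrm (-1) = 1" using nrm_nonneg[of "-1"]
    by (metis abs_of_nonneg abs_one power2_eq_square real_sqrt_abs real_sqrt_one)
  then show ?thesis using nrm_mult[of "-1" x] by simp
qed

lemma nrm_inverse: "nrm (inverse x) = inverse (nrm x)"
proof (cases "x = 0")
  case False
  then have "nrm x * nrm (inverse x) = 1" by (simp flip: nrm_mult)
  then show ?thesis by (simp add: inverse_unique)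
qed simp

lemma nrm_divide: "nrm (x / y) = nrm x / nrm y"
  by (simp add: divide_inverse nrm_mult nrm_inverse)

lemma nrm_p: "nrm (of_nat p) = 1 / real p"
proof -
  have "v (of_nat p) = 1"
    using padic_val_divide[OF p, of "int p" 1] prime_gt_0_nat[OF p] prime_int
    by (simp add: multiplicity_self prime_elem_def)
  then show ?thesis using prime_gt_0_nat[OF p] by (simp add: padic_abs_def power_int_minus divide_inverse)
qed

lemma nrm_le_iff:
  assumes "x \<noteq> 0" "y \<noteq> 0" shows "nrm x \<le> nrm y \<longleftrightarrow> v y \<le> v x"
proof
  show "nrm x \<le> nrm y" if "v y \<le> v x"
    using that assms p_gt1 by (simp add: padic_abs_def power_int_increasing del: power_int_minus)
  show "v y \<le> v x" if "nrm x \<le> nrm y"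
  proof (rule ccontr)
    assume "\<not> v y \<le> v x"
    then have "real p powi (- v y) < real p powi (- v x)"
      using p_gt1 by (intro power_int_strict_increasing) auto
    then show False using that assms by (simp add: padic_abs_def)
  qed
qed

lemma ultrametric: "nrm (x + y) \<le> max (nrm x) (nrm y)"
proof (cases "x = 0 \<or> y = 0 \<or> x + y = 0")
  case True
  then show ?thesis by (auto simp: le_max_iff_disj)
next
  case False
  obtain a b where x: "x = of_int a / of_int b" "b \<noteq> 0" by (rule rat_as_int_fraction)
  obtain c d where y: "y = of_int c / of_int d" "d \<noteq> 0" by (rule rat_as_int_fraction)
  define m n e where "m = a * d" and "n = c * b" and "e = b * d"
  have e: "e \<noteq> 0" and xe: "x = of_int m / of_int e" and ye: "y = of_int n / of_int e"
    using x y by (auto simp: m_def n_def e_def)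
  have xye: "x + y = of_int (m + n) / of_int e" using xe ye by (simp add: add_divide_distrib)
  have nz: "m \<noteq> 0" "n \<noteq> 0" "m + n \<noteq> 0" using False xe ye xye by auto
  have "min (multiplicity (int p) m) (multiplicity (int p) n) \<le> multiplicity (int p) (m + n)"
  proof (rule multiplicity_geI)
    show "m + n \<noteq> 0" "\<not> is_unit (int p)" using nz prime_int by (auto simp: prime_elem_def)
    have "int p ^ k dvd m" if "k \<le> multiplicity (int p) m" for k
      using that by (rule multiplicity_dvd')
    moreover have "int p ^ k dvd n" if "k \<le> multiplicity (int p) n" for k
      using that by (rule multiplicity_dvd')
    ultimately show "int p ^ min (multiplicity (int p) m) (multiplicity (int p) n) dvd m + n"
      by (intro dvd_add) auto
  qed
  then have "min (v x) (v y) \<le> v (x + y)"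
    unfolding xye unfolding xe ye padic_val_divide[OF p nz(1) e] padic_val_divide[OF p nz(2) e]
      padic_val_divide[OF p nz(3) e] by auto
  then show ?thesis using False by (auto simp: le_max_iff_disj nrm_le_iff min_le_iff_disj)
qed

lemma nrm_add_le: "nrm x \<le> c \<Longrightarrow> nrm y \<le> c \<Longrightarrow> nrm (x + y) \<le> c"
  using ultrametric[of x y] by linarith

lemma nrm_add_less: "nrm x < c \<Longrightarrow> nrm y < c \<Longrightarrow> nrm (x + y) < c"
  using ultrametric[of x y] by linarith

lemma nrm_diff_commute: "nrm (x - y) = nrm (y - x)" using nrm_minus[of "x - y"] by simp

lemma nrm_diff_ge: "\<bar>nrm x - nrm y\<bar> \<le> nrm (x - y)"
proof -
  have e: "x - y + y = x" "y - x + x = y" by simp_all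
  show ?thesis
    using ultrametric[of "x - y" y] ultrametric[of "y - x" x] nrm_diff_commute[of x y]
      nrm_nonneg[of x] nrm_nonneg[of y] nrm_nonneg[of "x - y"]
    unfolding e by linarith
qed

lemma nrm_eq_of_close: "nrm (x - y) < nrm y \<Longrightarrow> nrm x = nrm y"
  using ultrametric[of "x - y" y] ultrametric[of "y - x" x] nrm_diff_commute[of x y] by simp

text \<open>No value of the absolute value lies strictly between 1 and \<open>p\<close>.\<close>

lemma nrm_less_2: "nrm x < 2 \<Longrightarrow> nrm x \<le> 1"
proof (rule ccontr)
  assume 2: "nrm x < 2" and 1: "\<not> nrm x \<le> 1"
  then have "x \<noteq> 0" by auto
  then have n: "nrm x = real p powi (- v x)" by (simp add: padic_abs_def)
  have "0 < - v x"
  proof (rule ccontr)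
    assume "\<not> 0 < - v x"
    then have "real p powi (- v x) \<le> real p powi 0" using p_gt1 by (intro power_int_increasing) auto
    then show False using 1 n by simp
  qed
  then have "real p powi 1 \<le> real p powi (- v x)" using p_gt1 by (intro power_int_increasing) auto
  moreover have "2 \<le> real p" using prime_ge_2_nat[OF p] by simp
  ultimately show False using 2 n by simp
qed

abbreviation "CR \<equiv> padic_Cauchy_ring p"

lemma CauchyD:
  assumes "padic_Cauchy p s" "0 < e"
  obtains N where "\<And>m n. m \<ge> N \<Longrightarrow> n \<ge> N \<Longrightarrow> nrm (s m - s n) < e"
  using assms unfolding padic_Cauchy_def by blast

lemma Cauchy_mult:
  assumes "padic_Cauchy p s" "padic_Cauchy p t" shows "padic_Cauchy p (\<lambda>n. s n * t n)"
proof -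
  have bound: "\<exists>B>0. \<exists>N. \<forall>n\<ge>N. nrm (s n) \<le> B" if Cs: "padic_Cauchy p s" for s
  proof -
    obtain N where N: "\<And>m n. m \<ge> N \<Longrightarrow> n \<ge> N \<Longrightarrow> nrm (s m - s n) < 1"
      using CauchyD[OF Cs, of 1] by auto
    have "nrm (s n) \<le> max 1 (nrm (s N))" if "n \<ge> N" for n
      using N[OF that order_refl] ultrametric[of "s n - s N" "s N"] by simp
    then show ?thesis by (intro exI[of _ "max 1 (nrm (s N))"]) auto
  qed
  obtain B N where B: "B > 0" "\<And>n. n \<ge> N \<Longrightarrow> nrm (s n) \<le> B" using bound[OF assms(1)] by blast
  obtain B' N' where B': "B' > 0" "\<And>n. n \<ge> N' \<Longrightarrow> nrm (t n) \<le> B'" using bound[OF assms(2)] by blast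
  show ?thesis unfolding padic_Cauchy_def
  proof (intro allI impI)
    fix e :: real assume e: "e > 0"
    obtain N1 where N1: "\<And>m n. m \<ge> N1 \<Longrightarrow> n \<ge> N1 \<Longrightarrow> nrm (s m - s n) < e / B'"
      using assms(1) e B'(1) unfolding padic_Cauchy_def by (metis divide_pos_pos)
    obtain N2 where N2: "\<And>m n. m \<ge> N2 \<Longrightarrow> n \<ge> N2 \<Longrightarrow> nrm (t m - t n) < e / B"
      using assms(2) e B(1) unfolding padic_Cauchy_def by (metis divide_pos_pos)
    define M where "M = Max {N, N', N1, N2}"
    have M: "N \<le> M" "N' \<le> M" "N1 \<le> M" "N2 \<le> M" by (auto simp: M_def)
    have "nrm (s m * t m - s n * t n) < e" if mn: "m \<ge> M" "n \<ge> M" for m n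
    proof -
      have "nrm (s m * (t m - t n)) < e"
      proof -
        have "nrm (s m) * nrm (t m - t n) \<le> B * nrm (t m - t n)"
          using B(2)[of m] M mn by (intro mult_right_mono) auto
        also have "\<dots> < B * (e / B)" using N2[of m n] M mn B(1) by (intro mult_strict_left_mono) auto
        finally show ?thesis using B(1) by (simp add: nrm_mult)
      qed
      moreover have "nrm (t n * (s m - s n)) < e"
      proof -
        have "nrm (t n) * nrm (s m - s n) \<le> B' * nrm (s m - s n)"
          using B'(2)[of n] M mn by (intro mult_right_mono) auto
        also have "\<dots> < B' * (e / B')" using N1[of m n] M mn B'(1) by (intro mult_strict_left_mono) auto
        finally show ?thesis using B'(1) by (simp add: nrm_mult)
      qed
      ultimately have "nrm (s m * (t m - t n) + t n * (s m - s n)) < e" by (rule nrm_add_less)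
      then show ?thesis by (simp add: algebra_simps)
    qed
    then show "\<exists>N. \<forall>m\<ge>N. \<forall>n\<ge>N. nrm (s m * t m - s n * t n) < e" by blast
  qed
qed

lemma Cauchy_add:
  assumes "padic_Cauchy p s" "padic_Cauchy p t" shows "padic_Cauchy p (\<lambda>n. s n + t n)"
  unfolding padic_Cauchy_def
proof (intro allI impI)
  fix e :: real assume e: "e > 0"
  obtain N1 where N1: "\<And>m n. m \<ge> N1 \<Longrightarrow> n \<ge> N1 \<Longrightarrow> nrm (s m - s n) < e"
    using assms(1) e unfolding padic_Cauchy_def by metis
  obtain N2 where N2: "\<And>m n. m \<ge> N2 \<Longrightarrow> n \<ge> N2 \<Longrightarrow> nrm (t m - t n) < e"
    using assms(2) e unfolding padic_Cauchy_def by metis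
  have "nrm (s m + t m - (s n + t n)) < e" if "m \<ge> max N1 N2" "n \<ge> max N1 N2" for m n
    using nrm_add_less[OF N1[of m n] N2[of m n]] that by (simp add: algebra_simps)
  then show "\<exists>N. \<forall>m\<ge>N. \<forall>n\<ge>N. nrm (s m + t m - (s n + t n)) < e" by blast
qed

lemma Cauchy_const: "padic_Cauchy p (\<lambda>_. c)" by (auto simp: padic_Cauchy_def)

lemma Cauchy_minus: "padic_Cauchy p s \<Longrightarrow> padic_Cauchy p (\<lambda>n. - s n)"
  using Cauchy_mult[OF Cauchy_const[of "-1"], of s] by simp

lemma CR_cring: "cring CR"
proof (rule cringI)
  show "abelian_group CR"
  proof (rule abelian_groupI)
    show "\<exists>y\<in>carrier CR. y \<oplus>\<^bsub>CR\<^esub> s = \<zero>\<^bsub>CR\<^esub>" if "s \<in> carrier CR" for s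
      using that Cauchy_minus by (intro bexI[of _ "\<lambda>n. - s n"]) (auto simp: padic_Cauchy_ring_def)
  qed (auto simp: padic_Cauchy_ring_def Cauchy_add Cauchy_const algebra_simps)
  show "Group.comm_monoid CR"
    by unfold_locales (auto simp: padic_Cauchy_ring_def Cauchy_mult Cauchy_const algebra_simps)
qed (auto simp: padic_Cauchy_ring_def algebra_simps)

lemma null_Cauchy: assumes "s \<in> padic_null p" shows "padic_Cauchy p s"
  unfolding padic_Cauchy_def
proof (intro allI impI)
  fix e :: real assume "e > 0"
  then obtain N where N: "\<And>n. n \<ge> N \<Longrightarrow> nrm (s n) < e"
    using assms unfolding padic_null_def by (auto simp: LIMSEQ_iff)
  have "nrm (s m - s n) < e" if "m \<ge> N" "n \<ge> N" for m n
    using nrm_add_less[of "s m" e "- s n"] N that by simp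
  then show "\<exists>N. \<forall>m\<ge>N. \<forall>n\<ge>N. nrm (s m - s n) < e" by blast
qed

lemma null_add: assumes "s \<in> padic_null p" "t \<in> padic_null p" shows "(\<lambda>n. s n + t n) \<in> padic_null p"
proof -
  have "(\<lambda>n. nrm (s n) + nrm (t n)) \<longlonglongrightarrow> 0 + 0" using assms unfolding padic_null_def by (intro tendsto_add) auto
  then have l: "(\<lambda>n. nrm (s n) + nrm (t n)) \<longlonglongrightarrow> 0" by simp
  have "nrm (s n + t n) \<le> nrm (s n) + nrm (t n)" for n
    using ultrametric[of "s n" "t n"] nrm_nonneg[of "s n"] nrm_nonneg[of "t n"] by linarith
  then have "(\<lambda>n. nrm (s n + t n)) \<longlonglongrightarrow> 0" by (intro tendsto_sandwich[OF _ _ tendsto_const l]) auto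
  then show ?thesis by (simp add: padic_null_def)
qed

lemma null_mult: assumes s: "s \<in> padic_null p" and t: "padic_Cauchy p t" shows "(\<lambda>n. t n * s n) \<in> padic_null p"
proof -
  obtain N where N: "\<And>m n. m \<ge> N \<Longrightarrow> n \<ge> N \<Longrightarrow> nrm (t m - t n) < 1"
    using CauchyD[OF t, of 1] by auto
  define B where "B = max 1 (nrm (t N))"
  have B: "nrm (t n) \<le> B" if "n \<ge> N" for n
    using N[OF that order_refl] ultrametric[of "t n - t N" "t N"] by (simp add: B_def)
  have l: "(\<lambda>n. B * nrm (s n)) \<longlonglongrightarrow> 0" using s unfolding padic_null_def by (auto intro: tendsto_mult_right_zero)
  have "\<forall>\<^sub>F n in sequentially. nrm (t n * s n) \<le> B * nrm (s n)"
    unfolding eventually_sequentially using B by (intro exI[of _ N]) (auto simp: nrm_mult intro: mult_right_mono)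
  then have "(\<lambda>n. nrm (t n * s n)) \<longlonglongrightarrow> 0" by (intro tendsto_sandwich[OF _ _ tendsto_const l]) auto
  then show ?thesis by (simp add: padic_null_def)
qed

lemma null_ideal: "ideal (padic_null p) CR"
proof -
  interpret cring CR by (rule CR_cring)
  have inv: "\<ominus>\<^bsub>CR\<^esub> s = (\<lambda>n. - s n)" if "s \<in> carrier CR" for s
    using that Cauchy_minus by (intro minus_equality) (auto simp: padic_Cauchy_ring_def)
  show ?thesis
  proof (rule idealI[OF ring_axioms])
    show "subgroup (padic_null p) (add_monoid CR)"
    proof (rule add.subgroupI)
      show "padic_null p \<subseteq> carrier CR" using null_Cauchy by (auto simp: padic_Cauchy_ring_def)
      have "(\<lambda>_. 0) \<in> padic_null p" by (simp add: padic_null_def)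
      then show "padic_null p \<noteq> {}" by blast
      show "\<ominus>\<^bsub>CR\<^esub> s \<in> padic_null p" if "s \<in> padic_null p" for s
        
      proof -
        have "\<ominus>\<^bsub>CR\<^esub> s = (\<lambda>n. - s n)"
          using null_Cauchy[OF that] by (intro inv) (simp add: padic_Cauchy_ring_def)
        then show ?thesis using that by (simp add: padic_null_def)
      qed
      show "s \<oplus>\<^bsub>CR\<^esub> t \<in> padic_null p" if "s \<in> padic_null p" "t \<in> padic_null p" for s t
        using null_add[OF that] by (simp add: padic_Cauchy_ring_def)
    qed
    fix s t assume s: "s \<in> padic_null p" and t: "t \<in> carrier CR"
    then show "t \<otimes>\<^bsub>CR\<^esub> s \<in> padic_null p" using null_mult by (simp add: padic_Cauchy_ring_def)
    then show "s \<otimes>\<^bsub>CR\<^esub> t \<in> padic_null p" using s t null_Cauchy m_comm by (simp add: padic_Cauchy_ring_def mult.commute)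
  qed
qed

definition cls :: "(nat \<Rightarrow> rat) \<Rightarrow> (nat \<Rightarrow> rat) set" where
  "cls s = padic_null p +>\<^bsub>CR\<^esub> s"

lemma cls_hom: "cls \<in> ring_hom CR (Qp p)"
  unfolding cls_def Qp_def using ideal.rcos_ring_hom[OF null_ideal] by simp

lemma cls_mem: "t \<in> cls s \<longleftrightarrow> (\<lambda>n. t n - s n) \<in> padic_null p"
proof -
  have "t \<in> cls s \<longleftrightarrow> (\<exists>z\<in>padic_null p. t = (\<lambda>n. z n + s n))"
    by (auto simp: cls_def a_r_coset_def' padic_Cauchy_ring_def)
  also have "\<dots> \<longleftrightarrow> (\<lambda>n. t n - s n) \<in> padic_null p"
    by (auto intro!: bexI[of _ "\<lambda>n. t n - s n"])
  finally show ?thesis .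
qed

lemma carrier_Qp: "carrier (Qp p) = cls ` {s. padic_Cauchy p s}"
  by (auto simp: Qp_def FactRing_def A_RCOSETS_def' cls_def padic_Cauchy_ring_def)

definition integral_seq :: "(nat \<Rightarrow> rat) \<Rightarrow> bool" where
  "integral_seq s \<longleftrightarrow> padic_Cauchy p s \<and> (\<forall>\<^sub>F n in sequentially. nrm (s n) \<le> 1)"

text \<open>The limit of the absolute values along a Cauchy sequence is at most 1 only if they are below 2, and
  hence at most 1, from some index on. Adding a null sequence does not change this.\<close>

lemma Zp_eq: "Zp p = cls ` {s. integral_seq s}"
proof -
  have conv: "(\<lambda>n. nrm (s n)) \<longlonglongrightarrow> lim (\<lambda>n. nrm (s n))" if s: "padic_Cauchy p s" for s
  proof -
    have "Cauchy (\<lambda>n. nrm (s n))"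
    proof (rule metric_CauchyI)
      fix e :: real assume "e > 0"
      then obtain N where "\<And>m n. m \<ge> N \<Longrightarrow> n \<ge> N \<Longrightarrow> nrm (s m - s n) < e"
        using s unfolding padic_Cauchy_def by metis
      then show "\<exists>M. \<forall>m\<ge>M. \<forall>n\<ge>M. dist (nrm (s m)) (nrm (s n)) < e"
        unfolding dist_real_def using le_less_trans[OF nrm_diff_ge] by blast
    qed
    then show ?thesis by (simp add: Cauchy_convergent_iff convergent_LIMSEQ_iff)
  qed
  have key: "Qp_abs p (cls s) \<le> 1 \<longleftrightarrow> (\<forall>\<^sub>F n in sequentially. nrm (s n) \<le> 1)" if s: "padic_Cauchy p s" for s
  proof -
    define t where "t = (SOME t. t \<in> cls s)"
    have "s \<in> cls s" by (simp add: cls_mem padic_null_def)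
    then have "t \<in> cls s" unfolding t_def by (rule someI[of "\<lambda>t. t \<in> cls s"])
    then have ts: "(\<lambda>n. t n - s n) \<in> padic_null p" by (simp add: cls_mem)
    have t: "padic_Cauchy p t" using Cauchy_add[OF null_Cauchy[OF ts] s] by simp
    have "\<forall>\<^sub>F n in sequentially. nrm (t n - s n) < 1"
      using ts unfolding padic_null_def by (auto elim: order_tendstoD)
    then have "(\<forall>\<^sub>F n in sequentially. nrm (t n) \<le> 1) \<longleftrightarrow> (\<forall>\<^sub>F n in sequentially. nrm (s n) \<le> 1)"
    proof (intro iffI)
      assume d: "\<forall>\<^sub>F n in sequentially. nrm (t n - s n) < 1"
      show "\<forall>\<^sub>F n in sequentially. nrm (s n) \<le> 1" if "\<forall>\<^sub>F n in sequentially. nrm (t n) \<le> 1"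
        using d that
      proof eventually_elim
        case (elim n)
        then show ?case using nrm_add_le[of "s n - t n" 1 "t n"] nrm_diff_commute[of "s n" "t n"] by simp
      qed
      show "\<forall>\<^sub>F n in sequentially. nrm (t n) \<le> 1" if "\<forall>\<^sub>F n in sequentially. nrm (s n) \<le> 1"
        using d that
      proof eventually_elim
        case (elim n)
        then show ?case using nrm_add_le[of "t n - s n" 1 "s n"] by simp
      qed
    qed
    moreover have "Qp_abs p (cls s) \<le> 1 \<longleftrightarrow> (\<forall>\<^sub>F n in sequentially. nrm (t n) \<le> 1)"
    proof
      assume "Qp_abs p (cls s) \<le> 1"
      then have "lim (\<lambda>n. nrm (t n)) < 2" by (simp add: Qp_abs_def t_def)
      then have "\<forall>\<^sub>F n in sequentially. nrm (t n) < 2" using conv[OF t] by (rule order_tendstoD(2)[rotated])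
      then show "\<forall>\<^sub>F n in sequentially. nrm (t n) \<le> 1" by eventually_elim (rule nrm_less_2)
    next
      assume "\<forall>\<^sub>F n in sequentially. nrm (t n) \<le> 1"
      then have "lim (\<lambda>n. nrm (t n)) \<le> 1" using conv[OF t] by (intro tendsto_upperbound) auto
      then show "Qp_abs p (cls s) \<le> 1" by (simp add: Qp_abs_def t_def)
    qed
    ultimately show ?thesis by simp
  qed
  then show ?thesis unfolding Zp_def carrier_Qp integral_seq_def by auto
qed

lemma integral_seq_const: "nrm c \<le> 1 \<Longrightarrow> integral_seq (\<lambda>_. c)"
  by (simp add: integral_seq_def Cauchy_const)

lemma integral_seq_add: "integral_seq s \<Longrightarrow> integral_seq t \<Longrightarrow> integral_seq (\<lambda>n. s n + t n)"
  unfolding integral_seq_def by (auto intro: Cauchy_add elim: eventually_elim2 nrm_add_le)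

lemma integral_seq_mult: "integral_seq s \<Longrightarrow> integral_seq t \<Longrightarrow> integral_seq (\<lambda>n. s n * t n)"
  unfolding integral_seq_def
proof (elim conjE, intro conjI Cauchy_mult)
  assume "\<forall>\<^sub>F n in sequentially. nrm (s n) \<le> 1" "\<forall>\<^sub>F n in sequentially. nrm (t n) \<le> 1"
  then show "\<forall>\<^sub>F n in sequentially. nrm (s n * t n) \<le> 1"
    by eventually_elim (simp add: nrm_mult mult_le_one)
qed

text \<open>The absolute values of a Cauchy sequence that is not a null sequence are eventually constant, equal
  to \<open>p\<^sup>-\<^sup>k\<close>. Beyond that index, \<open>u\<close> is the sequence divided by \<open>p\<^sup>k\<close> and \<open>w\<close> its termwise inverse.\<close>

lemma integral_seq_factor:
  assumes s: "integral_seq s" and nz: "s \<notin> padic_null p"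
  obtains k u w where "integral_seq u" "integral_seq w"
    "(\<lambda>n. s n - of_nat p ^ k * u n) \<in> padic_null p" "(\<lambda>n. u n * w n - 1) \<in> padic_null p"
proof -
  have C: "padic_Cauchy p s" using s by (simp add: integral_seq_def)
  obtain \<epsilon> where \<epsilon>: "\<epsilon> > 0" "\<And>N. \<exists>n\<ge>N. nrm (s n) \<ge> \<epsilon>"
    using nz unfolding padic_null_def LIMSEQ_iff by (auto simp: not_less)
  obtain N1 where N1: "\<And>m n. m \<ge> N1 \<Longrightarrow> n \<ge> N1 \<Longrightarrow> nrm (s m - s n) < \<epsilon>"
    using C \<epsilon>(1) unfolding padic_Cauchy_def by metis
  obtain N2 where N2: "\<And>n. n \<ge> N2 \<Longrightarrow> nrm (s n) \<le> 1"
    using s by (auto simp: integral_seq_def eventually_sequentially)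
  obtain N where N: "N \<ge> max N1 N2" "nrm (s N) \<ge> \<epsilon>" using \<epsilon>(2) by blast
  have const: "nrm (s n) = nrm (s N)" if "n \<ge> N" for n
    using nrm_eq_of_close[of "s n" "s N"] N1[of n N] N that by simp
  have sN: "s N \<noteq> 0" using N(2) \<epsilon>(1) by auto
  define k where "k = nat (v (s N))"
  have "nrm (s N) \<le> nrm 1" using N2[of N] N(1) by simp
  then have "0 \<le> v (s N)" using nrm_le_iff[of "s N" 1] sN val_1 by simp
  then have k: "nrm (s N) = (1 / real p) ^ k"
    using sN p_gt1 by (simp add: padic_abs_def k_def power_int_minus power_int_def power_one_over divide_inverse power_inverse)
  have pk: "nrm (of_nat p ^ k) = (1 / real p) ^ k"
    by (induction k) (simp_all add: nrm_mult nrm_p)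
  have pk0: "(of_nat p :: rat) ^ k \<noteq> 0" using prime_gt_0_nat[OF p] by simp
  define c where "c = (1 / real p) ^ k"
  have c: "c > 0" using p_gt1 by (simp add: c_def)
  have sc: "nrm (s n) = c" if "n \<ge> N" for n using const[OF that] k by (simp add: c_def)
  then have s0: "s n \<noteq> 0" if "n \<ge> N" for n using that c by fastforce
  define u where "u n = (if n \<ge> N then s n / of_nat p ^ k else 1)" for n
  define w where "w n = (if n \<ge> N then of_nat p ^ k / s n else 1)" for n
  have Cu: "padic_Cauchy p u" unfolding padic_Cauchy_def
  proof (intro allI impI)
    fix e :: real assume "e > 0"
    then obtain M where M: "\<And>m n. m \<ge> M \<Longrightarrow> n \<ge> M \<Longrightarrow> nrm (s m - s n) < e * c"
      using C c unfolding padic_Cauchy_def by (metis mult_pos_pos)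
    have "nrm (u m - u n) < e" if mn: "m \<ge> max M N" "n \<ge> max M N" for m n
    proof -
      have "u m - u n = (s m - s n) / of_nat p ^ k" using mn by (simp add: u_def diff_divide_distrib)
      then have "nrm (u m - u n) = nrm (s m - s n) / c" by (simp add: nrm_divide pk c_def)
      then show ?thesis using M[of m n] mn c by (simp add: pos_divide_less_eq)
    qed
    then show "\<exists>N. \<forall>m\<ge>N. \<forall>n\<ge>N. nrm (u m - u n) < e" by blast
  qed
  have Cw: "padic_Cauchy p w" unfolding padic_Cauchy_def
  proof (intro allI impI)
    fix e :: real assume "e > 0"
    then obtain M where M: "\<And>m n. m \<ge> M \<Longrightarrow> n \<ge> M \<Longrightarrow> nrm (s m - s n) < e * c"
      using C c unfolding padic_Cauchy_def by (metis mult_pos_pos)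
    have "nrm (w m - w n) < e" if mn: "m \<ge> max M N" "n \<ge> max M N" for m n
    proof -
      have "w m - w n = of_nat p ^ k * (s n - s m) / (s m * s n)"
        using mn s0[of m] s0[of n] by (simp add: w_def field_simps)
      then have "nrm (w m - w n) = c * nrm (s n - s m) / (c * c)"
        using sc[of m] sc[of n] mn by (simp add: nrm_divide nrm_mult pk c_def[symmetric])
      also have "\<dots> = nrm (s m - s n) / c" using c by (simp add: nrm_diff_commute)
      finally show ?thesis using M[of m n] mn c by (simp add: pos_divide_less_eq)
    qed
    then show "\<exists>N. \<forall>m\<ge>N. \<forall>n\<ge>N. nrm (w m - w n) < e" by blast
  qed
  have "nrm (u n) \<le> 1" "nrm (w n) \<le> 1" for n
    using c sc[of n] by (auto simp: u_def w_def nrm_divide pk c_def[symmetric])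
  then have int: "integral_seq u" "integral_seq w" using Cu Cw by (simp_all add: integral_seq_def)
  have ev0: "(\<lambda>n. f n) \<in> padic_null p" if "\<And>n. n \<ge> N \<Longrightarrow> f n = 0" for f
  proof -
    have "\<forall>\<^sub>F n in sequentially. nrm (f n) = 0" unfolding eventually_sequentially using that by auto
    then show ?thesis unfolding padic_null_def by (auto intro: tendsto_eventually)
  qed
  show thesis
  proof (rule that[OF int])
    show "(\<lambda>n. s n - of_nat p ^ k * u n) \<in> padic_null p" using pk0 by (intro ev0) (simp add: u_def)
    show "(\<lambda>n. u n * w n - 1) \<in> padic_null p" using pk0 s0 by (intro ev0) (simp add: u_def w_def)
  qed
qed

end

section \<open>Integral closures\<close>

text \<open>\<open>S\<close> is a valuation ring with uniformizer \<open>p\<close> and \<open>A\<close> its integral closure in \<open>K\<close>. The maximality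
  assumption contains the statement that \<open>A\<close> is a ring.\<close>

locale integral_closure = field K for K :: "('k, 'y) ring_scheme" (structure) +
  fixes S :: "'k set" and p :: nat and A :: "('k, 'y) ring_scheme"
  assumes S_carrier: "S \<subseteq> carrier K" and one_S: "\<one> \<in> S" and minus_one_S: "\<ominus> \<one> \<in> S"
    and add_S: "a \<in> S \<Longrightarrow> b \<in> S \<Longrightarrow> a \<oplus> b \<in> S"
    and mult_S: "a \<in> S \<Longrightarrow> b \<in> S \<Longrightarrow> a \<otimes> b \<in> S"
    and factor_S: "s \<in> S \<Longrightarrow> s \<noteq> \<zero> \<Longrightarrow> \<exists>k::nat. \<exists>u\<in>S. \<exists>v\<in>S. s = ([p] \<cdot> \<one>) [^] k \<otimes> u \<and> u \<otimes> v = \<one>"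
    and p_nonzero: "[p] \<cdot> \<one> \<noteq> \<zero>"
    and A_def: "A = K\<lparr>carrier := {x \<in> carrier K. integral_over K S x}\<rparr>"
    and maximal: "maximalideal (PIdl\<^bsub>A\<^esub> ([p] \<cdot>\<^bsub>A\<^esub> \<one>\<^bsub>A\<^esub>)) A"
begin

abbreviation "\<pi> \<equiv> [p] \<cdot> \<one>"

sublocale A: ring A using maximal by (simp add: maximalideal_def ideal_def)

lemma A_simps [simp]: "\<one>\<^bsub>A\<^esub> = \<one>" "\<zero>\<^bsub>A\<^esub> = \<zero>" "a \<otimes>\<^bsub>A\<^esub> b = a \<otimes> b" "a \<oplus>\<^bsub>A\<^esub> b = a \<oplus> b"
  by (simp_all add: A_def)

lemma A_pi: "[p] \<cdot>\<^bsub>A\<^esub> \<one>\<^bsub>A\<^esub> = \<pi>" by (simp add: A_def add_pow_def nat_pow_def)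

lemma A_pow: "a [^]\<^bsub>A\<^esub> (n::nat) = a [^] n" by (simp add: A_def nat_pow_def)

lemma A_iff: "x \<in> carrier A \<longleftrightarrow> x \<in> carrier K \<and> integral_over K S x" by (simp add: A_def)

lemma A_carrier [simp]: "a \<in> carrier A \<Longrightarrow> a \<in> carrier K" by (simp add: A_def)

lemma A_closed: "a \<in> carrier A \<Longrightarrow> b \<in> carrier A \<Longrightarrow> a \<oplus> b \<in> carrier A"
  "a \<in> carrier A \<Longrightarrow> b \<in> carrier A \<Longrightarrow> a \<otimes> b \<in> carrier A" "\<zero> \<in> carrier A" "\<one> \<in> carrier A"
  using A.add.m_closed A.m_closed A.zero_closed A.one_closed by simp_all

lemma A_cring: "cring A"
  by (intro cring.intro A.ring_axioms Group.comm_monoid.intro A.monoid_axioms comm_monoid_axioms.intro)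
     (simp add: m_comm)

lemma S_A: assumes "s \<in> S" shows "s \<in> carrier A"
proof -
  have s: "s \<in> carrier K" using assms S_carrier by blast
  have ms: "\<ominus> s \<in> S" using mult_S[OF minus_one_S assms] s by (simp add: l_minus)
  have "eval [\<one>, \<ominus> s] s = \<zero>" using s by (simp add: r_neg)
  then have "integral_over K S s" unfolding integral_over_def
    using one_S ms by (intro exI[of _ "[\<one>, \<ominus> s]"]) auto
  then show ?thesis using s A_iff by blast
qed

lemma minus_A: assumes "a \<in> carrier A" shows "\<ominus> a \<in> carrier A"
  using A_closed(2)[OF S_A[OF minus_one_S] assms] assms by (simp add: l_minus)

lemma pow_A: "a \<in> carrier A \<Longrightarrow> a [^] (n::nat) \<in> carrier A"
  by (induction n) (auto intro: A_closed)

lemma pi_S: "\<pi> \<in> S"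
proof -
  have "[p] \<cdot> \<one> = \<ominus> \<one> \<oplus> \<one> \<or> [p] \<cdot> \<one> \<in> S"
  proof (induction p)
    case (Suc n)
    then show ?case using one_S add_S[OF _ one_S, of "[n] \<cdot> \<one>"] by (auto simp: l_neg)
  qed (simp add: l_neg)
  then show ?thesis using p_nonzero by (auto simp: l_neg)
qed

lemma pi_A: "\<pi> \<in> carrier A" and pi_K [simp]: "\<pi> \<in> carrier K"
  using S_A[OF pi_S] by auto

lemma ideal_eq: "PIdl\<^bsub>A\<^esub> ([p] \<cdot>\<^bsub>A\<^esub> \<one>\<^bsub>A\<^esub>) = {x \<otimes> \<pi> | x. x \<in> carrier A}"
  unfolding A_pi cgenideal_def by simp

lemma pi_nonunit: assumes a: "a \<in> carrier A" shows "\<pi> \<otimes> a \<noteq> \<one>"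
proof
  assume 1: "\<pi> \<otimes> a = \<one>"
  have "x \<in> {x \<otimes> \<pi> | x. x \<in> carrier A}" if x: "x \<in> carrier A" for x
  proof -
    have "(x \<otimes> a) \<otimes> \<pi> = x \<otimes> (\<pi> \<otimes> a)" 
      using A_carrier[OF x] A_carrier[OF a] pi_K by algebra
    then have "x = (x \<otimes> a) \<otimes> \<pi>" using 1 x by simp
    then show ?thesis using A_closed(2)[OF x a] by blast
  qed
  moreover have "{x \<otimes> \<pi> | x. x \<in> carrier A} \<subseteq> carrier A" using A_closed(2) pi_A by blast
  ultimately have "carrier A = PIdl\<^bsub>A\<^esub> ([p] \<cdot>\<^bsub>A\<^esub> \<one>\<^bsub>A\<^esub>)" unfolding ideal_eq by blast
  then show False using maximalideal.I_notcarr[OF maximal] by simp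
qed

lemma S_unit:
  assumes s: "s \<in> S" and e: "e = \<one> \<or> e = \<ominus> \<one>"
  obtains v where "v \<in> S" "(e \<oplus> \<pi> \<otimes> s) \<otimes> v = \<one>"
proof -
  have eS: "e \<in> S" using e one_S minus_one_S by auto
  have sK: "s \<in> carrier K" and eK: "e \<in> carrier K" using s eS S_carrier by blast+
  have ee: "e \<otimes> e = \<one>" using e by (auto simp: l_minus)
  have no: False if x: "x \<in> carrier A" and ex: "e \<oplus> \<pi> \<otimes> s = \<pi> \<otimes> x" for x
  proof -
    have xK: "x \<in> carrier K" using x by simp
    have "\<pi> \<otimes> ((x \<oplus> \<ominus> s) \<otimes> e) = (\<pi> \<otimes> x \<oplus> \<ominus> (\<pi> \<otimes> s)) \<otimes> e" using xK sK eK pi_K by algebra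
    also have "\<dots> = (e \<oplus> \<pi> \<otimes> s \<oplus> \<ominus> (\<pi> \<otimes> s)) \<otimes> e" by (simp only: ex)
    also have "\<dots> = e \<otimes> e" using sK eK pi_K by algebra
    finally have "\<pi> \<otimes> ((x \<oplus> \<ominus> s) \<otimes> e) = \<one>" by (simp only: ee)
    then show False using pi_nonunit[OF A_closed(2)[OF A_closed(1)[OF x minus_A[OF S_A[OF s]]] S_A[OF eS]]] by simp
  qed
  have tS: "e \<oplus> \<pi> \<otimes> s \<in> S" by (intro add_S mult_S eS pi_S s)
  have "e \<oplus> \<pi> \<otimes> s \<noteq> \<zero>" using no[OF A_closed(3)] by auto
  then obtain k :: nat and u v where u: "u \<in> S" "v \<in> S" "e \<oplus> \<pi> \<otimes> s = \<pi> [^] k \<otimes> u" "u \<otimes> v = \<one>"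
    using factor_S[OF tS] by blast
  have uK: "u \<in> carrier K" using u S_carrier by blast
  have "k = 0"
  proof (rule ccontr)
    assume "k \<noteq> 0"
    then obtain j where j: "k = Suc j" by (cases k) auto
    have "e \<oplus> \<pi> \<otimes> s = \<pi> \<otimes> (\<pi> [^] j \<otimes> u)"
      unfolding u(3) j using uK nat_pow_Suc2[OF pi_K, of j] by (simp add: m_assoc)
    then show False using no[OF A_closed(2)[OF pow_A[OF pi_A] S_A[OF u(1)]]] by blast
  qed
  then have "(e \<oplus> \<pi> \<otimes> s) \<otimes> v = \<one>" using u uK by simp
  then show thesis using that u(2) by blast
qed

text \<open>Write \<open>w = 1 + p z\<close> and multiply a monic equation of degree \<open>n\<close> for \<open>z\<close> by \<open>p\<^sup>n\<close>. Substituting \<open>p z = w - 1\<close>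
  and collecting the multiples of \<open>w\<close> leaves a constant \<open>\<plusminus>1 + p s\<close> with \<open>s\<close> in \<open>S\<close>, which is a unit and
  is divisible by \<open>w\<close>.\<close>

lemma one_plus_unit:
  assumes z: "z \<in> carrier A" shows "\<exists>c\<in>carrier A. (\<one> \<oplus> \<pi> \<otimes> z) \<otimes> c = \<one>"
proof -
  define w where "w = \<one> \<oplus> \<pi> \<otimes> z"
  have zK: "z \<in> carrier K" using z by simp
  have wA: "w \<in> carrier A" unfolding w_def by (intro A_closed pi_A z)
  then have wK: "w \<in> carrier K" by simp
  have pz: "\<pi> \<otimes> z = w \<oplus> \<ominus> \<one>" unfolding w_def using zK pi_K by algebra
  have pow: "\<exists>c\<in>carrier A. \<exists>e. (e = \<one> \<or> e = \<ominus> \<one>) \<and> (\<pi> \<otimes> z) [^] n = w \<otimes> c \<oplus> e" for n :: nat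
  proof (induction n)
    case 0
    then show ?case using wK by (intro bexI[of _ \<zero>] exI[of _ \<one>]) (auto intro: A_closed)
  next
    case (Suc n)
    then obtain c e where c: "c \<in> carrier A" "e = \<one> \<or> e = \<ominus> \<one>" "(\<pi> \<otimes> z) [^] n = w \<otimes> c \<oplus> e" by blast
    have cK: "c \<in> carrier K" and eK: "e \<in> carrier K" using c by auto
    have eA: "e \<in> carrier A" using c(2) S_A one_S minus_one_S by auto
    have "(\<pi> \<otimes> z) [^] Suc n = (w \<otimes> c \<oplus> e) \<otimes> (w \<oplus> \<ominus> \<one>)" using c(3) pz by simp
    also have "\<dots> = w \<otimes> (c \<otimes> (w \<oplus> \<ominus> \<one>) \<oplus> e) \<oplus> \<ominus> e" using cK eK wK by algebra
    finally have "(\<pi> \<otimes> z) [^] Suc n = w \<otimes> (c \<otimes> (w \<oplus> \<ominus> \<one>) \<oplus> e) \<oplus> \<ominus> e" .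
    moreover have "\<ominus> e = \<one> \<or> \<ominus> e = \<ominus> \<one>" using c(2) by auto
    moreover have "c \<otimes> (w \<oplus> \<ominus> \<one>) \<oplus> e \<in> carrier A"
      by (intro A_closed c wA eA S_A[OF minus_one_S])
    ultimately show ?case by blast
  qed
  have homog: "\<exists>c\<in>carrier A. \<exists>s\<in>S. \<pi> [^] length q \<otimes> eval q z = w \<otimes> c \<oplus> \<pi> \<otimes> s" if "set q \<subseteq> S" for q
    using that
  proof (induction q)
    case Nil
    have "\<zero> \<in> S" using add_S[OF one_S minus_one_S] by (simp add: r_neg)
    then show ?case using wK by (intro bexI[of _ \<zero>]) (auto intro: A_closed)
  next
    case (Cons a q)
    then obtain c s where c: "c \<in> carrier A" "s \<in> S" "\<pi> [^] length q \<otimes> eval q z = w \<otimes> c \<oplus> \<pi> \<otimes> s" by auto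
    obtain c' e where e: "c' \<in> carrier A" "e = \<one> \<or> e = \<ominus> \<one>" "(\<pi> \<otimes> z) [^] length q = w \<otimes> c' \<oplus> e"
      using pow by blast
    have aS: "a \<in> S" and qS: "set q \<subseteq> S" using Cons.prems by auto
    have eS: "e \<in> S" using e(2) one_S minus_one_S by auto
    have qK: "set q \<subseteq> carrier K" using qS S_carrier by blast
    have K: "a \<in> carrier K" "s \<in> carrier K" "e \<in> carrier K" "c \<in> carrier K" "c' \<in> carrier K"
      "eval q z \<in> carrier K" "z [^] length q \<in> carrier K" "\<pi> [^] length q \<in> carrier K"
      using aS c eS e(1) S_carrier eval_in_carrier[OF qK zK] zK by auto
    have pzn: "\<pi> [^] length q \<otimes> z [^] length q = w \<otimes> c' \<oplus> e"
      using e(3) zK by (simp add: nat_pow_distrib)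
    have "\<pi> [^] length (a # q) \<otimes> eval (a # q) z
      = \<pi> \<otimes> (a \<otimes> (\<pi> [^] length q \<otimes> z [^] length q) \<oplus> \<pi> [^] length q \<otimes> eval q z)"
    proof -
      have "\<pi> [^] length (a # q) \<otimes> eval (a # q) z
        = (\<pi> [^] length q \<otimes> \<pi>) \<otimes> (a \<otimes> z [^] length q \<oplus> eval q z)" by simp
      also have "\<dots> = \<pi> \<otimes> (a \<otimes> (\<pi> [^] length q \<otimes> z [^] length q) \<oplus> \<pi> [^] length q \<otimes> eval q z)"
        using K pi_K by algebra
      finally show ?thesis .
    qed
    also have "\<dots> = \<pi> \<otimes> (a \<otimes> (w \<otimes> c' \<oplus> e) \<oplus> (w \<otimes> c \<oplus> \<pi> \<otimes> s))" by (simp only: pzn c(3))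
    also have "\<dots> = w \<otimes> (\<pi> \<otimes> (a \<otimes> c' \<oplus> c)) \<oplus> \<pi> \<otimes> (a \<otimes> e \<oplus> \<pi> \<otimes> s)"
      using K wK pi_K by algebra
    finally have "\<pi> [^] length (a # q) \<otimes> eval (a # q) z = w \<otimes> (\<pi> \<otimes> (a \<otimes> c' \<oplus> c)) \<oplus> \<pi> \<otimes> (a \<otimes> e \<oplus> \<pi> \<otimes> s)" .
    moreover have "\<pi> \<otimes> (a \<otimes> c' \<oplus> c) \<in> carrier A" by (intro A_closed pi_A S_A[OF aS] e c)
    moreover have "a \<otimes> e \<oplus> \<pi> \<otimes> s \<in> S" by (intro add_S mult_S aS eS pi_S c)
    ultimately show ?case by blast
  qed
  have "integral_over K S z" using z A_iff by blast
  then obtain q where q: "set q \<subseteq> S" "eval (\<one> # q) z = \<zero>"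
    unfolding integral_over_def by (metis list.exhaust_sel set_ConsD set_subset_Cons subset_trans)
  obtain c s where c: "c \<in> carrier A" "s \<in> S" "\<pi> [^] length q \<otimes> eval q z = w \<otimes> c \<oplus> \<pi> \<otimes> s"
    using homog[OF q(1)] by blast
  obtain c' e where e: "c' \<in> carrier A" "e = \<one> \<or> e = \<ominus> \<one>" "(\<pi> \<otimes> z) [^] length q = w \<otimes> c' \<oplus> e"
    using pow by blast
  obtain v where v: "v \<in> S" "(e \<oplus> \<pi> \<otimes> s) \<otimes> v = \<one>" using S_unit[OF c(2) e(2)] by blast
  have qK: "set q \<subseteq> carrier K" using q(1) S_carrier by blast
  have K: "s \<in> carrier K" "e \<in> carrier K" "c \<in> carrier K" "c' \<in> carrier K" "v \<in> carrier K"
      "eval q z \<in> carrier K" "z [^] length q \<in> carrier K" "\<pi> [^] length q \<in> carrier K"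
    using c e v S_carrier eval_in_carrier[OF qK zK] zK by auto
  have pzn: "\<pi> [^] length q \<otimes> z [^] length q = w \<otimes> c' \<oplus> e" using e(3) zK by (simp add: nat_pow_distrib)
  have "\<zero> = \<pi> [^] length q \<otimes> (z [^] length q \<oplus> eval q z)" using q(2) K by simp
  also have "\<dots> = (w \<otimes> c' \<oplus> e) \<oplus> (w \<otimes> c \<oplus> \<pi> \<otimes> s)"
    unfolding pzn[symmetric] c(3)[symmetric] using K by algebra
  finally have 0: "(w \<otimes> c' \<oplus> e) \<oplus> (w \<otimes> c \<oplus> \<pi> \<otimes> s) = \<zero>" ..
  have "w \<otimes> ((c' \<oplus> c) \<otimes> (\<ominus> v)) = (e \<oplus> \<pi> \<otimes> s) \<otimes> v \<oplus> \<ominus> (((w \<otimes> c' \<oplus> e) \<oplus> (w \<otimes> c \<oplus> \<pi> \<otimes> s)) \<otimes> v)"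
    using K wK pi_K by algebra
  also have "\<dots> = \<one>" unfolding 0 v(2) using K by simp
  finally have "w \<otimes> ((c' \<oplus> c) \<otimes> (\<ominus> v)) = \<one>" .
  moreover have "(c' \<oplus> c) \<otimes> (\<ominus> v) \<in> carrier A" by (intro A_closed e c minus_A S_A v)
  ultimately show ?thesis unfolding w_def by blast
qed

text \<open>An element outside the maximal ideal \<open>(p)\<close> is invertible modulo \<open>p\<close>, and \<open>1 + p z\<close> is a unit. Thus
  the maximal ideal \<open>(p)\<close> is the only one.\<close>

lemma unit_or_divisible:
  assumes a: "a \<in> carrier A"
  shows "(\<exists>b\<in>carrier A. a \<otimes> b = \<one>) \<or> (\<exists>b\<in>carrier A. a = \<pi> \<otimes> b)"
proof (rule disjCI)
  assume nd: "\<not> (\<exists>b\<in>carrier A. a = \<pi> \<otimes> b)"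
  let ?I = "PIdl\<^bsub>A\<^esub> ([p] \<cdot>\<^bsub>A\<^esub> \<one>\<^bsub>A\<^esub>)"
  interpret I: maximalideal ?I A by (rule maximal)
  interpret F: field "A Quot ?I" by (rule I.quotient_is_field[OF A_cring])
  have "a \<notin> ?I"
  proof
    assume "a \<in> ?I"
    then obtain b where "b \<in> carrier A" "a = b \<otimes> \<pi>" unfolding ideal_eq by blast
    then show False using nd by (metis m_comm A_carrier pi_K)
  qed
  then have "?I +>\<^bsub>A\<^esub> a \<noteq> ?I" using I.a_rcos_self[OF a] by blast
  moreover have aQ: "?I +>\<^bsub>A\<^esub> a \<in> carrier (A Quot ?I)" using a by (auto simp: FactRing_def A_RCOSETS_def')
  ultimately have "?I +>\<^bsub>A\<^esub> a \<in> Units (A Quot ?I)" unfolding F.field_Units by (auto simp: FactRing_def)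
  then obtain y where y: "y \<in> carrier (A Quot ?I)" "(?I +>\<^bsub>A\<^esub> a) \<otimes>\<^bsub>A Quot ?I\<^esub> y = \<one>\<^bsub>A Quot ?I\<^esub>"
    unfolding Units_def by blast
  then obtain b where b: "b \<in> carrier A" "y = ?I +>\<^bsub>A\<^esub> b" by (auto simp: FactRing_def A_RCOSETS_def')
  have "?I +>\<^bsub>A\<^esub> (a \<otimes>\<^bsub>A\<^esub> b) = ?I +>\<^bsub>A\<^esub> \<one>\<^bsub>A\<^esub>"
    using y(2) unfolding b(2) FactRing_def by (simp add: I.rcoset_mult_add[OF a b(1)] del: A_simps)
  then have "(a \<otimes>\<^bsub>A\<^esub> b) \<ominus>\<^bsub>A\<^esub> \<one>\<^bsub>A\<^esub> \<in> ?I"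
    using A.quotient_eq_iff_same_a_r_cos[OF I.ideal_axioms A.m_closed[OF a b(1)] A.one_closed] by simp
  then obtain z where z: "z \<in> carrier A" "(a \<otimes>\<^bsub>A\<^esub> b) \<ominus>\<^bsub>A\<^esub> \<one>\<^bsub>A\<^esub> = z \<otimes> \<pi>" unfolding ideal_eq by blast
  have "a \<otimes>\<^bsub>A\<^esub> b = \<one>\<^bsub>A\<^esub> \<oplus>\<^bsub>A\<^esub> ((a \<otimes>\<^bsub>A\<^esub> b) \<ominus>\<^bsub>A\<^esub> \<one>\<^bsub>A\<^esub>)"
    using A.m_closed[OF a b(1)] A.one_closed by algebra
  then have "a \<otimes> b = \<one> \<oplus> \<pi> \<otimes> z" unfolding z(2) using z(1) by (simp add: m_comm)
  then obtain c where c: "c \<in> carrier A" "(a \<otimes> b) \<otimes> c = \<one>" using one_plus_unit[OF z(1)] by auto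
  then have "a \<otimes> (b \<otimes> c) = \<one>" using a b by (simp add: m_assoc)
  then show "\<exists>b\<in>carrier A. a \<otimes> b = \<one>" using A_closed(2)[OF b(1) c(1)] by blast
qed

text \<open>The element divides the last nonvanishing coefficient of a monic equation that it satisfies.\<close>

lemma divides_pi_power:
  assumes a: "a \<in> carrier A" and nz: "a \<noteq> \<zero>"
  shows "\<exists>e::nat. \<exists>b\<in>carrier A. a \<otimes> b = \<pi> [^] e"
proof -
  have aK: "a \<in> carrier K" using a by simp
  have ev: "eval q a \<in> carrier A" if "set q \<subseteq> S" for q
    using that by (induction q) (auto intro!: A_closed(1) A_closed(2)[OF S_A pow_A[OF a]] A_closed(3)[simplified])
  have *: "\<exists>c\<in>carrier A. \<exists>s\<in>S. s \<noteq> \<zero> \<and> a \<otimes> c = s"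
    if "set q \<subseteq> S" "q \<noteq> []" "hd q = \<one>" "eval q a = \<zero>" for q
    using that
  proof (induction q rule: rev_induct)
    case (snoc s q)
    have q: "set q \<subseteq> S" "s \<in> S" using snoc.prems by auto
    have qK: "set q \<subseteq> carrier K" and sK: "s \<in> carrier K" using q S_carrier by blast+
    have eK: "eval q a \<in> carrier K" by (rule eval_in_carrier[OF qK aK])
    have e: "eval q a \<otimes> a \<oplus> s = \<zero>" using snoc.prems(4) eval_append_aux[OF qK sK aK] by simp
    show ?case
    proof (cases "s = \<zero>")
      case True
      then have "eval q a = \<zero>" using e eK aK nz integral by auto
      moreover have "q \<noteq> []" using snoc.prems(3) True by auto
      ultimately show ?thesis using snoc.IH q snoc.prems(3) by simp
    next
      case False
      have "a \<otimes> (\<ominus> eval q a) = s \<oplus> \<ominus> (eval q a \<otimes> a \<oplus> s)" using aK sK eK by algebra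
      then have "a \<otimes> (\<ominus> eval q a) = s" using e sK by simp
      then show ?thesis using False q minus_A[OF ev[OF q(1)]] by blast
    qed
  qed simp
  have "integral_over K S a" using a A_iff by blast
  then obtain c s where c: "c \<in> carrier A" "s \<in> S" "s \<noteq> \<zero>" "a \<otimes> c = s" using * unfolding integral_over_def by blast
  obtain k :: nat and u v where u: "u \<in> S" "v \<in> S" "s = \<pi> [^] k \<otimes> u" "u \<otimes> v = \<one>" using factor_S c by blast
  have uK: "u \<in> carrier K" "v \<in> carrier K" "\<pi> [^] k \<in> carrier K" "c \<in> carrier K" using u S_carrier c by auto
  have "a \<otimes> (c \<otimes> v) = \<pi> [^] k \<otimes> (u \<otimes> v)" using c(4) u(3) uK aK by (simp flip: m_assoc)
  then have "a \<otimes> (c \<otimes> v) = \<pi> [^] k" using u(4) uK by simp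
  then show ?thesis using A_closed(2)[OF c(1) S_A[OF u(2)]] by blast
qed

lemma A_factor:
  assumes a: "a \<in> carrier A" and nz: "a \<noteq> \<zero>"
  shows "\<exists>k::nat. \<exists>u\<in>carrier A. \<exists>v\<in>carrier A. a = \<pi> [^] k \<otimes> u \<and> u \<otimes> v = \<one>"
proof -
  have "\<exists>k::nat. \<exists>u\<in>carrier A. \<exists>v\<in>carrier A. a = \<pi> [^] k \<otimes> u \<and> u \<otimes> v = \<one>"
    if "a \<in> carrier A" "b \<in> carrier A" "a \<otimes> b = \<pi> [^] e" for a b and e :: nat
    using that
  proof (induction e arbitrary: a)
    case 0
    then show ?case by (intro exI[of _ 0] bexI[of _ a] bexI[of _ b]) auto
  next
    case (Suc e)
    show ?case
    proof (cases "\<exists>c\<in>carrier A. a \<otimes> c = \<one>")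
      case True
      then obtain c where "c \<in> carrier A" "a \<otimes> c = \<one>" by blast
      then show ?thesis using Suc.prems by (intro exI[of _ 0] bexI[of _ a] bexI[of _ c]) auto
    next
      case False
      then obtain a' where a': "a' \<in> carrier A" "a = \<pi> \<otimes> a'" using unit_or_divisible[OF Suc.prems(1)] by blast
      have K: "a' \<in> carrier K" "b \<in> carrier K" using a' Suc.prems by auto
      have "\<pi> \<otimes> (a' \<otimes> b) = \<pi> \<otimes> \<pi> [^] e"
        using Suc.prems(3) K nat_pow_Suc2[OF pi_K, of e] unfolding a'(2) by (simp add: m_assoc)
      then have "a' \<otimes> b = \<pi> [^] e" using K p_nonzero m_lcancel[of \<pi> "a' \<otimes> b" "\<pi> [^] e"] by simp
      then obtain k :: nat and u v where u: "u \<in> carrier A" "v \<in> carrier A" "a' = \<pi> [^] k \<otimes> u" "u \<otimes> v = \<one>"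
        using Suc.IH[OF a'(1) Suc.prems(2)] by blast
      have "a = \<pi> [^] Suc k \<otimes> u" unfolding a'(2) u(3) using u nat_pow_Suc2[OF pi_K, of k] by (simp add: m_assoc)
      then show ?thesis using u by blast
    qed
  qed
  then show ?thesis using divides_pi_power[OF a nz] a by blast
qed

lemma pi_power_nonzero: "\<pi> [^] (k::nat) \<noteq> \<zero>"
  using p_nonzero by (induction k) (auto simp: integral_iff)

end

text \<open>The map \<open>h\<close> takes a Cauchy sequence to its limit, embedded in \<open>K\<close>.\<close>

lemma (in padic) extension_integral_closure:
  fixes K :: "('k, 'y) ring_scheme"
  assumes ext: "finite_padic_extension p K \<iota>" and unram: "unramified p K \<iota>"
  shows "integral_closure K (\<iota> ` Zp p) p (ring_of_integers p K \<iota>)"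
proof -
  interpret K: field K using ext by (simp add: finite_padic_extension_def)
  interpret C: cring CR by (rule CR_cring)
  define h where "h = \<iota> \<circ> cls"
  have h: "h \<in> ring_hom CR K"
    unfolding h_def using ext cls_hom by (auto simp: finite_padic_extension_def intro: ring_hom_trans)
  have car: "s \<in> carrier CR \<longleftrightarrow> padic_Cauchy p s" for s by (simp add: padic_Cauchy_ring_def)
  have h_closed: "h s \<in> carrier K" if "padic_Cauchy p s" for s
    using ring_hom_closed[OF h] that car by blast
  have h_add: "h (\<lambda>n. s n + t n) = h s \<oplus>\<^bsub>K\<^esub> h t" if "padic_Cauchy p s" "padic_Cauchy p t" for s t
    using ring_hom_add[OF h, of s t] that unfolding car by (simp add: padic_Cauchy_ring_def)
  have h_mult: "h (\<lambda>n. s n * t n) = h s \<otimes>\<^bsub>K\<^esub> h t" if "padic_Cauchy p s" "padic_Cauchy p t" for s t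
    using ring_hom_mult[OF h, of s t] that unfolding car by (simp add: padic_Cauchy_ring_def)
  have h_one: "h (\<lambda>_. 1) = \<one>\<^bsub>K\<^esub>" using ring_hom_one[OF h] by (simp add: padic_Cauchy_ring_def)
  have h_zero: "h (\<lambda>_. 0) = \<zero>\<^bsub>K\<^esub>"
    using ring_hom_zero[OF h C.ring_axioms K.ring_axioms] by (simp add: padic_Cauchy_ring_def)
  have h_cong: "h s = h t" if "(\<lambda>n. s n - t n) \<in> padic_null p" for s t
  proof -
    have "cls s = cls t"
    proof (intro Set.set_eqI)
      fix r
      have m: "(\<lambda>n. - f n) \<in> padic_null p" if "f \<in> padic_null p" for f
        using that by (simp add: padic_null_def)
      show "r \<in> cls s \<longleftrightarrow> r \<in> cls t"
        using null_add[OF _ that, of "\<lambda>n. r n - s n"] null_add[OF _ m[OF that], of "\<lambda>n. r n - t n"]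
        by (auto simp: cls_mem)
    qed
    then show ?thesis by (simp add: h_def)
  qed
  have h_minus_one: "h (\<lambda>_. - 1) = \<ominus>\<^bsub>K\<^esub> \<one>\<^bsub>K\<^esub>"
    using h_add[OF Cauchy_const Cauchy_const, of "-1" 1] h_zero h_one h_closed[OF Cauchy_const, of "-1"]
    by (intro K.minus_equality[symmetric]) simp_all
  have h_of_nat: "h (\<lambda>_. of_nat n) = [n] \<cdot>\<^bsub>K\<^esub> \<one>\<^bsub>K\<^esub>" for n
  proof (induction n)
    case (Suc n)
    have "h (\<lambda>_. of_nat (Suc n)) = h (\<lambda>_. of_nat n + 1)" by (simp add: add.commute)
    also have "\<dots> = [Suc n] \<cdot>\<^bsub>K\<^esub> \<one>\<^bsub>K\<^esub>"
      unfolding h_add[OF Cauchy_const Cauchy_const] Suc h_one by simp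
    finally show ?case .
  qed (simp add: h_zero)
  have h_p_power: "h (\<lambda>_. of_nat p ^ k) = ([p] \<cdot>\<^bsub>K\<^esub> \<one>\<^bsub>K\<^esub>) [^]\<^bsub>K\<^esub> k" for k :: nat
  proof (induction k)
    case (Suc k)
    have "h (\<lambda>_. of_nat p ^ Suc k) = h (\<lambda>_. of_nat p ^ k * of_nat p)" by (simp add: mult.commute)
    also have "\<dots> = ([p] \<cdot>\<^bsub>K\<^esub> \<one>\<^bsub>K\<^esub>) [^]\<^bsub>K\<^esub> Suc k"
      unfolding h_mult[OF Cauchy_const Cauchy_const] Suc h_of_nat by simp
    finally show ?case .
  qed (simp add: h_one)
  have Zp: "\<iota> ` Zp p = h ` {s. integral_seq s}" by (simp add: Zp_eq h_def image_comp)
  have cau: "padic_Cauchy p s" if "integral_seq s" for s using that by (simp add: integral_seq_def)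
  have memI: "h s \<in> h ` {s. integral_seq s}" if "integral_seq s" for s using that by blast
  show ?thesis unfolding Zp
  proof (intro integral_closure.intro integral_closure_axioms.intro)
    show "field K" by (rule K.field_axioms)
    show "h ` {s. integral_seq s} \<subseteq> carrier K" using h_closed cau by blast
    show "\<one>\<^bsub>K\<^esub> \<in> h ` {s. integral_seq s}"
      unfolding h_one[symmetric] by (intro memI integral_seq_const) simp
    show "\<ominus>\<^bsub>K\<^esub> \<one>\<^bsub>K\<^esub> \<in> h ` {s. integral_seq s}"
      unfolding h_minus_one[symmetric] by (intro memI integral_seq_const) simp
    show "a \<oplus>\<^bsub>K\<^esub> b \<in> h ` {s. integral_seq s}"
      if "a \<in> h ` {s. integral_seq s}" "b \<in> h ` {s. integral_seq s}" for a b
      using that memI[OF integral_seq_add] by (auto simp: h_add cau)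
    show "a \<otimes>\<^bsub>K\<^esub> b \<in> h ` {s. integral_seq s}"
      if "a \<in> h ` {s. integral_seq s}" "b \<in> h ` {s. integral_seq s}" for a b
      using that memI[OF integral_seq_mult] by (auto simp: h_mult cau)
    show "\<exists>k::nat. \<exists>u\<in>h ` {s. integral_seq s}. \<exists>w\<in>h ` {s. integral_seq s}.
        a = ([p] \<cdot>\<^bsub>K\<^esub> \<one>\<^bsub>K\<^esub>) [^]\<^bsub>K\<^esub> k \<otimes>\<^bsub>K\<^esub> u \<and> u \<otimes>\<^bsub>K\<^esub> w = \<one>\<^bsub>K\<^esub>"
      if a: "a \<in> h ` {s. integral_seq s}" "a \<noteq> \<zero>\<^bsub>K\<^esub>" for a
    proof -
      obtain s where s: "integral_seq s" "a = h s" using a(1) by blast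
      have "s \<notin> padic_null p" using h_cong[of s "\<lambda>_. 0"] s(2) a(2) h_zero by auto
      then obtain k u w where u: "integral_seq u" "integral_seq w"
        "(\<lambda>n. s n - of_nat p ^ k * u n) \<in> padic_null p" "(\<lambda>n. u n * w n - 1) \<in> padic_null p"
        using integral_seq_factor[OF s(1)] by metis
      have "a = ([p] \<cdot>\<^bsub>K\<^esub> \<one>\<^bsub>K\<^esub>) [^]\<^bsub>K\<^esub> k \<otimes>\<^bsub>K\<^esub> h u"
        using h_cong[OF u(3)] h_mult[OF Cauchy_const cau[OF u(1)], of "of_nat p ^ k"] s(2) h_p_power[of k] by simp
      moreover have "h u \<otimes>\<^bsub>K\<^esub> h w = \<one>\<^bsub>K\<^esub>"
        using h_cong[OF u(4)] h_mult[OF cau[OF u(1)] cau[OF u(2)]] h_one by simp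
      ultimately show ?thesis using memI[OF u(1)] memI[OF u(2)] by blast
    qed
    show "[p] \<cdot>\<^bsub>K\<^esub> \<one>\<^bsub>K\<^esub> \<noteq> \<zero>\<^bsub>K\<^esub>"
    proof
      assume 0: "[p] \<cdot>\<^bsub>K\<^esub> \<one>\<^bsub>K\<^esub> = \<zero>\<^bsub>K\<^esub>"
      have "h (\<lambda>_. of_nat p * inverse (of_nat p)) = \<zero>\<^bsub>K\<^esub> \<otimes>\<^bsub>K\<^esub> h (\<lambda>_. inverse (of_nat p))"
        unfolding h_mult[OF Cauchy_const Cauchy_const] h_of_nat 0 ..
      then have "h (\<lambda>_. 1) = \<zero>\<^bsub>K\<^esub>" using prime_gt_0_nat[OF p] h_closed[OF Cauchy_const] by simp
      then show False using h_one K.one_not_zero by simp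
    qed
    show "ring_of_integers p K \<iota> = K\<lparr>carrier := {x \<in> carrier K. integral_over K (h ` {s. integral_seq s}) x}\<rparr>"
      by (simp add: ring_of_integers_def Zp)
    show "maximalideal (PIdl\<^bsub>ring_of_integers p K \<iota>\<^esub> ([p] \<cdot>\<^bsub>ring_of_integers p K \<iota>\<^esub> \<one>\<^bsub>ring_of_integers p K \<iota>\<^esub>)) (ring_of_integers p K \<iota>)"
      using unram by (simp add: unramified_def Let_def)
  qed
qed

theorem theorem1p1:
  fixes p :: nat
    and C :: "('c, 'x) monoid_scheme"
    and K :: "('k, 'y) ring_scheme"
    and \<iota> :: "(nat \<Rightarrow> rat) set \<Rightarrow> 'k"
    and A :: "('k, 'y) ring_scheme"
    and M :: "('c \<Rightarrow> 'k, 'm, 'z) module_scheme"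
  assumes "Factorial_Ring.prime p"
    and "group C" and "order C = p"
    and "finite_padic_extension p K \<iota>" and "unramified p K \<iota>"
    and "A = ring_of_integers p K \<iota>"
    and "module (group_ring A C) M" and "finite (carrier M)"
  shows "card (carrier M)
           \<le> card (carrier (group_ring A C Quot fitting_ideal (group_ring A C) M)) \<and>
         (principalideal (fitting_ideal (group_ring A C) M) (group_ring A C) \<longrightarrow>
           card (carrier M)
             = card (carrier (group_ring A C Quot fitting_ideal (group_ring A C) M)))"
proof -
  interpret padic p by unfold_locales (rule assms(1))
  interpret I: integral_closure K "\<iota> ` Zp p" p A
    unfolding assms(6) by (rule extension_integral_closure[OF assms(4,5)])
  interpret M: module "group_ring A C" M by (rule assms(7))
  interpret G: group_ring_prime_order A C p
  proof (intro group_ring_prime_order.intro group_ring_prime_order_axioms.intro)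
    show "cring A" by (rule I.A_cring)
    show "group C" by (rule assms(2))
    show "cring (group_ring A C)" by unfold_locales
    show "Factorial_Ring.prime p" "order C = p" by (rule assms(1,3))+
    show "\<exists>k::nat. \<exists>u\<in>carrier A. \<exists>v\<in>carrier A.
        a = ([p] \<cdot>\<^bsub>A\<^esub> \<one>\<^bsub>A\<^esub>) [^]\<^bsub>A\<^esub> k \<otimes>\<^bsub>A\<^esub> u \<and> u \<otimes>\<^bsub>A\<^esub> v = \<one>\<^bsub>A\<^esub>"
      if a: "a \<in> carrier A" "a \<noteq> \<zero>\<^bsub>A\<^esub>" for a
      using I.A_factor[OF a[unfolded I.A_simps]] by (simp only: I.A_simps I.A_pi[unfolded I.A_simps] I.A_pow)
    show "[p] \<cdot>\<^bsub>A\<^esub> \<one>\<^bsub>A\<^esub> \<otimes>\<^bsub>A\<^esub> a \<noteq> \<one>\<^bsub>A\<^esub>" if "a \<in> carrier A" for a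
      using I.pi_nonunit[OF that] by (simp only: not_False_eq_True I.A_simps I.A_pi[unfolded I.A_simps])
    show "([p] \<cdot>\<^bsub>A\<^esub> \<one>\<^bsub>A\<^esub>) [^]\<^bsub>A\<^esub> k \<noteq> \<zero>\<^bsub>A\<^esub>" for k :: nat
      using I.pi_power_nonzero[of k] by (simp only: not_False_eq_True I.A_simps I.A_pi[unfolded I.A_simps] I.A_pow)
  qed
  obtain x y where "node (lifted_cring.ker (group_ring A C)) x y" using G.lifted_node by blast
  then show ?thesis by (rule fitting_index_of_node[OF assms(7,8)])
qed

end
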